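(* Under rerandomization using the Mahalanobis distance (ReFM) with threshold $a>0$, and for a sequence of finite populations satisfying the regularity conditions (i)–(iii) below, $$\hat{\boldsymbol{\tau}}-\boldsymbol{\tau}\mid\mathcal{M}\ \dot\sim\ (\boldsymbol{V}^{\perp}_{\tau\tau})^{1/2}\boldsymbol{\varepsilon}+(\boldsymbol{V}^{\parallel}_{\tau\tau})^{1/2}_{LF}\boldsymbol{\zeta}_{LF,a},$$ where $\boldsymbol{\varepsilon}\sim\mathcal{N}(\boldsymbol{0},\boldsymbol{I}_F)$ and $\boldsymbol{\zeta}_{LF,a}$ are independent.
   Context: Setup ($2^K$ factorial experiment, finite population). $K\ge1$ two-level factors, $Q=2^K$ treatment combinations $q=1,\dots,Q$; combination $q$ sets factor $k$ at $\iota_k(q)\in\{-1,+1\}$, bijectively onto $\{-1,+1\}^K$. $F=Q-1$ factorial effects, one per nonempty $A\subseteq\{1,\dots,K\}$, enumerated $f=1,\dots,F$, with $g_{fq}=\prod_{k\in A}\iota_k(q)$; $\boldsymbol{b}_q=(g_{1q},\dots,g_{Fq})'$. Units $i=1,\dots,n$ have fixed potential outcomes $Y_i(q)$ and covariates $\boldsymbol{x}_i\in\mathbb{R}^L$; $\bar Y(q),\bar{\boldsymbol{x}}$ means; $\boldsymbol{\tau}_i=2^{-(K-1)}\sum_q\boldsymbol{b}_qY_i(q)$, $\boldsymbol{\tau}=2^{-(K-1)}\sum_q\boldsymbol{b}_q\bar Y(q)$. Finite-population (co)variances with divisor $n-1$: $S_{qk}$ between $Y(q),Y(k)$; $\boldsymbol{S}_{xx}$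 of $\boldsymbol{x}$; $\boldsymbol{S}_{q,x}=\boldsymbol{S}_{x,q}'$ between $Y(q)$ and $\boldsymbol{x}$. CRFE: fixed $n_q\ge1$, $\sum n_q=n$; $\boldsymbol{Z}$ uniform over assignments with $n_q$ units in combination $q$. $\hat{\bar Y}(q)$, $\hat{\bar{\boldsymbol{x}}}(q)$ are group-$q$ means of observed outcomes $Y_i(Z_i)$ and covariates; $\hat{\boldsymbol{\tau}}=2^{-(K-1)}\sum_q\boldsymbol{b}_q\hat{\bar Y}(q)$; $\hat{\boldsymbol{\tau}}_x=(\hat{\boldsymbol{\tau}}_{x,1}',\dots,\hat{\boldsymbol{\tau}}_{x,F}')'$ with $\hat{\boldsymbol{\tau}}_{x,f}=2^{-(K-1)}\sum_qg_{fq}\hat{\bar{\boldsymbol{x}}}(q)$. $\boldsymbol{V}_{xx}=2^{-2(K-1)}\sum_qn_q^{-1}(\boldsymbol{b}_q\boldsymbol{b}_q')\otimes\boldsymbol{S}_{xx}$. ReFM: with $M=\hat{\boldsymbol{\tau}}_x'\boldsymbol{V}_{xx}^{-1}\hat{\boldsymbol{\tau}}_x$, the assignment is accepted iff $M\le a$; $\mathcal{M}$ denotes this event, and the distribution under ReFM is the CRFE distribution conditional on $\mathcal{M}$. Linear projections: $Y_i^{\parallel}(q)=\bar Y(q)+\boldsymbol{S}_{q,x}\boldsymbol{S}_{xx}^{-1}(\boldsymbol{x}_i-\bar{\boldsymbol{x}})$, $Y_i^{\perp}(q)=Y_i(q)-Y_i^{\parallel}(q)$; $\boldsymbol{\tau}_i^{\parallel},\boldsymbol{\tau}_i^{\perp}$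 defined from them like $\boldsymbol{\tau}_i$. $S^{\parallel}_{qq},S^{\perp}_{qq},\boldsymbol{S}^{\parallel}_{\tau\tau},\boldsymbol{S}^{\perp}_{\tau\tau}$ are the finite-population variances (divisor $n-1$) of $Y^{\parallel}(q),Y^{\perp}(q),\boldsymbol{\tau}^{\parallel},\boldsymbol{\tau}^{\perp}$. $\boldsymbol{V}^{\parallel}_{\tau\tau}=2^{-2(K-1)}\sum_qn_q^{-1}\boldsymbol{b}_q\boldsymbol{b}_q'S^{\parallel}_{qq}-n^{-1}\boldsymbol{S}^{\parallel}_{\tau\tau}$, $\boldsymbol{V}^{\perp}_{\tau\tau}=2^{-2(K-1)}\sum_qn_q^{-1}\boldsymbol{b}_q\boldsymbol{b}_q'S^{\perp}_{qq}-n^{-1}\boldsymbol{S}^{\perp}_{\tau\tau}$. Matrix roots: $\boldsymbol{A}^{1/2}$ is the symmetric PSD square root; for PSD $\boldsymbol{A}\in\mathbb{R}^{m\times m}$ and $p\ge\mathrm{rank}(\boldsymbol{A})$, $\boldsymbol{A}^{1/2}_p$ denotes any $m\times p$ matrix with $\boldsymbol{A}^{1/2}_p(\boldsymbol{A}^{1/2}_p)'=\boldsymbol{A}$. Truncated Gaussian: $\boldsymbol{\zeta}_{m,a}\sim\boldsymbol{D}\mid\boldsymbol{D}'\boldsymbol{D}\le a$ with $\boldsymbol{D}\sim\mathcal{N}(\boldsymbol{0},\boldsymbol{I}_m)$. Asymptotic regime: $n\to\infty$ along a sequence of finite populations with, for all $q\ne k$: (i) $n_q/n$ has a positive limit; (ii)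 $S_{qq},S_{qk},\boldsymbol{S}_{xx},\boldsymbol{S}_{q,x}$ have limits, $\boldsymbol{S}_{xx}$ and its limit nonsingular; (iii) $\max_i|Y_i(q)-\bar Y(q)|^2/n\to0$, $\max_i\|\boldsymbol{x}_i-\bar{\boldsymbol{x}}\|_2^2/n\to0$. $\boldsymbol{A}_n\dot\sim\boldsymbol{B}_n$ means $\sqrt n\boldsymbol{A}_n$ and $\sqrt n\boldsymbol{B}_n$ converge weakly to the same distribution. *)

theory Defs
  imports "HOL-Probability.Probability"
begin

definition outerp :: "real^'a \<Rightarrow> real^'b \<Rightarrow> real^'b^'a" where
  "outerp u v = (\<chi> r c. u $ r * v $ c)"

definition pmean :: "nat \<Rightarrow> (nat \<Rightarrow> 'a::real_vector) \<Rightarrow> 'a" where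
  "pmean n y = (1 / real n) *\<^sub>R (\<Sum>i<n. y i)"

definition pcov :: "nat \<Rightarrow> (nat \<Rightarrow> real) \<Rightarrow> (nat \<Rightarrow> real) \<Rightarrow> real" where
  "pcov n y w = (\<Sum>i<n. (y i - pmean n y) * (w i - pmean n w)) / (real n - 1)"

text \<open>finite-population covariance of a scalar with a vector (the row S_{q,x}, stored as a vector)\<close>
definition pcov_sv :: "nat \<Rightarrow> (nat \<Rightarrow> real) \<Rightarrow> (nat \<Rightarrow> real^'l) \<Rightarrow> real^'l" where
  "pcov_sv n y x = (1 / (real n - 1)) *\<^sub>R (\<Sum>i<n. (y i - pmean n y) *\<^sub>R (x i - pmean n x))"

definition pcov_mat :: "nat \<Rightarrow> (nat \<Rightarrow> real^'a) \<Rightarrow> real^'a^'a" where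
  "pcov_mat n x = (1 / (real n - 1)) *\<^sub>R (\<Sum>i<n. outerp (x i - pmean n x) (x i - pmean n x))"

text \<open>Factors indexed by the finite type 'k (K = CARD('k)), treatment combinations by the
  finite type 'q, factorial effects by the finite type 'f. iota q k is the level of factor k
  under combination q; eff f is the (nonempty) set of factors defining effect f.\<close>

definition gcoef :: "('q \<Rightarrow> 'k::finite \<Rightarrow> real) \<Rightarrow> ('f \<Rightarrow> 'k set) \<Rightarrow> 'f \<Rightarrow> 'q \<Rightarrow> real" where
  "gcoef iota eff f q = (\<Prod>k\<in>eff f. iota q k)"

definition bvec :: "('q \<Rightarrow> 'k::finite \<Rightarrow> real) \<Rightarrow> ('f::finite \<Rightarrow> 'k set) \<Rightarrow> 'q \<Rightarrow> real^'f" where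
  "bvec iota eff q = (\<chi> f. gcoef iota eff f q)"

definition valid_design :: "('q::finite \<Rightarrow> 'k::finite \<Rightarrow> real) \<Rightarrow> ('f::finite \<Rightarrow> 'k set) \<Rightarrow> bool" where
  "valid_design iota eff \<longleftrightarrow>
     bij_betw iota UNIV (Pi UNIV (\<lambda>_. {-1, 1})) \<and> bij_betw eff UNIV {A. A \<noteq> {}}"

definition tau_i :: "('q::finite \<Rightarrow> 'k::finite \<Rightarrow> real) \<Rightarrow> ('f::finite \<Rightarrow> 'k set)
     \<Rightarrow> (nat \<Rightarrow> 'q \<Rightarrow> real) \<Rightarrow> nat \<Rightarrow> real^'f" where
  "tau_i iota eff Y i = (1 / 2 ^ (CARD('k) - 1)) *\<^sub>R (\<Sum>q\<in>UNIV. Y i q *\<^sub>R bvec iota eff q)"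

definition tau_pop :: "('q::finite \<Rightarrow> 'k::finite \<Rightarrow> real) \<Rightarrow> ('f::finite \<Rightarrow> 'k set)
     \<Rightarrow> nat \<Rightarrow> (nat \<Rightarrow> 'q \<Rightarrow> real) \<Rightarrow> real^'f" where
  "tau_pop iota eff n Y = (1 / 2 ^ (CARD('k) - 1)) *\<^sub>R (\<Sum>q\<in>UNIV. pmean n (\<lambda>i. Y i q) *\<^sub>R bvec iota eff q)"

definition Vmat :: "('q::finite \<Rightarrow> 'k::finite \<Rightarrow> real) \<Rightarrow> ('f::finite \<Rightarrow> 'k set)
     \<Rightarrow> nat \<Rightarrow> ('q \<Rightarrow> nat) \<Rightarrow> (nat \<Rightarrow> 'q \<Rightarrow> real) \<Rightarrow> real^'f^'f" where
  "Vmat iota eff n nq Y =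
     (1 / 2 ^ (2 * (CARD('k) - 1))) *\<^sub>R
       (\<Sum>q\<in>UNIV. (pcov n (\<lambda>i. Y i q) (\<lambda>i. Y i q) / real (nq q)) *\<^sub>R
                   outerp (bvec iota eff q) (bvec iota eff q))
     - (1 / real n) *\<^sub>R pcov_mat n (tau_i iota eff Y)"

definition Ypar :: "nat \<Rightarrow> (nat \<Rightarrow> 'q \<Rightarrow> real) \<Rightarrow> (nat \<Rightarrow> real^'l::finite) \<Rightarrow> nat \<Rightarrow> 'q \<Rightarrow> real" where
  "Ypar n Y x i q = pmean n (\<lambda>j. Y j q)
      + pcov_sv n (\<lambda>j. Y j q) x \<bullet> (matrix_inv (pcov_mat n x) *v (x i - pmean n x))"

definition Yperp :: "nat \<Rightarrow> (nat \<Rightarrow> 'q \<Rightarrow> real) \<Rightarrow> (nat \<Rightarrow> real^'l::finite) \<Rightarrow> nat \<Rightarrow> 'q \<Rightarrow> real" where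
  "Yperp n Y x i q = Y i q - Ypar n Y x i q"

text \<open>V_xx = 2^{-2(K-1)} sum_q n_q^{-1} (b_q b_q') \<otimes> S_xx, indexed by pairs (f,l)
  (the stacking order of tau_x: effect-major)\<close>
definition Vxx :: "('q::finite \<Rightarrow> 'k::finite \<Rightarrow> real) \<Rightarrow> ('f::finite \<Rightarrow> 'k set)
     \<Rightarrow> nat \<Rightarrow> ('q \<Rightarrow> nat) \<Rightarrow> (nat \<Rightarrow> real^'l::finite) \<Rightarrow> real^('f \<times> 'l)^('f \<times> 'l)" where
  "Vxx iota eff n nq x =
     (\<chi> r c. (1 / 2 ^ (2 * (CARD('k) - 1))) *
        (\<Sum>q\<in>UNIV. (1 / real (nq q)) * gcoef iota eff (fst r) q * gcoef iota eff (fst c) q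
                      * pcov_mat n x $ snd r $ snd c))"

definition assignments :: "nat \<Rightarrow> ('q \<Rightarrow> nat) \<Rightarrow> (nat \<Rightarrow> 'q) set" where
  "assignments n nq = {z. (\<forall>i. n \<le> i \<longrightarrow> z i = undefined) \<and> (\<forall>q. card {i. i < n \<and> z i = q} = nq q)}"

definition CRFE :: "nat \<Rightarrow> ('q \<Rightarrow> nat) \<Rightarrow> (nat \<Rightarrow> 'q) pmf" where
  "CRFE n nq = pmf_of_set (assignments n nq)"

definition grp_mean :: "nat \<Rightarrow> ('q \<Rightarrow> nat) \<Rightarrow> (nat \<Rightarrow> 'q) \<Rightarrow> (nat \<Rightarrow> 'a::real_vector) \<Rightarrow> 'q \<Rightarrow> 'a" where
  "grp_mean n nq z w q = (1 / real (nq q)) *\<^sub>R (\<Sum>i\<in>{i. i < n \<and> z i = q}. w i)"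

definition tau_hat :: "('q::finite \<Rightarrow> 'k::finite \<Rightarrow> real) \<Rightarrow> ('f::finite \<Rightarrow> 'k set)
     \<Rightarrow> nat \<Rightarrow> ('q \<Rightarrow> nat) \<Rightarrow> (nat \<Rightarrow> 'q \<Rightarrow> real) \<Rightarrow> (nat \<Rightarrow> 'q) \<Rightarrow> real^'f" where
  "tau_hat iota eff n nq Y z = (1 / 2 ^ (CARD('k) - 1)) *\<^sub>R
      (\<Sum>q\<in>UNIV. grp_mean n nq z (\<lambda>i. Y i (z i)) q *\<^sub>R bvec iota eff q)"

definition tau_hat_x :: "('q::finite \<Rightarrow> 'k::finite \<Rightarrow> real) \<Rightarrow> ('f::finite \<Rightarrow> 'k set)
     \<Rightarrow> nat \<Rightarrow> ('q \<Rightarrow> nat) \<Rightarrow> (nat \<Rightarrow> real^'l::finite) \<Rightarrow> (nat \<Rightarrow> 'q) \<Rightarrow> real^('f \<times> 'l)" where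
  "tau_hat_x iota eff n nq x z = (\<chi> r. (1 / 2 ^ (CARD('k) - 1)) *
      (\<Sum>q\<in>UNIV. gcoef iota eff (fst r) q * grp_mean n nq z x q $ snd r))"

definition mahal :: "('q::finite \<Rightarrow> 'k::finite \<Rightarrow> real) \<Rightarrow> ('f::finite \<Rightarrow> 'k set)
     \<Rightarrow> nat \<Rightarrow> ('q \<Rightarrow> nat) \<Rightarrow> (nat \<Rightarrow> real^'l::finite) \<Rightarrow> (nat \<Rightarrow> 'q) \<Rightarrow> real" where
  "mahal iota eff n nq x z =
     tau_hat_x iota eff n nq x z \<bullet> (matrix_inv (Vxx iota eff n nq x) *v tau_hat_x iota eff n nq x z)"

definition ReFM :: "('q::finite \<Rightarrow> 'k::finite \<Rightarrow> real) \<Rightarrow> ('f::finite \<Rightarrow> 'k set)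
     \<Rightarrow> nat \<Rightarrow> ('q \<Rightarrow> nat) \<Rightarrow> (nat \<Rightarrow> real^'l::finite) \<Rightarrow> real \<Rightarrow> (nat \<Rightarrow> 'q) pmf" where
  "ReFM iota eff n nq x a = cond_pmf (CRFE n nq) {z. mahal iota eff n nq x z \<le> a}"

definition std_gauss :: "(real^'d) measure" where
  "std_gauss = density lborel (\<lambda>v. ennreal (\<Prod>i\<in>UNIV. std_normal_density (v $ i)))"

definition trunc_gauss :: "real \<Rightarrow> (real^'d) measure" where
  "trunc_gauss a = uniform_measure std_gauss {d. d \<bullet> d \<le> a}"

definition psd_mat :: "real^'n^'n \<Rightarrow> bool" where
  "psd_mat A \<longleftrightarrow> transpose A = A \<and> (\<forall>v. 0 \<le> v \<bullet> (A *v v))"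

definition mat_sqrt :: "real^'n^'n \<Rightarrow> real^'n^'n" where
  "mat_sqrt A = (THE R. psd_mat R \<and> R ** R = A)"

definition weak_conv_to :: "(nat \<Rightarrow> 'a::euclidean_space measure) \<Rightarrow> 'a measure \<Rightarrow> bool" where
  "weak_conv_to Ms M \<longleftrightarrow>
     (\<forall>f :: 'a \<Rightarrow> real. continuous_on UNIV f \<longrightarrow> bounded (range f) \<longrightarrow>
        (\<lambda>m. integral\<^sup>L (Ms m) f) \<longlonglongrightarrow> integral\<^sup>L M f)"

end

theory Submission
  imports Defs
begin

text \<open>The joint law of the estimation error and the covariate contrasts under complete randomization is
  treated with characteristic functions. A uniform assignment with fixed group sizes is an
  independent multinomial assignment conditioned on its counts, so the characteristic function of a sum
  \<open>\<Sum>i. A i (z i)\<close> is a ratio of two Fourier integrals over the count frequencies (Erdos and Renyi). When each column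
  of \<open>A\<close> is centred, the covariance between the sum and the counts vanishes, the limiting Gaussian integrand
  factorizes, and the integrals over the frequencies cancel in the ratio.

  The regression part of the estimation error is a linear function of \<open>tau_hat_x\<close>, while the residual part is
  asymptotically independent of it. After whitening, the acceptance event is a ball, and the limiting
  characteristic function in direction \<open>u\<close> is \<open>exp (- u'V_perp u / 2)\<close> times the characteristic function of a Gaussian
  vector conditioned on a ball, which is radial. Hence it depends on the factor \<open>C\<close> of \<open>V_par\<close> only through
  \<open>u'V_par u = |C'u|\<^sup>2\<close>. Levy's continuity theorem, proved by Gaussian smoothing, gives the weak limits.\<close>

section \<open>Standard Gaussian vectors\<close>

lemma integral_lborel_affine:
  fixes f :: "'a::euclidean_space \<Rightarrow> 'b::{banach, second_countable_topology}"
  assumes c: "c \<noteq> 0" and f: "integrable lborel f"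
  shows "(\<integral>y. f y \<partial>lborel) = \<bar>c\<bar> ^ DIM('a) *\<^sub>R (\<integral>z. f (t + c *\<^sub>R z) \<partial>lborel)"
proof -
  have [measurable]: "f \<in> borel_measurable borel"
    using borel_measurable_integrable[OF f] by simp
  show ?thesis
    by (subst lborel_affine[OF c, of t]) (simp add: integral_density integral_distr)
qed

lemma measurable_vec_lambda [measurable]:
  "(\<lambda>f. (\<chi> i. f i) :: real^'d) \<in> PiM UNIV (\<lambda>_. lborel) \<rightarrow>\<^sub>M borel"
  unfolding borel_measurable_euclidean_space[where 'c="real^'d"]
  by (auto simp: Basis_vec_def inner_axis)

lemma lborel_vec:
  "(lborel :: (real^'d) measure) = distr (PiM UNIV (\<lambda>_. lborel)) borel (\<lambda>f. \<chi> i. f i)"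
proof (rule lborel_eqI)
  interpret product_sigma_finite "\<lambda>_::'d. lborel :: real measure" ..
  interpret finite_product_sigma_finite "\<lambda>_::'d. lborel :: real measure" UNIV
    by standard auto
  fix l u :: "real^'d" assume le: "\<And>b. b \<in> Basis \<Longrightarrow> l \<bullet> b \<le> u \<bullet> b"
  have le': "l $ i \<le> u $ i" for i
    using le[of "axis i 1"] by (auto simp: Basis_vec_def inner_axis)
  have "(\<lambda>f. (\<chi> i. f i) :: real^'d) -` box l u \<inter> space (PiM UNIV (\<lambda>_. lborel)) =
      (\<Pi>\<^sub>E i\<in>UNIV. {l $ i <..< u $ i})"
    by (auto simp: mem_box_cart PiE_def Pi_def extensional_def space_PiM)
  then have "emeasure (distr (PiM UNIV (\<lambda>_. lborel)) borel (\<lambda>f. (\<chi> i. f i) :: real^'d)) (box l u)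
      = (\<Prod>i\<in>UNIV. ennreal (u $ i - l $ i))"
    by (simp add: emeasure_distr emeasure_PiM le')
  also have "\<dots> = ennreal (\<Prod>i\<in>UNIV. u $ i - l $ i)"
    using le' by (simp add: prod_ennreal)
  also have "(\<Prod>i\<in>UNIV. u $ i - l $ i) = (\<Prod>b\<in>Basis. (u - l) \<bullet> b)"
  proof -
    have B: "Basis = (\<lambda>i::'d. axis i (1::real)) ` UNIV" by (auto simp: Basis_vec_def)
    have "inj (\<lambda>i::'d. axis i (1::real))" by (auto intro!: injI simp: axis_eq_axis)
    then show ?thesis unfolding B
      by (subst prod.reindex) (auto simp: inner_axis)
  qed
  finally show "emeasure (distr (PiM UNIV (\<lambda>_. lborel)) borel (\<lambda>f. (\<chi> i. f i) :: real^'d)) (box l u)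
      = (\<Prod>b\<in>Basis. (u - l) \<bullet> b)" by simp
qed simp

lemma
  fixes f :: "'d::finite \<Rightarrow> real \<Rightarrow> 'a::{real_normed_field,banach,second_countable_topology}"
  assumes f: "\<And>i. integrable lborel (f i)"
  shows integrable_prod_vec: "integrable lborel (\<lambda>v::real^'d. \<Prod>i\<in>UNIV. f i (v $ i))"
    and integral_prod_vec: "(\<integral>v. (\<Prod>i\<in>UNIV. f i (v $ i)) \<partial>(lborel :: (real^'d) measure)) = (\<Prod>i\<in>UNIV. integral\<^sup>L lborel (f i))"
proof -
  interpret product_sigma_finite "\<lambda>_::'d. lborel :: real measure" ..
  have [measurable]: "f i \<in> borel_measurable borel" for i
    using borel_measurable_integrable[OF f] by simp
  show "integrable lborel (\<lambda>v::real^'d. \<Prod>i\<in>UNIV. f i (v $ i))"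
    unfolding lborel_vec
    by (subst integrable_distr_eq) (auto intro!: product_integrable_prod f)
  show "(\<integral>v. (\<Prod>i\<in>UNIV. f i (v $ i)) \<partial>(lborel :: (real^'d) measure)) = (\<Prod>i\<in>UNIV. integral\<^sup>L lborel (f i))"
    unfolding lborel_vec
    by (subst integral_distr) (auto intro!: product_integral_prod f)
qed

lemma std_normal_density_integrable: "integrable lborel std_normal_density"
  by (simp add: integrable_normal_density)

lemma integral_std_normal_density: "integral\<^sup>L lborel std_normal_density = 1"
  by (simp add: integral_normal_density)

definition gauss_dens :: "real^'d \<Rightarrow> real" where
  "gauss_dens v = (\<Prod>i\<in>UNIV. std_normal_density (v $ i))"

lemma gauss_dens_nonneg [simp]: "0 \<le> gauss_dens v"
  unfolding gauss_dens_def by (intro prod_nonneg) auto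

lemma gauss_dens_measurable [measurable]: "gauss_dens \<in> borel_measurable borel"
  unfolding gauss_dens_def by measurable

lemma std_gauss_eq: "std_gauss = density lborel (\<lambda>v. ennreal (gauss_dens v))"
  by (simp add: std_gauss_def gauss_dens_def)

lemma sets_std_gauss [measurable_cong, simp]: "sets std_gauss = sets borel"
  by (simp add: std_gauss_eq)

lemma space_std_gauss [simp]: "space std_gauss = UNIV"
  by (simp add: std_gauss_eq)

lemma gauss_dens_integrable: "integrable lborel gauss_dens"
  unfolding gauss_dens_def by (intro integrable_prod_vec std_normal_density_integrable)

lemma prob_space_std_gauss: "prob_space (std_gauss :: (real^'d) measure)"
proof
  have "emeasure (std_gauss :: (real^'d) measure) (space std_gauss) = (\<integral>\<^sup>+v. ennreal (gauss_dens (v::real^'d)) \<partial>lborel)"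
    by (simp add: std_gauss_eq emeasure_density)
  also have "\<dots> = ennreal (\<integral>v. gauss_dens v \<partial>(lborel :: (real^'d) measure))"
    by (rule nn_integral_eq_integral[OF gauss_dens_integrable]) simp
  also have "(\<integral>v. gauss_dens v \<partial>(lborel :: (real^'d) measure)) = 1"
    unfolding gauss_dens_def
    by (subst integral_prod_vec[OF std_normal_density_integrable]) (simp add: integral_std_normal_density)
  finally show "emeasure (std_gauss :: (real^'d) measure) (space std_gauss) = 1" by simp
qed

interpretation std_gauss: prob_space std_gauss by (rule prob_space_std_gauss)

lemma integral_std_gauss:
  fixes f :: "real^'d \<Rightarrow> 'b::{banach, second_countable_topology}"
  assumes [measurable]: "f \<in> borel_measurable borel"
  shows "integral\<^sup>L std_gauss f = (\<integral>v. gauss_dens v *\<^sub>R f v \<partial>lborel)"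
  unfolding std_gauss_eq by (subst integral_density) auto

lemma gauss_dens_eq: "gauss_dens (v::real^'d) = exp (- (norm v)\<^sup>2 / 2) / sqrt (2 * pi) ^ CARD('d)"
proof -
  have "gauss_dens v = (\<Prod>i\<in>UNIV. exp (- (v $ i)\<^sup>2 / 2) / sqrt (2 * pi))"
    by (simp add: gauss_dens_def std_normal_density_def)
  also have "\<dots> = exp (\<Sum>i\<in>UNIV. - (v $ i)\<^sup>2 / 2) / sqrt (2 * pi) ^ CARD('d)"
    by (simp add: prod_dividef exp_sum)
  also have "(\<Sum>i\<in>UNIV. - (v $ i)\<^sup>2 / 2) = - (norm v)\<^sup>2 / 2"
    unfolding power2_norm_eq_inner
    by (simp add: inner_vec_def sum_negf sum_divide_distrib[symmetric] power2_eq_square)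
  finally show ?thesis .
qed

lemma iexp_sum: "finite I \<Longrightarrow> iexp (\<Sum>i\<in>I. f i) = (\<Prod>i\<in>I. iexp (f i))"
  by (induction I rule: finite_induct) (auto simp: algebra_simps exp_add)

lemma iexp_measurable [measurable]: "f \<in> borel_measurable M \<Longrightarrow> (\<lambda>x. iexp (f x)) \<in> borel_measurable M"
  by simp

lemma char_std_gauss:
  fixes w :: "real^'d"
  shows "(\<integral>v. iexp (w \<bullet> v) \<partial>std_gauss) = of_real (exp (- (norm w)\<^sup>2 / 2))"
proof -
  have int: "integrable lborel (\<lambda>t. std_normal_density t *\<^sub>R iexp (s * t))" for s
    by (rule Bochner_Integration.integrable_bound[OF std_normal_density_integrable])
       (auto simp: norm_mult)
  have 1: "(\<integral>t. std_normal_density t *\<^sub>R iexp (s * t) \<partial>lborel) = of_real (exp (- s\<^sup>2 / 2))" for s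
  proof -
    have "char std_normal_distribution s = (\<integral>t. std_normal_density t *\<^sub>R iexp (s * t) \<partial>lborel)"
      unfolding char_def by (subst integral_density) auto
    then show ?thesis using char_std_normal_distribution by (simp add: fun_eq_iff)
  qed
  have "(\<integral>v. iexp (w \<bullet> v) \<partial>std_gauss) = (\<integral>v. gauss_dens v *\<^sub>R iexp (w \<bullet> v) \<partial>lborel)"
    by (rule integral_std_gauss) simp
  also have "\<dots> = (\<integral>v. (\<Prod>i\<in>UNIV. std_normal_density (v $ i) *\<^sub>R iexp (w $ i * v $ i)) \<partial>lborel)"
    by (intro Bochner_Integration.integral_cong refl)
       (simp add: gauss_dens_def inner_vec_def scaleR_conv_of_real prod.distrib iexp_sum del: of_real_sum)
  also have "\<dots> = (\<Prod>i\<in>UNIV. of_real (exp (- (w $ i)\<^sup>2 / 2)))"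
    by (subst integral_prod_vec[OF int]) (simp only: 1)
  also have "\<dots> = of_real (exp (\<Sum>i\<in>UNIV. - (w $ i)\<^sup>2 / 2))"
    by (simp add: exp_sum)
  also have "(\<Sum>i\<in>UNIV. - (w $ i)\<^sup>2 / 2) = - (norm w)\<^sup>2 / 2"
    unfolding power2_norm_eq_inner
    by (simp add: inner_vec_def sum_negf sum_divide_distrib[symmetric] power2_eq_square)
  finally show ?thesis .
qed

section \<open>Weak convergence from characteristic functions\<close>

lemma integrable_pair_fst:
  fixes g :: "'a \<Rightarrow> 'b::{banach, second_countable_topology}"
  assumes P: "sigma_finite_measure P" and N: "prob_space N" and g: "integrable P g"
  shows "integrable (P \<Otimes>\<^sub>M N) (\<lambda>x. g (fst x))"
proof -
  interpret P: sigma_finite_measure P by fact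
  interpret N: prob_space N by fact
  interpret pair_sigma_finite P N ..
  have [measurable]: "g \<in> borel_measurable P" using g by auto
  show ?thesis
    by (rule Fubini_integrable) (use g in \<open>auto simp: N.prob_space\<close>)
qed

lemma integrable_pair_snd:
  fixes g :: "'a \<Rightarrow> 'b::{banach, second_countable_topology}"
  assumes P: "sigma_finite_measure P" and N: "prob_space N" and g: "integrable P g"
  shows "integrable (N \<Otimes>\<^sub>M P) (\<lambda>x. g (snd x))"
proof -
  interpret P: sigma_finite_measure P by fact
  interpret N: prob_space N by fact
  interpret pair_sigma_finite N P ..
  have [measurable]: "g \<in> borel_measurable P" using g by auto
  show ?thesis
    by (rule Fubini_integrable) (use g in \<open>auto simp: N.prob_space\<close>)
qed

lemma gauss_smoothing_fourier:
  fixes f :: "real^'d \<Rightarrow> real" and x :: "real^'d"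
  assumes f: "integrable lborel f" and s: "s > 0"
  shows "of_real (\<integral>z. f (x + s *\<^sub>R z) \<partial>std_gauss) =
    of_real (1 / (s * sqrt (2 * pi)) ^ CARD('d)) *
    (\<integral>p. of_real (f (fst p)) * iexp (fst p \<bullet> snd p / s) * iexp (- (x \<bullet> snd p) / s)
       \<partial>(lborel \<Otimes>\<^sub>M (std_gauss :: (real^'d) measure)))"
proof -
  have [measurable]: "f \<in> borel_measurable borel"
    using borel_measurable_integrable[OF f] by simp
  interpret pair_sigma_finite "lborel :: (real^'d) measure" "std_gauss :: (real^'d) measure" ..
  define k where "k = sqrt (2 * pi) ^ CARD('d)"
  have kpos: "k > 0" by (simp add: k_def)
  have dens: "complex_of_real (gauss_dens ((y - x) /\<^sub>R s)) = (\<integral>t. iexp (y \<bullet> t / s) * iexp (- (x \<bullet> t) / s) \<partial>std_gauss) / k" for y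
  proof -
    have "(\<integral>t. iexp (y \<bullet> t / s) * iexp (- (x \<bullet> t) / s) \<partial>std_gauss) = (\<integral>t. iexp (((y - x) /\<^sub>R s) \<bullet> t) \<partial>std_gauss)"
      unfolding exp_add[symmetric] distrib_left[symmetric] of_real_add[symmetric]
      using s by (intro Bochner_Integration.integral_cong refl arg_cong[where f=iexp])
        (simp add: inner_diff_left field_simps)
    also have "\<dots> = of_real (exp (- (norm ((y - x) /\<^sub>R s))\<^sup>2 / 2))" by (rule char_std_gauss)
    finally show ?thesis using kpos by (simp add: gauss_dens_eq k_def)
  qed
  have bnd: "gauss_dens v \<le> 1 / k" for v :: "real^'d"
    using kpos by (simp add: gauss_dens_eq k_def divide_simps)
  have int: "integrable lborel (\<lambda>y. gauss_dens ((y - x) /\<^sub>R s) * f y)"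
  proof (rule Bochner_Integration.integrable_bound[OF integrable_mult_right[of "1/k", OF f]])
    show "AE y in lborel. norm (gauss_dens ((y - x) /\<^sub>R s) * f y) \<le> norm (1 / k * f y)"
      using mult_right_mono[OF bnd, of "\<bar>f _\<bar>"] kpos by (auto simp: abs_mult intro!: AE_I2)
  qed measurable
  have "(\<integral>y. gauss_dens ((y - x) /\<^sub>R s) * f y \<partial>lborel) = s ^ CARD('d) * (\<integral>z. gauss_dens z * f (x + s *\<^sub>R z) \<partial>lborel)"
    using s by (subst integral_lborel_affine[OF _ int, of s x]) (auto)
  also have "(\<integral>z. gauss_dens z * f (x + s *\<^sub>R z) \<partial>lborel) = (\<integral>z. f (x + s *\<^sub>R z) \<partial>std_gauss)"
    by (subst integral_std_gauss) auto
  finally have 1: "(\<integral>z. f (x + s *\<^sub>R z) \<partial>std_gauss) = (\<integral>y. gauss_dens ((y - x) /\<^sub>R s) * f y \<partial>lborel) / s ^ CARD('d)"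
    using s by (simp add: field_simps)
  have int2: "integrable (lborel \<Otimes>\<^sub>M (std_gauss :: (real^'d) measure))
     (\<lambda>p. of_real (f (fst p)) * iexp (fst p \<bullet> snd p / s) * iexp (- (x \<bullet> snd p) / s))"
  proof (rule Bochner_Integration.integrable_bound)
    show "integrable (lborel \<Otimes>\<^sub>M (std_gauss :: (real^'d) measure)) (\<lambda>p. f (fst p))"
      by (rule integrable_pair_fst[OF _ prob_space_std_gauss f]) (simp add: sigma_finite_lborel)
    have "norm (of_real (f (fst p)) * iexp (fst p \<bullet> snd p / s) * iexp (- (x \<bullet> snd p) / s)) \<le> norm (f (fst p))" for p :: "(real^'d) \<times> (real^'d)"
      unfolding norm_mult norm_exp_i_times norm_of_real by simp
    then show "AE p in lborel \<Otimes>\<^sub>M (std_gauss :: (real^'d) measure). norm (of_real (f (fst p)) * iexp (fst p \<bullet> snd p / s) * iexp (- (x \<bullet> snd p) / s)) \<le> norm (f (fst p))"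
      by (intro AE_I2)
  qed measurable
  have "complex_of_real (\<integral>y. gauss_dens ((y - x) /\<^sub>R s) * f y \<partial>lborel) =
     (\<integral>y. of_real (gauss_dens ((y - x) /\<^sub>R s)) * of_real (f y) \<partial>lborel)"
    by (subst integral_complex_of_real[symmetric]) simp
  also have "\<dots> = (\<integral>y. (\<integral>t. of_real (f y) * iexp (y \<bullet> t / s) * iexp (- (x \<bullet> t) / s) \<partial>std_gauss) / k \<partial>lborel)"
    unfolding dens mult.assoc integral_mult_right_zero
    by (intro Bochner_Integration.integral_cong refl) simp
  also have "\<dots> = (\<integral>y. (\<integral>t. of_real (f y) * iexp (y \<bullet> t / s) * iexp (- (x \<bullet> t) / s) \<partial>std_gauss) \<partial>lborel) / k"
    by simp
  also have "(\<integral>y. (\<integral>t. of_real (f y) * iexp (y \<bullet> t / s) * iexp (- (x \<bullet> t) / s) \<partial>std_gauss) \<partial>lborel) =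
     (\<integral>p. of_real (f (fst p)) * iexp (fst p \<bullet> snd p / s) * iexp (- (x \<bullet> snd p) / s)
       \<partial>(lborel \<Otimes>\<^sub>M (std_gauss :: (real^'d) measure)))"
    using integral_fst'[OF int2] by simp
  finally have 2: "complex_of_real (\<integral>y. gauss_dens ((y - x) /\<^sub>R s) * f y \<partial>lborel) =
     (\<integral>p. of_real (f (fst p)) * iexp (fst p \<bullet> snd p / s) * iexp (- (x \<bullet> snd p) / s)
       \<partial>(lborel \<Otimes>\<^sub>M (std_gauss :: (real^'d) measure))) / k" .
  show ?thesis
    unfolding 1 of_real_divide[of _ "_ ^ _"] 2
    by (simp add: k_def power_mult_distrib field_simps)
qed

lemma weighted_smoothing_fourier:
  fixes f :: "real^'d \<Rightarrow> real" and W :: "'b \<Rightarrow> real^'d" and \<xi> :: "'b \<Rightarrow> complex"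
  assumes f: "integrable lborel f" and s: "s > 0" and N: "prob_space N"
    and [measurable]: "W \<in> borel_measurable N" "\<xi> \<in> borel_measurable N"
    and \<xi>: "\<And>x. norm (\<xi> x) \<le> 1"
  shows "(\<integral>\<omega>. \<xi> \<omega> * of_real (\<integral>z. f (W \<omega> + s *\<^sub>R z) \<partial>std_gauss) \<partial>N) =
    of_real (1 / (s * sqrt (2 * pi)) ^ CARD('d)) *
    (\<integral>p. of_real (f (fst p)) * iexp (fst p \<bullet> snd p / s) *
        (\<integral>\<omega>. \<xi> \<omega> * iexp ((- (1/s) *\<^sub>R snd p) \<bullet> W \<omega>) \<partial>N)
       \<partial>(lborel \<Otimes>\<^sub>M (std_gauss :: (real^'d) measure)))"
    (is "_ = ?c * ?R")
proof -
  let ?P = "(lborel :: (real^'d) measure) \<Otimes>\<^sub>M (std_gauss :: (real^'d) measure)"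
  have [measurable]: "f \<in> borel_measurable borel"
    using borel_measurable_integrable[OF f] by simp
  interpret PP: pair_sigma_finite "lborel :: (real^'d) measure" "std_gauss :: (real^'d) measure" ..
  interpret N: prob_space N by fact
  interpret pair_sigma_finite N ?P ..
  let ?g = "\<lambda>\<omega> p. of_real (f (fst p)) * iexp (fst p \<bullet> snd p / s) * (\<xi> \<omega> * iexp ((- (1/s) *\<^sub>R snd p) \<bullet> W \<omega>))"
  have "integrable ?P (\<lambda>p. f (fst p))"
    by (rule integrable_pair_fst[OF _ prob_space_std_gauss f]) (simp add: sigma_finite_lborel)
  from integrable_pair_snd[OF _ N this]
  have int0: "integrable (N \<Otimes>\<^sub>M ?P) (\<lambda>q. f (fst (snd q)))"
    by (simp add: PP.P.sigma_finite_measure_axioms)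
  have int: "integrable (N \<Otimes>\<^sub>M ?P) (\<lambda>(\<omega>, p). ?g \<omega> p)"
  proof (rule Bochner_Integration.integrable_bound[OF int0])
    have "norm (?g \<omega> p) \<le> \<bar>f (fst p)\<bar>" for \<omega> p
      unfolding norm_mult norm_exp_i_times norm_of_real using mult_left_le[OF \<xi>, of "\<bar>f (fst p)\<bar>"] by simp
    then show "AE q in N \<Otimes>\<^sub>M ?P. norm (case q of (\<omega>, p) \<Rightarrow> ?g \<omega> p) \<le> norm (f (fst (snd q)))"
      by (intro AE_I2) (simp only: split_beta real_norm_def)
  qed measurable
  have "(\<integral>\<omega>. \<xi> \<omega> * of_real (\<integral>z. f (W \<omega> + s *\<^sub>R z) \<partial>std_gauss) \<partial>N) =
     (\<integral>\<omega>. ?c * (\<integral>p. ?g \<omega> p \<partial>?P) \<partial>N)"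
  proof (intro Bochner_Integration.integral_cong refl)
    fix \<omega>
    have "\<xi> \<omega> * of_real (\<integral>z. f (W \<omega> + s *\<^sub>R z) \<partial>std_gauss) = ?c * (\<integral>p. \<xi> \<omega> *
       (of_real (f (fst p)) * iexp (fst p \<bullet> snd p / s) * iexp (- (W \<omega> \<bullet> snd p) / s)) \<partial>?P)"
      unfolding gauss_smoothing_fourier[OF f s] by simp
    also have "\<dots> = ?c * (\<integral>p. ?g \<omega> p \<partial>?P)"
      by (intro arg_cong[where f="\<lambda>x. ?c * x"] Bochner_Integration.integral_cong refl)
         (simp add: inner_commute field_simps)
    finally show "\<xi> \<omega> * of_real (\<integral>z. f (W \<omega> + s *\<^sub>R z) \<partial>std_gauss) = ?c * (\<integral>p. ?g \<omega> p \<partial>?P)" .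
  qed
  also have "\<dots> = ?c * (\<integral>\<omega>. (\<integral>p. ?g \<omega> p \<partial>?P) \<partial>N)" by simp
  also have "(\<integral>\<omega>. (\<integral>p. ?g \<omega> p \<partial>?P) \<partial>N) = (\<integral>p. (\<integral>\<omega>. ?g \<omega> p \<partial>N) \<partial>?P)"
    using Fubini_integral[OF int] by simp
  also have "\<dots> = ?R" by simp
  finally show ?thesis .
qed

lemma weighted_smoothing_tendsto:
  fixes f :: "real^'d \<Rightarrow> real" and W :: "nat \<Rightarrow> 'b \<Rightarrow> real^'d" and \<xi> :: "nat \<Rightarrow> 'b \<Rightarrow> complex"
    and W' :: "'c \<Rightarrow> real^'d"
  assumes f: "integrable lborel f" and s: "s > 0" and N: "\<And>m. prob_space (N m)" and N': "prob_space N'"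
    and W [measurable]: "\<And>m. W m \<in> borel_measurable (N m)" "\<And>m. \<xi> m \<in> borel_measurable (N m)"
    and W' [measurable]: "W' \<in> borel_measurable N'" "\<xi>' \<in> borel_measurable N'"
    and \<xi>: "\<And>m x. norm (\<xi> m x) \<le> 1" and \<xi>': "\<And>x. norm (\<xi>' x) \<le> 1"
    and lim: "\<And>v. (\<lambda>m. \<integral>\<omega>. \<xi> m \<omega> * iexp (v \<bullet> W m \<omega>) \<partial>N m) \<longlonglongrightarrow> (\<integral>\<omega>. \<xi>' \<omega> * iexp (v \<bullet> W' \<omega>) \<partial>N')"
  shows "(\<lambda>m. \<integral>\<omega>. \<xi> m \<omega> * of_real (\<integral>z. f (W m \<omega> + s *\<^sub>R z) \<partial>std_gauss) \<partial>N m) \<longlonglongrightarrow>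
    (\<integral>\<omega>. \<xi>' \<omega> * of_real (\<integral>z. f (W' \<omega> + s *\<^sub>R z) \<partial>std_gauss) \<partial>N')"
proof -
  let ?P = "(lborel :: (real^'d) measure) \<Otimes>\<^sub>M (std_gauss :: (real^'d) measure)"
  have [measurable]: "f \<in> borel_measurable borel"
    using borel_measurable_integrable[OF f] by simp
  have NN: "sigma_finite_measure (N m)" for m
    using N[of m] by (simp add: prob_space_imp_sigma_finite)
  have NN': "sigma_finite_measure N'"
    using N' by (simp add: prob_space_imp_sigma_finite)
  have int0: "integrable ?P (\<lambda>p. \<bar>f (fst p)\<bar>)"
    by (rule integrable_pair_fst[OF _ prob_space_std_gauss integrable_abs[OF f]]) (simp add: sigma_finite_lborel)
  have bnd: "norm (\<integral>\<omega>. \<xi> m \<omega> * iexp (v \<bullet> W m \<omega>) \<partial>N m) \<le> 1" for m v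
  proof -
    interpret prob_space "N m" by (rule N)
    have "norm (\<integral>\<omega>. \<xi> m \<omega> * iexp (v \<bullet> W m \<omega>) \<partial>N m) \<le> (\<integral>\<omega>. norm (\<xi> m \<omega> * iexp (v \<bullet> W m \<omega>)) \<partial>N m)"
      by (rule integral_norm_bound)
    also have "\<dots> \<le> (\<integral>\<omega>. 1 \<partial>N m)"
      by (rule integral_mono') (auto simp: norm_mult \<xi>)
    finally show ?thesis by (simp add: prob_space)
  qed
  show ?thesis
    unfolding weighted_smoothing_fourier[OF f s N W \<xi>] weighted_smoothing_fourier[OF f s N' W' \<xi>']
  proof (intro tendsto_mult_left integral_dominated_convergence[OF _ _ int0])
    fix m
    have "norm (of_real (f (fst p)) * iexp (fst p \<bullet> snd p / s) *
        (\<integral>\<omega>. \<xi> m \<omega> * iexp ((- (1/s) *\<^sub>R snd p) \<bullet> W m \<omega>) \<partial>N m)) \<le> \<bar>f (fst p)\<bar>" for p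
      unfolding norm_mult norm_exp_i_times norm_of_real using mult_left_le[OF bnd[of m "- (1/s) *\<^sub>R snd p"], of "\<bar>f (fst p)\<bar>"] by simp
    then show "AE p in ?P. norm (of_real (f (fst p)) * iexp (fst p \<bullet> snd p / s) *
        (\<integral>\<omega>. \<xi> m \<omega> * iexp ((- (1/s) *\<^sub>R snd p) \<bullet> W m \<omega>) \<partial>N m)) \<le> \<bar>f (fst p)\<bar>"
      by (intro AE_I2)
  next
    show "AE p in ?P. (\<lambda>m. of_real (f (fst p)) * iexp (fst p \<bullet> snd p / s) *
        (\<integral>\<omega>. \<xi> m \<omega> * iexp ((- (1/s) *\<^sub>R snd p) \<bullet> W m \<omega>) \<partial>N m)) \<longlonglongrightarrow>
        of_real (f (fst p)) * iexp (fst p \<bullet> snd p / s) *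
        (\<integral>\<omega>. \<xi>' \<omega> * iexp ((- (1/s) *\<^sub>R snd p) \<bullet> W' \<omega>) \<partial>N')"
      by (intro AE_I2 tendsto_mult_left lim)
  next
    show "(\<lambda>p. of_real (f (fst p)) * iexp (fst p \<bullet> snd p / s) *
        (\<integral>\<omega>. \<xi>' \<omega> * iexp ((- (1/s) *\<^sub>R snd p) \<bullet> W' \<omega>) \<partial>N')) \<in> borel_measurable ?P"
      by (intro borel_measurable_times sigma_finite_measure.borel_measurable_lebesgue_integral[OF NN']) measurable
    show "(\<lambda>p. of_real (f (fst p)) * iexp (fst p \<bullet> snd p / s) *
        (\<integral>\<omega>. \<xi> m \<omega> * iexp ((- (1/s) *\<^sub>R snd p) \<bullet> W m \<omega>) \<partial>N m)) \<in> borel_measurable ?P" for m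
      by (intro borel_measurable_times sigma_finite_measure.borel_measurable_lebesgue_integral[OF NN]) measurable
  qed
qed

lemma tendsto_approx:
  fixes X :: "nat \<Rightarrow> 'a::real_normed_vector"
  assumes "\<And>e. e > 0 \<Longrightarrow> \<exists>X' L'. X' \<longlonglongrightarrow> L' \<and> norm (L - L') \<le> e \<and> (\<forall>\<^sub>F m in sequentially. norm (X m - X' m) \<le> e)"
  shows "X \<longlonglongrightarrow> L"
proof (rule tendstoI)
  fix e :: real assume e: "e > 0"
  then obtain X' L' where 1: "X' \<longlonglongrightarrow> L'" "norm (L - L') \<le> e/4" "\<forall>\<^sub>F m in sequentially. norm (X m - X' m) \<le> e/4"
    using assms[of "e/4"] by auto
  have "\<forall>\<^sub>F m in sequentially. dist (X' m) L' < e/4"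
    using tendstoD[OF 1(1), of "e/4"] e by auto
  with 1(3) show "\<forall>\<^sub>F m in sequentially. dist (X m) L < e"
  proof eventually_elim
    case (elim m)
    have "X m - L = (X m - X' m) + (X' m - L') - (L - L')" by simp
    then have "norm (X m - L) \<le> norm (X m - X' m) + norm (X' m - L') + norm (L - L')"
      using norm_triangle_ineq4[of "(X m - X' m) + (X' m - L')" "L - L'"] norm_triangle_ineq[of "X m - X' m" "X' m - L'"]
      by simp
    then show ?case using elim 1(2) e by (simp add: dist_norm)
  qed
qed

lemma std_gauss_tail: "(\<lambda>k. measure (std_gauss :: (real^'d) measure) {z. real k < norm z}) \<longlonglongrightarrow> 0"
proof -
  have "(\<lambda>k. measure (std_gauss :: (real^'d) measure) {z. real k < norm z}) \<longlonglongrightarrow>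
    measure (std_gauss :: (real^'d) measure) (\<Inter>k. {z. real k < norm z})"
    by (rule std_gauss.finite_Lim_measure_decseq) (auto simp: decseq_def)
  also have "(\<Inter>k. {z::real^'d. real k < norm z}) = {}"
  proof -
    have "\<exists>k. \<not> real k < norm z" for z :: "real^'d"
      using reals_Archimedean2[of "norm z"] by (meson not_less_iff_gr_or_eq)
    then show ?thesis by blast
  qed
  finally show ?thesis by simp
qed

lemma gauss_smoothing_uniform:
  fixes f :: "real^'d \<Rightarrow> real"
  assumes f: "uniformly_continuous_on UNIV f" and B: "\<And>x. \<bar>f x\<bar> \<le> B" and e: "e > 0"
  obtains s where "s > 0" "\<And>x. \<bar>f x - (\<integral>z. f (x + s *\<^sub>R z) \<partial>std_gauss)\<bar> \<le> e"
proof -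
  have [measurable]: "f \<in> borel_measurable borel"
    using uniformly_continuous_imp_continuous[OF f] by (rule borel_measurable_continuous_onI)
  have B0: "B \<ge> 0" using B[of 0] by linarith
  obtain d where d: "d > 0" "\<And>x y. dist y x < d \<Longrightarrow> dist (f y) (f x) < e/2"
    using f e unfolding uniformly_continuous_on_def by (metis UNIV_I half_gt_zero)
  have "\<forall>\<^sub>F k in sequentially. measure (std_gauss :: (real^'d) measure) {z. real k < norm z} < e / (4 * (B + 1))"
    using order_tendstoD(2)[OF std_gauss_tail, of "e / (4 * (B + 1))"] e B0 by auto
  then obtain k where k: "measure (std_gauss :: (real^'d) measure) {z. real k < norm z} < e / (4 * (B + 1))"
    by (auto dest: eventually_happens)
  define s where "s = d / (real k + 1)"
  have s: "s > 0" using d by (simp add: s_def)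
  have "\<bar>f x - (\<integral>z. f (x + s *\<^sub>R z) \<partial>std_gauss)\<bar> \<le> e" for x
  proof -
    have int: "integrable std_gauss (\<lambda>z. f (x + s *\<^sub>R z))"
      using B by (intro std_gauss.integrable_const_bound[where B=B]) auto
    have int2: "integrable std_gauss (\<lambda>z::real^'d. e/2 + 2 * B * indicator {z. real k < norm z} z)"
      by (intro std_gauss.integrable_const_bound[where B="e/2 + 2 * B"]) (use B0 e in \<open>auto simp: indicator_def\<close>)
    have "f x - (\<integral>z. f (x + s *\<^sub>R z) \<partial>std_gauss) = (\<integral>z. f x - f (x + s *\<^sub>R z) \<partial>std_gauss)"
      using int by (simp add: std_gauss.prob_space[simplified])
    also have "\<bar>\<dots>\<bar> \<le> (\<integral>z. \<bar>f x - f (x + s *\<^sub>R z)\<bar> \<partial>std_gauss)"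
      by (rule integral_abs_bound)
    also have "\<dots> \<le> (\<integral>z. e/2 + 2 * B * indicator {z. real k < norm z} z \<partial>(std_gauss :: (real^'d) measure))"
    proof (rule integral_mono[OF _ int2])
      show "integrable std_gauss (\<lambda>z. \<bar>f x - f (x + s *\<^sub>R z)\<bar>)" using int by simp
      fix z :: "real^'d"
      show "\<bar>f x - f (x + s *\<^sub>R z)\<bar> \<le> e/2 + 2 * B * indicator {z. real k < norm z} z"
      proof (cases "real k < norm z")
        case True
        have "\<bar>f x - f (x + s *\<^sub>R z)\<bar> \<le> 2 * B" using B[of x] B[of "x + s *\<^sub>R z"] by linarith
        then show ?thesis using True e by simp
      next
        case False
        have "s * norm z < d"
        proof -
          have "s * norm z \<le> s * real k" using False s by simp
          also have "\<dots> < s * (real k + 1)" using s by simp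
          also have "\<dots> = d" by (simp add: s_def)
          finally show ?thesis .
        qed
        then have "dist (x + s *\<^sub>R z) x < d" using s by (simp add: dist_norm)
        from d(2)[OF this] False show ?thesis by (simp add: dist_real_def abs_minus_commute)
      qed
    qed
    also have "\<dots> = e/2 + 2 * B * measure (std_gauss :: (real^'d) measure) {z. real k < norm z}"
    proof -
      have "integrable (std_gauss :: (real^'d) measure) (indicator {z. real k < norm z} :: _ \<Rightarrow> real)"
        by (intro std_gauss.integrable_const_bound[where B=1]) auto
      then show ?thesis by (simp add: std_gauss.prob_space[simplified])
    qed
    also have "\<dots> \<le> e/2 + 2 * B * (e / (4 * (B + 1)))"
      using k B0 by (intro add_left_mono mult_left_mono) auto
    also have "\<dots> \<le> e"
      using B0 e by (simp add: divide_simps) (simp add: algebra_simps)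
    finally show ?thesis .
  qed
  with s that show thesis by blast
qed

lemma weighted_integral_diff:
  fixes f g h :: "real^'d \<Rightarrow> real" and V :: "'b \<Rightarrow> real^'d" and \<zeta> :: "'b \<Rightarrow> complex"
  assumes K: "prob_space K"
    and [measurable]: "V \<in> borel_measurable K" "\<zeta> \<in> borel_measurable K"
    and \<zeta>: "\<And>x. norm (\<zeta> x) \<le> 1"
    and [measurable]: "f \<in> borel_measurable borel" "g \<in> borel_measurable borel" "h \<in> borel_measurable borel"
    and B: "\<And>x. \<bar>f x\<bar> \<le> B" "\<And>x. \<bar>g x\<bar> \<le> B" "\<And>x. \<bar>h x\<bar> \<le> B"
    and h: "\<And>x. \<bar>f x - g x\<bar> \<le> h x"
  shows "norm ((\<integral>\<omega>. \<zeta> \<omega> * of_real (f (V \<omega>)) \<partial>K) - (\<integral>\<omega>. \<zeta> \<omega> * of_real (g (V \<omega>)) \<partial>K)) \<le> (\<integral>\<omega>. h (V \<omega>) \<partial>K)"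
proof -
  interpret K: prob_space K by fact
  have i1: "integrable K (\<lambda>\<omega>. \<zeta> \<omega> * of_real (f (V \<omega>)))"
    by (rule K.integrable_const_bound[where B="1 * B"]) (use mult_mono[OF \<zeta> B(1)] in \<open>auto simp: norm_mult intro!: AE_I2\<close>)
  have i2: "integrable K (\<lambda>\<omega>. \<zeta> \<omega> * of_real (g (V \<omega>)))"
    by (rule K.integrable_const_bound[where B="1 * B"]) (use mult_mono[OF \<zeta> B(2)] in \<open>auto simp: norm_mult intro!: AE_I2\<close>)
  have "(\<integral>\<omega>. \<zeta> \<omega> * of_real (f (V \<omega>)) \<partial>K) - (\<integral>\<omega>. \<zeta> \<omega> * of_real (g (V \<omega>)) \<partial>K) =
    (\<integral>\<omega>. \<zeta> \<omega> * of_real (f (V \<omega>)) - \<zeta> \<omega> * of_real (g (V \<omega>)) \<partial>K)"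
    using i1 i2 by simp
  also have "norm \<dots> \<le> (\<integral>\<omega>. norm (\<zeta> \<omega> * of_real (f (V \<omega>)) - \<zeta> \<omega> * of_real (g (V \<omega>))) \<partial>K)"
    by (rule integral_norm_bound)
  also have "\<dots> \<le> (\<integral>\<omega>. h (V \<omega>) \<partial>K)"
  proof (rule integral_mono')
    show "integrable K (\<lambda>\<omega>. h (V \<omega>))"
      by (rule K.integrable_const_bound[where B=B]) (use B(3) in auto)
    fix \<omega>
    show "0 \<le> h (V \<omega>)" using h[of "V \<omega>"] by linarith
    have "norm (\<zeta> \<omega> * of_real (f (V \<omega>)) - \<zeta> \<omega> * of_real (g (V \<omega>))) = norm (\<zeta> \<omega>) * \<bar>f (V \<omega>) - g (V \<omega>)\<bar>"
      unfolding right_diff_distrib[symmetric] norm_mult of_real_diff[symmetric] norm_of_real ..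
    also have "\<dots> \<le> 1 * h (V \<omega>)" using \<zeta> h by (intro mult_mono) auto
    finally show "norm (\<zeta> \<omega> * of_real (f (V \<omega>)) - \<zeta> \<omega> * of_real (g (V \<omega>))) \<le> h (V \<omega>)" by simp
  qed
  finally show ?thesis .
qed

lemma weighted_tendsto_Cc:
  fixes f :: "real^'d \<Rightarrow> real" and W :: "nat \<Rightarrow> 'b \<Rightarrow> real^'d" and \<xi> :: "nat \<Rightarrow> 'b \<Rightarrow> complex"
    and W' :: "'c \<Rightarrow> real^'d"
  assumes f: "continuous_on UNIV f" and supp: "\<And>x. norm x > T \<Longrightarrow> f x = 0"
    and N: "\<And>m. prob_space (N m)" and N': "prob_space N'"
    and W [measurable]: "\<And>m. W m \<in> borel_measurable (N m)" "\<And>m. \<xi> m \<in> borel_measurable (N m)"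
    and W' [measurable]: "W' \<in> borel_measurable N'" "\<xi>' \<in> borel_measurable N'"
    and \<xi>: "\<And>m x. norm (\<xi> m x) \<le> 1" and \<xi>': "\<And>x. norm (\<xi>' x) \<le> 1"
    and lim: "\<And>v. (\<lambda>m. \<integral>\<omega>. \<xi> m \<omega> * iexp (v \<bullet> W m \<omega>) \<partial>N m) \<longlonglongrightarrow> (\<integral>\<omega>. \<xi>' \<omega> * iexp (v \<bullet> W' \<omega>) \<partial>N')"
  shows "(\<lambda>m. \<integral>\<omega>. \<xi> m \<omega> * of_real (f (W m \<omega>)) \<partial>N m) \<longlonglongrightarrow> (\<integral>\<omega>. \<xi>' \<omega> * of_real (f (W' \<omega>)) \<partial>N')"
proof (rule tendsto_approx)
  fix e :: real assume e: "e > 0"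
  have fm [measurable]: "f \<in> borel_measurable borel" using f by (rule borel_measurable_continuous_onI)
  have cb: "compact (cball (0::real^'d) (T + 1))" by simp
  have contb: "continuous_on (cball 0 (T + 1)) f" using f continuous_on_subset by blast
  have "bounded (f ` cball 0 (T + 1))"
    using compact_continuous_image[OF contb cb] by (rule compact_imp_bounded)
  then obtain B where "B > 0" and B0: "\<And>x. x \<in> cball 0 (T + 1) \<Longrightarrow> \<bar>f x\<bar> \<le> B"
    by (auto simp: bounded_pos)
  have B: "\<bar>f x\<bar> \<le> B" for x
    using B0[of x] supp[of x] \<open>B > 0\<close> by (cases "norm x > T") auto
  have uc: "uniformly_continuous_on UNIV f"
    unfolding uniformly_continuous_on_def
  proof (intro allI impI)
    fix e :: real assume e: "e > 0"
    have "uniformly_continuous_on (cball 0 (T + 1)) f" by (rule compact_uniformly_continuous[OF contb cb])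
    then obtain d where d: "d > 0" "\<And>x y. x \<in> cball 0 (T + 1) \<Longrightarrow> y \<in> cball 0 (T + 1) \<Longrightarrow> dist y x < d \<Longrightarrow> dist (f y) (f x) < e"
      unfolding uniformly_continuous_on_def using e by metis
    have "dist (f y) (f x) < e" if "dist y x < min d 1" for x y
    proof (cases "norm x > T \<and> norm y > T")
      case True then show ?thesis using supp e by simp
    next
      case False
      have "norm x \<le> norm y + dist y x" "norm y \<le> norm x + dist y x"
        using norm_triangle_sub[of x y] norm_triangle_sub[of y x] norm_minus_commute[of x y]
        by (simp_all add: dist_norm)
      then have "x \<in> cball 0 (T + 1)" "y \<in> cball 0 (T + 1)" using False that by auto
      then show ?thesis using d(2) that by auto
    qed
    then show "\<exists>d>0. \<forall>x\<in>UNIV. \<forall>y\<in>UNIV. dist y x < d \<longrightarrow> dist (f y) (f x) < e"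
      using d(1) by (intro exI[of _ "min d 1"]) auto
  qed
  have int: "integrable lborel f"
  proof -
    have "integrable lborel (\<lambda>x. indicator (cball 0 (T + 1)) x *\<^sub>R f x)"
      using borel_integrable_compact[OF cb contb] by simp
    also have "(\<lambda>x. indicator (cball 0 (T + 1)) x *\<^sub>R f x) = f"
      using supp by (auto simp: fun_eq_iff indicator_def)
    finally show ?thesis .
  qed
  obtain s where s: "s > 0" "\<And>x. \<bar>f x - (\<integral>z. f (x + s *\<^sub>R z) \<partial>std_gauss)\<bar> \<le> e"
    using gauss_smoothing_uniform[OF uc B e] by blast
  let ?g = "\<lambda>x. \<integral>z. f (x + s *\<^sub>R z) \<partial>std_gauss"
  have gB: "\<bar>?g x\<bar> \<le> B" for x
  proof -
    have "\<bar>?g x\<bar> \<le> (\<integral>z. \<bar>f (x + s *\<^sub>R z)\<bar> \<partial>std_gauss)" by (rule integral_abs_bound)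
    also have "\<dots> \<le> (\<integral>z. B \<partial>(std_gauss :: (real^'d) measure))" by (rule integral_mono') (use B \<open>B > 0\<close> in auto)
    finally show ?thesis by (simp add: std_gauss.prob_space[simplified])
  qed
  have gm: "?g \<in> borel_measurable borel"
    by (rule std_gauss.borel_measurable_lebesgue_integral) measurable
  show "\<exists>X' L'. X' \<longlonglongrightarrow> L' \<and> norm ((\<integral>\<omega>. \<xi>' \<omega> * of_real (f (W' \<omega>)) \<partial>N') - L') \<le> e \<and>
      (\<forall>\<^sub>F m in sequentially. norm ((\<integral>\<omega>. \<xi> m \<omega> * of_real (f (W m \<omega>)) \<partial>N m) - X' m) \<le> e)"
  proof (intro exI conjI)
    show "(\<lambda>m. \<integral>\<omega>. \<xi> m \<omega> * of_real (?g (W m \<omega>)) \<partial>N m) \<longlonglongrightarrow> (\<integral>\<omega>. \<xi>' \<omega> * of_real (?g (W' \<omega>)) \<partial>N')"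
      by (rule weighted_smoothing_tendsto[OF int s(1) N N' W W' \<xi> \<xi>' lim])
    have bnd: "\<bar>f x - ?g x\<bar> \<le> e" for x by (rule s(2))
    have mB: "\<bar>f x\<bar> \<le> max B e" "\<bar>?g x\<bar> \<le> max B e" "\<bar>e\<bar> \<le> max B e" for x
      using B[of x] gB[of x] e by auto
    show "norm ((\<integral>\<omega>. \<xi>' \<omega> * of_real (f (W' \<omega>)) \<partial>N') - (\<integral>\<omega>. \<xi>' \<omega> * of_real (?g (W' \<omega>)) \<partial>N')) \<le> e"
      using weighted_integral_diff[OF N' W' \<xi>' fm gm borel_measurable_const mB bnd] N' by (simp add: prob_space.prob_space)
    show "\<forall>\<^sub>F m in sequentially. norm ((\<integral>\<omega>. \<xi> m \<omega> * of_real (f (W m \<omega>)) \<partial>N m) - (\<integral>\<omega>. \<xi> m \<omega> * of_real (?g (W m \<omega>)) \<partial>N m)) \<le> e"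
      using weighted_integral_diff[OF N W \<xi> fm gm borel_measurable_const mB bnd] N by (simp add: prob_space.prob_space)
  qed
qed

definition cutoff :: "nat \<Rightarrow> 'a::real_normed_vector \<Rightarrow> real" where
  "cutoff T x = max 0 (min 1 (real T + 1 - norm x))"

lemma cutoff_bounds: "0 \<le> cutoff T x" "cutoff T x \<le> 1"
  by (auto simp: cutoff_def)

lemma cutoff_zero: "norm x > real T + 1 \<Longrightarrow> cutoff T x = 0"
  by (simp add: cutoff_def)

lemma continuous_cutoff: "continuous_on A (cutoff T)"
  unfolding cutoff_def by (intro continuous_intros)

lemma cutoff_measurable [measurable]: "cutoff T \<in> borel_measurable borel"
  by (rule borel_measurable_continuous_onI[OF continuous_cutoff])

lemma cutoff_tendsto: "(\<lambda>T. cutoff T x) \<longlonglongrightarrow> 1"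
proof (rule tendsto_eventually)
  have "\<forall>\<^sub>F T in sequentially. norm x \<le> real T"
    by (rule eventually_at_top_linorderI[of "nat \<lceil>norm x\<rceil>"]) linarith
  then show "\<forall>\<^sub>F T in sequentially. cutoff T x = 1"
    by eventually_elim (auto simp: cutoff_def)
qed

lemma weighted_cutoff_close:
  fixes f :: "real^'d \<Rightarrow> real" and V :: "'b \<Rightarrow> real^'d" and \<zeta> :: "'b \<Rightarrow> complex"
  assumes K: "prob_space K"
    and [measurable]: "V \<in> borel_measurable K" "\<zeta> \<in> borel_measurable K"
    and \<zeta>: "\<And>x. norm (\<zeta> x) \<le> 1"
    and [measurable]: "f \<in> borel_measurable borel" and B: "\<And>x. \<bar>f x\<bar> \<le> B"
  shows "norm ((\<integral>\<omega>. \<zeta> \<omega> * of_real (f (V \<omega>)) \<partial>K) - (\<integral>\<omega>. \<zeta> \<omega> * of_real (f (V \<omega>) * cutoff T (V \<omega>)) \<partial>K))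
      \<le> B * (1 - (\<integral>\<omega>. cutoff T (V \<omega>) \<partial>K))"
proof -
  interpret K: prob_space K by fact
  have B0: "B \<ge> 0" using B[of 0] by linarith
  have fB: "\<bar>f x * cutoff T x\<bar> \<le> B" "\<bar>B * (1 - cutoff T x)\<bar> \<le> B" for x
    using mult_mono[OF B, of "cutoff T x" 1 x] mult_left_mono[of "1 - cutoff T x" 1 B] cutoff_bounds[of T x] B0
    by (auto simp: abs_mult)
  have h: "\<bar>f x - f x * cutoff T x\<bar> \<le> B * (1 - cutoff T x)" for x
  proof -
    have "f x - f x * cutoff T x = f x * (1 - cutoff T x)" by (simp add: algebra_simps)
    then show ?thesis using mult_right_mono[OF B, of "1 - cutoff T x" x] cutoff_bounds[of T x] by (simp add: abs_mult)
  qed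
  have "integrable K (\<lambda>\<omega>. cutoff T (V \<omega>))"
    by (rule K.integrable_const_bound[where B=1]) (auto simp: cutoff_bounds intro!: AE_I2)
  then have "(\<integral>\<omega>. B * (1 - cutoff T (V \<omega>)) \<partial>K) = B * (1 - (\<integral>\<omega>. cutoff T (V \<omega>) \<partial>K))"
    by (simp add: K.prob_space)
  moreover have "norm ((\<integral>\<omega>. \<zeta> \<omega> * of_real (f (V \<omega>)) \<partial>K) - (\<integral>\<omega>. \<zeta> \<omega> * of_real (f (V \<omega>) * cutoff T (V \<omega>)) \<partial>K))
      \<le> (\<integral>\<omega>. B * (1 - cutoff T (V \<omega>)) \<partial>K)"
    by (rule weighted_integral_diff[where B=B]) (use K \<zeta> B fB h in auto)
  ultimately show ?thesis by (simp only:)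
qed

theorem weighted_levy_continuity:
  fixes f :: "real^'d \<Rightarrow> real" and W :: "nat \<Rightarrow> 'b \<Rightarrow> real^'d" and \<xi> :: "nat \<Rightarrow> 'b \<Rightarrow> complex"
    and W' :: "'c \<Rightarrow> real^'d"
  assumes f: "continuous_on UNIV f" and B: "\<And>x. \<bar>f x\<bar> \<le> B"
    and N: "\<And>m. prob_space (N m)" and N': "prob_space N'"
    and W [measurable]: "\<And>m. W m \<in> borel_measurable (N m)" "\<And>m. \<xi> m \<in> borel_measurable (N m)"
    and W' [measurable]: "W' \<in> borel_measurable N'" "\<xi>' \<in> borel_measurable N'"
    and \<xi>: "\<And>m x. norm (\<xi> m x) \<le> 1" and \<xi>': "\<And>x. norm (\<xi>' x) \<le> 1"
    and lim1: "\<And>v. (\<lambda>m. \<integral>\<omega>. iexp (v \<bullet> W m \<omega>) \<partial>N m) \<longlonglongrightarrow> (\<integral>\<omega>. iexp (v \<bullet> W' \<omega>) \<partial>N')"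
    and lim: "\<And>v. (\<lambda>m. \<integral>\<omega>. \<xi> m \<omega> * iexp (v \<bullet> W m \<omega>) \<partial>N m) \<longlonglongrightarrow> (\<integral>\<omega>. \<xi>' \<omega> * iexp (v \<bullet> W' \<omega>) \<partial>N')"
  shows "(\<lambda>m. \<integral>\<omega>. \<xi> m \<omega> * of_real (f (W m \<omega>)) \<partial>N m) \<longlonglongrightarrow> (\<integral>\<omega>. \<xi>' \<omega> * of_real (f (W' \<omega>)) \<partial>N')"
proof (rule tendsto_approx)
  fix e :: real assume e: "e > 0"
  have [measurable]: "f \<in> borel_measurable borel" using f by (rule borel_measurable_continuous_onI)
  have B0: "B \<ge> 0" using B[of 0] by linarith
  interpret N': prob_space N' by fact
  have "(\<lambda>T. \<integral>\<omega>. cutoff T (W' \<omega>) \<partial>N') \<longlonglongrightarrow> (\<integral>\<omega>. 1 \<partial>N')"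
    by (rule integral_dominated_convergence[where w="\<lambda>_. 1"])
       (auto simp: cutoff_bounds intro!: AE_I2 cutoff_tendsto)
  then have "(\<lambda>T. \<integral>\<omega>. cutoff T (W' \<omega>) \<partial>N') \<longlonglongrightarrow> 1" by (simp add: N'.prob_space)
  moreover have "1 - e / (B + 1) < 1" using e B0 by simp
  ultimately have "\<forall>\<^sub>F T in sequentially. 1 - e / (B + 1) < (\<integral>\<omega>. cutoff T (W' \<omega>) \<partial>N')"
    by (rule order_tendstoD)
  then obtain T where T: "1 - e / (B + 1) < (\<integral>\<omega>. cutoff T (W' \<omega>) \<partial>N')"
    by (auto dest: eventually_happens)
  have cZ: "norm x > real T + 1 \<Longrightarrow> f x * cutoff T x = 0" for x by (simp add: cutoff_zero)
  have cont: "continuous_on UNIV (\<lambda>x. f x * cutoff T x)" by (intro continuous_on_mult f continuous_cutoff)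
  have L1: "(\<lambda>m. \<integral>\<omega>. \<xi> m \<omega> * of_real (f (W m \<omega>) * cutoff T (W m \<omega>)) \<partial>N m) \<longlonglongrightarrow>
      (\<integral>\<omega>. \<xi>' \<omega> * of_real (f (W' \<omega>) * cutoff T (W' \<omega>)) \<partial>N')"
    by (rule weighted_tendsto_Cc[OF _ cZ N N' W W' \<xi> \<xi>' lim, OF cont])
  have "(\<lambda>m. \<integral>\<omega>. 1 * complex_of_real (cutoff T (W m \<omega>)) \<partial>N m) \<longlonglongrightarrow> (\<integral>\<omega>. 1 * complex_of_real (cutoff T (W' \<omega>)) \<partial>N')"
    by (rule weighted_tendsto_Cc[where T="real T + 1", OF continuous_cutoff cutoff_zero N N'])
       (use lim1 in auto)
  then have "(\<lambda>m. Re (of_real (\<integral>\<omega>. cutoff T (W m \<omega>) \<partial>N m))) \<longlonglongrightarrow> Re (of_real (\<integral>\<omega>. cutoff T (W' \<omega>) \<partial>N'))"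
    by (intro tendsto_Re) simp
  then have "(\<lambda>m. \<integral>\<omega>. cutoff T (W m \<omega>) \<partial>N m) \<longlonglongrightarrow> (\<integral>\<omega>. cutoff T (W' \<omega>) \<partial>N')"
    by simp
  from order_tendstoD(1)[OF this T]
  have ev: "\<forall>\<^sub>F m in sequentially. 1 - e / (B + 1) < (\<integral>\<omega>. cutoff T (W m \<omega>) \<partial>N m)" .
  have fin: "B * (1 - t) \<le> e" if "1 - e / (B + 1) < t" for t
  proof -
    have "B * (1 - t) \<le> B * (e / (B + 1))" using that B0 by (intro mult_left_mono) auto
    also have "\<dots> \<le> e" using B0 e by (simp add: divide_simps)
    finally show ?thesis .
  qed
  show "\<exists>X' L'. X' \<longlonglongrightarrow> L' \<and> norm ((\<integral>\<omega>. \<xi>' \<omega> * of_real (f (W' \<omega>)) \<partial>N') - L') \<le> e \<and>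
      (\<forall>\<^sub>F m in sequentially. norm ((\<integral>\<omega>. \<xi> m \<omega> * of_real (f (W m \<omega>)) \<partial>N m) - X' m) \<le> e)"
  proof (intro exI conjI, rule L1)
    show "norm ((\<integral>\<omega>. \<xi>' \<omega> * of_real (f (W' \<omega>)) \<partial>N') - (\<integral>\<omega>. \<xi>' \<omega> * of_real (f (W' \<omega>) * cutoff T (W' \<omega>)) \<partial>N')) \<le> e"
      by (rule order_trans[OF weighted_cutoff_close[OF N' W' \<xi>' _ B] fin[OF T]]) measurable
    show "\<forall>\<^sub>F m in sequentially. norm ((\<integral>\<omega>. \<xi> m \<omega> * of_real (f (W m \<omega>)) \<partial>N m) - (\<integral>\<omega>. \<xi> m \<omega> * of_real (f (W m \<omega>) * cutoff T (W m \<omega>)) \<partial>N m)) \<le> e"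
      using ev
    proof eventually_elim
      case (elim m)
      then show ?case by (intro order_trans[OF weighted_cutoff_close[OF N W \<xi> _ B] fin]) simp_all
    qed
  qed
qed

corollary levy_continuity_vec:
  fixes M :: "nat \<Rightarrow> (real^'d) measure"
  assumes M: "\<And>m. prob_space (M m)" "\<And>m. sets (M m) = sets borel"
    and M': "prob_space M'" "sets M' = sets borel"
    and lim: "\<And>v. (\<lambda>m. \<integral>x. iexp (v \<bullet> x) \<partial>M m) \<longlonglongrightarrow> (\<integral>x. iexp (v \<bullet> x) \<partial>M')"
  shows "weak_conv_to M M'"
  unfolding weak_conv_to_def
proof (intro allI impI)
  fix f :: "real^'d \<Rightarrow> real" assume f: "continuous_on UNIV f" and b: "bounded (range f)"
  note [measurable_cong] = M(2) M'(2)
  from b obtain B where B: "\<And>x. \<bar>f x\<bar> \<le> B" by (auto simp: bounded_iff)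
  have "(\<lambda>m. \<integral>x. 1 * complex_of_real (f x) \<partial>M m) \<longlonglongrightarrow> (\<integral>x. 1 * complex_of_real (f x) \<partial>M')"
    by (rule weighted_levy_continuity[OF f B M(1) M'(1)]) (use lim in auto)
  then have "(\<lambda>m. complex_of_real (\<integral>x. f x \<partial>M m)) \<longlonglongrightarrow> of_real (\<integral>x. f x \<partial>M')"
    by simp
  then show "(\<lambda>m. \<integral>x. f x \<partial>M m) \<longlonglongrightarrow> (\<integral>x. f x \<partial>M')"
    by (simp only: tendsto_of_real_iff)
qed

definition bump :: "real \<Rightarrow> real \<Rightarrow> 'a::real_normed_vector \<Rightarrow> real" where
  "bump a d x = max 0 (1 - \<bar>(norm x)\<^sup>2 - a\<bar> / d)"

definition ramp :: "real \<Rightarrow> real \<Rightarrow> 'a::real_normed_vector \<Rightarrow> real" where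
  "ramp a d x = max 0 (min 1 (1 - ((norm x)\<^sup>2 - a) / d))"

lemma bump_bounds: "d > 0 \<Longrightarrow> 0 \<le> bump a d x" "d > 0 \<Longrightarrow> bump a d x \<le> 1"
  by (auto simp: bump_def)

lemma ramp_bounds: "0 \<le> ramp a d x" "ramp a d x \<le> 1"
  by (auto simp: ramp_def)

lemma continuous_bump: "continuous_on A (bump a d)"
  unfolding bump_def divide_inverse by (intro continuous_intros)

lemma continuous_ramp: "continuous_on A (ramp a d)"
  unfolding ramp_def divide_inverse by (intro continuous_intros)

lemma bump_measurable [measurable]: "bump a d \<in> borel_measurable borel"
  by (rule borel_measurable_continuous_onI[OF continuous_bump])

lemma ramp_measurable [measurable]: "ramp a d \<in> borel_measurable borel"
  by (rule borel_measurable_continuous_onI[OF continuous_ramp])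

lemma indicator_ramp_le_bump:
  assumes "d > 0"
  shows "\<bar>indicator {x. (norm x)\<^sup>2 \<le> a} x - ramp a d x\<bar> \<le> bump a d x"
proof (cases "(norm x)\<^sup>2 \<le> a")
  case True
  then have "((norm x)\<^sup>2 - a) / d \<le> 0" using assms by (simp add: divide_nonpos_pos)
  then have "ramp a d x = 1" by (simp add: ramp_def)
  then show ?thesis using True bump_bounds[OF assms] by simp
next
  case False
  then have "((norm x)\<^sup>2 - a) / d > 0" using assms by simp
  then show ?thesis using False by (auto simp: ramp_def bump_def abs_real_def)
qed

lemma std_gauss_sphere_null: "AE x in (std_gauss :: (real^'d) measure). (norm x)\<^sup>2 \<noteq> a"
proof -
  have "sphere (0::real^'d) (sqrt a) \<in> null_sets lborel"
    using negligible_sphere[of "0::real^'d" "sqrt a"]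
    by (auto simp: negligible_iff_null_sets null_sets_completion_iff)
  then have "AE x in lborel. x \<notin> sphere (0::real^'d) (sqrt a)" by (rule AE_not_in)
  then have "AE x in (lborel :: (real^'d) measure). (norm x)\<^sup>2 \<noteq> a"
    by eventually_elim auto
  then show ?thesis unfolding std_gauss_eq by (subst AE_density) auto
qed

lemma bump_gauss_small:
  assumes e: "e > 0"
  obtains d where "d > 0" "(\<integral>x. bump a d x \<partial>(std_gauss :: (real^'d) measure)) < e"
proof -
  have "(\<lambda>k. \<integral>x. bump a (1 / real (Suc k)) x \<partial>(std_gauss :: (real^'d) measure)) \<longlonglongrightarrow> (\<integral>x. 0 \<partial>(std_gauss :: (real^'d) measure))"
  proof (rule integral_dominated_convergence[where w="\<lambda>_. 1"])
    show "AE x in (std_gauss :: (real^'d) measure). (\<lambda>k. bump a (1 / real (Suc k)) x) \<longlonglongrightarrow> 0"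
      using std_gauss_sphere_null[of a]
    proof eventually_elim
      case (elim x)
      have "\<forall>\<^sub>F k in sequentially. 1 / \<bar>(norm x)\<^sup>2 - a\<bar> \<le> real k"
        by (rule eventually_at_top_linorderI[of "nat \<lceil>1 / \<bar>(norm x)\<^sup>2 - a\<bar>\<rceil>"]) linarith
      then have "\<forall>\<^sub>F k in sequentially. bump a (1 / real (Suc k)) x = 0"
      proof eventually_elim
        case (elim k)
        then have "1 \<le> \<bar>(norm x)\<^sup>2 - a\<bar> * real k"
          using \<open>(norm x)\<^sup>2 \<noteq> a\<close> by (simp add: field_simps)
        also have "\<dots> \<le> \<bar>(norm x)\<^sup>2 - a\<bar> * real (Suc k)" by (intro mult_left_mono) auto
        finally show ?case by (simp add: bump_def)
      qed
      then show ?case by (rule tendsto_eventually)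
    qed
  qed (auto simp: bump_bounds intro!: AE_I2)
  then have "\<forall>\<^sub>F k in sequentially. (\<integral>x. bump a (1 / real (Suc k)) x \<partial>(std_gauss :: (real^'d) measure)) < e"
    using e by (intro order_tendstoD(2)) auto
  then obtain k where "(\<integral>x. bump a (1 / real (Suc k)) x \<partial>(std_gauss :: (real^'d) measure)) < e"
    by (auto dest: eventually_happens)
  then show thesis by (intro that[of "1 / real (Suc k)"]) auto
qed

lemma weighted_ball_close:
  fixes V :: "'b \<Rightarrow> real^'d" and \<zeta> :: "'b \<Rightarrow> complex"
  assumes K: "prob_space K"
    and [measurable]: "V \<in> borel_measurable K" "\<zeta> \<in> borel_measurable K"
    and \<zeta>: "\<And>x. norm (\<zeta> x) \<le> 1" and d: "d > 0"
  shows "norm ((\<integral>\<omega>. \<zeta> \<omega> * indicator {x. (norm x)\<^sup>2 \<le> a} (V \<omega>) \<partial>K) - (\<integral>\<omega>. \<zeta> \<omega> * of_real (ramp a d (V \<omega>)) \<partial>K))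
     \<le> (\<integral>\<omega>. bump a d (V \<omega>) \<partial>K)"
proof -
  have ind: "indicator {x. (norm x)\<^sup>2 \<le> a} y = complex_of_real (indicator {x. (norm x)\<^sup>2 \<le> a} y)" for y :: "real^'d"
    by (simp add: indicator_def)
  have B: "\<bar>ramp a d y\<bar> \<le> 1" "\<bar>bump a d y\<bar> \<le> 1" for y :: "real^'d"
    using ramp_bounds[of a d y] bump_bounds[OF d, of a y] by auto
  show ?thesis unfolding ind
    by (rule weighted_integral_diff[where B=1])
       (use K \<zeta> in \<open>auto intro: B indicator_ramp_le_bump[OF d]\<close>)
qed

theorem weighted_ball_tendsto:
  fixes W :: "nat \<Rightarrow> 'b \<Rightarrow> real^'d" and \<xi> :: "nat \<Rightarrow> 'b \<Rightarrow> complex"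
  assumes N: "\<And>m. prob_space (N m)"
    and W [measurable]: "\<And>m. W m \<in> borel_measurable (N m)" "\<And>m. \<xi> m \<in> borel_measurable (N m)"
    and \<xi>'m [measurable]: "\<xi>' \<in> borel_measurable borel"
    and \<xi>: "\<And>m x. norm (\<xi> m x) \<le> 1" and \<xi>': "\<And>x. norm (\<xi>' x) \<le> 1"
    and lim1: "\<And>v. (\<lambda>m. \<integral>\<omega>. iexp (v \<bullet> W m \<omega>) \<partial>N m) \<longlonglongrightarrow> (\<integral>x. iexp (v \<bullet> x) \<partial>std_gauss)"
    and lim: "\<And>v. (\<lambda>m. \<integral>\<omega>. \<xi> m \<omega> * iexp (v \<bullet> W m \<omega>) \<partial>N m) \<longlonglongrightarrow> (\<integral>x. \<xi>' x * iexp (v \<bullet> x) \<partial>std_gauss)"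
  shows "(\<lambda>m. \<integral>\<omega>. \<xi> m \<omega> * indicator {x. (norm x)\<^sup>2 \<le> a} (W m \<omega>) \<partial>N m) \<longlonglongrightarrow>
    (\<integral>x. \<xi>' x * indicator {x. (norm x)\<^sup>2 \<le> a} x \<partial>std_gauss)"
proof (rule tendsto_approx)
  fix e :: real assume e: "e > 0"
  obtain d where d: "d > 0" "(\<integral>x. bump a d x \<partial>(std_gauss :: (real^'d) measure)) < e"
    using bump_gauss_small[OF e] .
  have id: "(\<lambda>x. x) \<in> borel_measurable (std_gauss :: (real^'d) measure)" "\<xi>' \<in> borel_measurable std_gauss" by auto
  have b1: "\<bar>ramp a d x\<bar> \<le> 1" for x :: "real^'d" using ramp_bounds[of a d x] by auto
  have b2: "\<bar>bump a d x\<bar> \<le> 1" for x :: "real^'d" using bump_bounds[OF d(1), of a x] by auto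
  have L1: "(\<lambda>m. \<integral>\<omega>. \<xi> m \<omega> * of_real (ramp a d (W m \<omega>)) \<partial>N m) \<longlonglongrightarrow>
      (\<integral>\<omega>. \<xi>' \<omega> * of_real (ramp a d \<omega>) \<partial>std_gauss)"
    by (rule weighted_levy_continuity[OF continuous_ramp b1 N prob_space_std_gauss W id \<xi> \<xi>' lim1 lim])
  have "(\<lambda>m. \<integral>\<omega>. 1 * complex_of_real (bump a d (W m \<omega>)) \<partial>N m) \<longlonglongrightarrow> (\<integral>\<omega>. 1 * complex_of_real (bump a d \<omega>) \<partial>(std_gauss :: (real^'d) measure))"
    by (rule weighted_levy_continuity[OF continuous_bump b2 N prob_space_std_gauss W(1)  _ id(1)])
       (use lim1 in auto)
  then have "(\<lambda>m. complex_of_real (\<integral>\<omega>. bump a d (W m \<omega>) \<partial>N m)) \<longlonglongrightarrow> of_real (\<integral>\<omega>. bump a d \<omega> \<partial>(std_gauss :: (real^'d) measure))"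
    by simp
  then have "(\<lambda>m. (\<integral>\<omega>. bump a d (W m \<omega>) \<partial>N m)) \<longlonglongrightarrow> (\<integral>\<omega>. bump a d \<omega> \<partial>(std_gauss :: (real^'d) measure))"
    by (simp only: tendsto_of_real_iff)
  from order_tendstoD(2)[OF this d(2)]
  have ev: "\<forall>\<^sub>F m in sequentially. (\<integral>\<omega>. bump a d (W m \<omega>) \<partial>N m) < e" .
  show "\<exists>X' L'. X' \<longlonglongrightarrow> L' \<and> norm ((\<integral>x. \<xi>' x * indicator {x. (norm x)\<^sup>2 \<le> a} x \<partial>std_gauss) - L') \<le> e \<and>
      (\<forall>\<^sub>F m in sequentially. norm ((\<integral>\<omega>. \<xi> m \<omega> * indicator {x. (norm x)\<^sup>2 \<le> a} (W m \<omega>) \<partial>N m) - X' m) \<le> e)"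
  proof (intro exI conjI, rule L1)
    show "norm ((\<integral>x. \<xi>' x * indicator {x. (norm x)\<^sup>2 \<le> a} x \<partial>std_gauss) - (\<integral>\<omega>. \<xi>' \<omega> * of_real (ramp a d \<omega>) \<partial>std_gauss)) \<le> e"
      using weighted_ball_close[OF prob_space_std_gauss id \<xi>' d(1), of a] d(2) by linarith
    show "\<forall>\<^sub>F m in sequentially. norm ((\<integral>\<omega>. \<xi> m \<omega> * indicator {x. (norm x)\<^sup>2 \<le> a} (W m \<omega>) \<partial>N m) -
       (\<integral>\<omega>. \<xi> m \<omega> * of_real (ramp a d (W m \<omega>)) \<partial>N m)) \<le> e"
      using ev
    proof eventually_elim
      case (elim m)
      then show ?case by (intro order_trans[OF weighted_ball_close[OF N W \<xi> d(1)]]) simp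
    qed
  qed
qed

definition ball_char :: "real \<Rightarrow> real^'d \<Rightarrow> complex" where
  "ball_char a w = (\<integral>x. iexp (w \<bullet> x) * indicator {x. (norm x)\<^sup>2 \<le> a} x \<partial>std_gauss)"

lemma ball_char_radial:
  fixes w w' :: "real^'d"
  assumes "norm w = norm w'"
  shows "ball_char a w = ball_char a w'"
proof -
  obtain T where T: "orthogonal_transformation T" "T w = w'"
    using orthogonal_transformation_exists[OF assms] .
  have lin: "linear T" using T(1) by (rule orthogonal_transformation_linear)
  then have [measurable]: "T \<in> borel_measurable borel"
    by (intro borel_measurable_continuous_onI linear_continuous_on linear_conv_bounded_linear[THEN iffD1])
  have inn: "T x \<bullet> T y = x \<bullet> y" for x y
    using T(1) by (simp add: orthogonal_transformation_def)
  obtain T' where T': "\<And>v. T (T' v) = v" "orthogonal_transformation T'"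
    using surj_f_inv_f[OF orthogonal_transformation_surj[OF T(1)]] orthogonal_transformation_inv[OF T(1)] by blast
  have 1: "(\<integral>x. iexp (v \<bullet> T x) \<partial>std_gauss) = (\<integral>x. iexp (v \<bullet> x) \<partial>std_gauss)" for v
  proof -
    have "v \<bullet> T x = T' v \<bullet> x" for x using inn[of "T' v" x] T'(1) by simp
    moreover have "norm (T' v) = norm v" using T'(2) by (simp add: orthogonal_transformation)
    ultimately show ?thesis by (simp add: char_std_gauss)
  qed
  have "(\<lambda>m::nat. \<integral>x. iexp (w' \<bullet> T x) * indicator {x. (norm x)\<^sup>2 \<le> a} (T x) \<partial>std_gauss) \<longlonglongrightarrow>
      (\<integral>x. iexp (w' \<bullet> x) * indicator {x. (norm x)\<^sup>2 \<le> a} x \<partial>std_gauss)"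
  proof (rule weighted_ball_tendsto)
    show "(\<lambda>m. \<integral>\<omega>. iexp (v \<bullet> T \<omega>) \<partial>std_gauss) \<longlonglongrightarrow> (\<integral>x. iexp (v \<bullet> x) \<partial>std_gauss)" for v
      unfolding 1 by simp
    have "iexp (w' \<bullet> x) * iexp (v \<bullet> x) = iexp ((w' + v) \<bullet> x)" for v x
      by (simp add: exp_add[symmetric] inner_add_left distrib_left)
    then show "(\<lambda>m. \<integral>\<omega>. iexp (w' \<bullet> T \<omega>) * iexp (v \<bullet> T \<omega>) \<partial>std_gauss) \<longlonglongrightarrow> (\<integral>x. iexp (w' \<bullet> x) * iexp (v \<bullet> x) \<partial>std_gauss)" for v
      by (simp only: 1 tendsto_const)
  qed (auto simp: prob_space_std_gauss)
  moreover have "w' \<bullet> T x = w \<bullet> x" for x using inn[of w x] T(2) by simp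
  moreover have "norm (T x) = norm x" for x using T(1) by (simp add: orthogonal_transformation)
  ultimately have "(\<lambda>m::nat. ball_char a w) \<longlonglongrightarrow> ball_char a w'"
    by (simp add: ball_char_def indicator_def)
  then show ?thesis by (rule LIMSEQ_const_iff[THEN iffD1])
qed

lemma ball_char_tendsto:
  fixes w :: "nat \<Rightarrow> real^'d" and w' :: "real^'d"
  assumes "(\<lambda>m. norm (w m)) \<longlonglongrightarrow> norm w'"
  shows "(\<lambda>m. ball_char a (w m)) \<longlonglongrightarrow> ball_char a w'"
proof -
  obtain e :: "real^'d" where e: "norm e = 1" using vector_choose_size[of 1] by auto
  have eq: "ball_char a v = ball_char a (norm v *\<^sub>R e)" for v :: "real^'d"
    by (rule ball_char_radial) (simp add: e)
  have "(\<lambda>m. ball_char a (norm (w m) *\<^sub>R e)) \<longlonglongrightarrow> ball_char a (norm w' *\<^sub>R e)"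
    unfolding ball_char_def
  proof (rule integral_dominated_convergence[where w="\<lambda>_. 1"])
    show "AE x in std_gauss. (\<lambda>m. iexp ((norm (w m) *\<^sub>R e) \<bullet> x) * indicator {x. (norm x)\<^sup>2 \<le> a} x) \<longlonglongrightarrow>
        iexp ((norm w' *\<^sub>R e) \<bullet> x) * indicator {x. (norm x)\<^sup>2 \<le> a} x"
      by (intro AE_I2 tendsto_intros assms)
  qed (auto simp: indicator_def norm_mult intro!: AE_I2)
  moreover have "(\<lambda>m. ball_char a (w m)) = (\<lambda>m. ball_char a (norm (w m) *\<^sub>R e))"
    by (rule ext) (rule eq)
  ultimately show ?thesis by (simp only: eq[of w'])
qed

lemma ball_char_0: "ball_char a (0::real^'d) = of_real (measure (std_gauss :: (real^'d) measure) {x. (norm x)\<^sup>2 \<le> a})"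
proof -
  have "ball_char a (0::real^'d) = (\<integral>x. of_real (indicator {x. (norm x)\<^sup>2 \<le> a} x) \<partial>(std_gauss :: (real^'d) measure))"
    unfolding ball_char_def by (intro Bochner_Integration.integral_cong) (auto simp: indicator_def)
  then show ?thesis by simp
qed

lemma std_gauss_ball_pos:
  assumes "a > 0"
  shows "measure (std_gauss :: (real^'d) measure) {x. (norm x)\<^sup>2 \<le> a} > 0"
proof (rule ccontr)
  let ?S = "{x::real^'d. (norm x)\<^sup>2 \<le> a}"
  assume "\<not> measure (std_gauss :: (real^'d) measure) ?S > 0"
  then have "measure (std_gauss :: (real^'d) measure) ?S = 0"
    using measure_nonneg[of "std_gauss :: (real^'d) measure" ?S] by linarith
  then have "AE x in (std_gauss :: (real^'d) measure). x \<notin> ?S"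
    by (intro AE_not_in) (auto simp: null_sets_def std_gauss.emeasure_eq_measure)
  then have "AE x in (lborel :: (real^'d) measure). 0 < gauss_dens x \<longrightarrow> x \<notin> ?S"
    unfolding std_gauss_eq by (subst (asm) AE_density) auto
  moreover have "0 < gauss_dens x" for x :: "real^'d" by (simp add: gauss_dens_eq)
  ultimately have "AE x in (lborel :: (real^'d) measure). x \<notin> ?S" by simp
  then have "AE x in (lborel :: (real^'d) measure). x \<notin> ball 0 (sqrt a)"
  proof eventually_elim
    case (elim x)
    then show ?case using power_mono[of "norm x" "sqrt a" 2] assms by auto
  qed
  then have "ball (0::real^'d) (sqrt a) \<in> null_sets lborel"
    by (subst AE_iff_null_sets) auto
  then have "emeasure lborel (ball (0::real^'d) (sqrt a)) = 0" by auto
  moreover have "emeasure lborel (ball (0::real^'d) (sqrt a)) > 0"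
    using assms unit_ball_vol_pos[of "real CARD('d)"] by (simp add: emeasure_ball)
  ultimately show False by simp
qed

section \<open>A combinatorial central limit theorem\<close>

lemma integral_indicator_iexp:
  assumes r: "r > 0"
  shows "(\<integral>t. indicator {-(pi * r)..pi * r} t *\<^sub>R iexp (t * of_int k / r) \<partial>lborel) = (if k = 0 then of_real (2 * pi * r) else 0)"
proof (cases "k = 0")
  case True
  have "(\<integral>t. indicator {-(pi * r)..pi * r} t *\<^sub>R iexp (t * of_int k / r) \<partial>lborel) =
     (\<integral>t. complex_of_real (indicator {-(pi * r)..pi * r} t) \<partial>lborel)"
    using True by (simp add: scaleR_conv_of_real)
  also have "\<dots> = of_real (2 * pi * r)"
    using r by (subst integral_complex_of_real) (simp add: measure_def)
  finally show ?thesis using True by simp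
next
  case False
  let ?F = "\<lambda>t. iexp (t * of_int k / r) * (of_real r / (\<i> * of_int k))"
  have "(\<integral>t. indicator {-(pi * r)..pi * r} t *\<^sub>R iexp (t * of_int k / r) \<partial>lborel) = ?F (pi * r) - ?F (-(pi * r))"
  proof (rule integral_FTC_atLeastAtMost)
    show "- (pi * r) \<le> pi * r" using r by simp
    show "continuous_on {- (pi * r)..pi * r} (\<lambda>t. iexp (t * of_int k / r))"
      using r by (intro continuous_intros) auto
    fix t
    show "(?F has_vector_derivative iexp (t * of_int k / r)) (at t within {- (pi * r)..pi * r})"
    proof -
      define w where "w = \<i> * of_int k / of_real r"
      have w: "w \<noteq> 0" "of_real r / (\<i> * of_int k) = 1 / w" using r False by (auto simp: w_def)
      have e: "iexp (x * of_int k / r) = exp (x *\<^sub>R w)" for x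
        by (simp add: w_def scaleR_conv_of_real field_simps)
      have "((\<lambda>x. exp (x *\<^sub>R w) * (1 / w)) has_vector_derivative (exp (t *\<^sub>R w) * w) * (1 / w)) (at t within {- (pi * r)..pi * r})"
        by (intro has_vector_derivative_mult_left exp_scaleR_has_vector_derivative_right)
      then show ?thesis unfolding e w(2) using w(1) by simp
    qed
  qed
  also have "iexp (pi * r * of_int k / r) = iexp (- (pi * r) * of_int k / r)"
  proof -
    have "iexp (pi * of_int k) = iexp (- (pi * of_int k))"
      by (rule complex_eqI) (simp_all add: Re_exp Im_exp)
    then show ?thesis using r by simp
  qed
  then have "?F (pi * r) - ?F (-(pi * r)) = 0" by simp
  finally show ?thesis using False by simp
qed

definition ext0 :: "'q \<Rightarrow> ('q \<Rightarrow> real) \<Rightarrow> 'q \<Rightarrow> real" where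
  "ext0 q0 s q = (if q = q0 then 0 else s q)"

lemma ext0_measurable [measurable]:
  "(\<lambda>s. ext0 q0 s q) \<in> borel_measurable (PiM (UNIV - {q0}) (\<lambda>_. lborel))"
  unfolding ext0_def by (cases "q = q0") auto

lemma sum_ext0:
  fixes g :: "'q::finite \<Rightarrow> real"
  shows "(\<Sum>q\<in>UNIV. g q * ext0 q0 s q) = (\<Sum>q\<in>UNIV - {q0}. g q * s q)"
proof -
  have "(\<Sum>q\<in>UNIV. g q * ext0 q0 s q) = (\<Sum>q\<in>UNIV - {q0}. g q * ext0 q0 s q)"
    by (rule sum.mono_neutral_right) (auto simp: ext0_def)
  also have "\<dots> = (\<Sum>q\<in>UNIV - {q0}. g q * s q)" by (rule sum.cong) (auto simp: ext0_def)
  finally show ?thesis .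
qed

definition freq_fun :: "'q::finite \<Rightarrow> nat \<Rightarrow> ('q \<Rightarrow> nat) \<Rightarrow> (nat \<Rightarrow> 'q \<Rightarrow> real) \<Rightarrow> ('q \<Rightarrow> real) \<Rightarrow> complex" where
  "freq_fun q0 n nq A s =
     (\<Prod>i<n. \<Sum>q\<in>UNIV. of_real (real (nq q) / real n) * iexp (A i q + ext0 q0 s q / sqrt n)) *
     iexp (- (\<Sum>q\<in>UNIV. real (nq q) * ext0 q0 s q) / sqrt n)"

lemma freq_fun_measurable [measurable]:
  "freq_fun q0 n nq A \<in> borel_measurable (PiM (UNIV - {q0}) (\<lambda>_. lborel))"
  unfolding freq_fun_def by measurable

definition freq_box :: "'q \<Rightarrow> nat \<Rightarrow> ('q \<Rightarrow> real) \<Rightarrow> complex" where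
  "freq_box q0 n s = (\<Prod>q\<in>UNIV - {q0}. indicator {-(pi * sqrt n)..pi * sqrt n} (s q))"

lemma freq_box_measurable [measurable]:
  "freq_box (q0::'q::finite) n \<in> borel_measurable (PiM (UNIV - {q0}) (\<lambda>_. lborel))"
proof -
  have [measurable]: "(\<lambda>s. indicator {-(pi * sqrt n)..pi * sqrt n} (s q) :: complex) \<in> borel_measurable (PiM (UNIV - {q0}) (\<lambda>_. lborel))" if "q \<in> UNIV - {q0}" for q
    using that by (intro measurable_compose[OF measurable_component_singleton[OF that]]) auto
  show ?thesis unfolding freq_box_def by measurable
qed

lemma finite_assignments: "finite (assignments n (nq :: 'q::finite \<Rightarrow> nat))"
proof (rule finite_subset)
  show "assignments n nq \<subseteq> PiE {..<n} (\<lambda>_. UNIV)"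
    by (auto simp: assignments_def PiE_def extensional_def)
qed (auto intro: finite_PiE)

lemma sum_by_label:
  fixes z :: "nat \<Rightarrow> 'q::finite" and g :: "'q \<Rightarrow> 'a::comm_ring_1"
  shows "(\<Sum>i<n. g (z i)) = (\<Sum>q\<in>UNIV. of_nat (card {i. i < n \<and> z i = q}) * g q)"
proof -
  have "(\<Sum>i<n. g (z i)) = (\<Sum>q\<in>UNIV. \<Sum>i | i < n \<and> z i = q. g (z i))"
    by (subst sum.group[where g=z and S="{..<n}" and T=UNIV, symmetric]) (auto intro!: sum.cong)
  also have "\<dots> = (\<Sum>q\<in>UNIV. of_nat (card {i. i < n \<and> z i = q}) * g q)"
    by (rule sum.cong) auto
  finally show ?thesis .
qed

lemma sum_card_labels:
  fixes z :: "nat \<Rightarrow> 'q::finite"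
  shows "(\<Sum>q\<in>UNIV. card {i. i < n \<and> z i = q}) = n"
  using sum_by_label[of "\<lambda>_. 1::int" z n] by (simp flip: of_nat_sum)

lemma prod_by_label:
  fixes z :: "nat \<Rightarrow> 'q::finite" and g :: "'q \<Rightarrow> 'a::comm_ring_1"
  shows "(\<Prod>i<n. g (z i)) = (\<Prod>q\<in>UNIV. g q ^ card {i. i < n \<and> z i = q})"
proof -
  have "(\<Prod>i<n. g (z i)) = (\<Prod>q\<in>UNIV. \<Prod>i | i < n \<and> z i = q. g (z i))"
    by (subst prod.group[where g=z and S="{..<n}" and T=UNIV, symmetric]) (auto intro!: prod.cong)
  also have "\<dots> = (\<Prod>q\<in>UNIV. g q ^ card {i. i < n \<and> z i = q})"
    by (rule prod.cong) auto
  finally show ?thesis .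
qed

text \<open>Fourier inversion on the torus extracts the assignments with the prescribed group sizes from
  the independent multinomial assignment. The count of the label \<open>q0\<close> is
  determined by the others, so its frequency is fixed at 0.\<close>

lemma fourier_assignments:
  fixes nq :: "'q::finite \<Rightarrow> nat"
  assumes n: "n > 0" and nq: "(\<Sum>q\<in>UNIV. nq q) = n"
  shows "(\<integral>s. freq_box q0 n s * freq_fun q0 n nq A s \<partial>PiM (UNIV - {q0}) (\<lambda>_. lborel)) =
    of_real ((2 * pi * sqrt n) ^ card (UNIV - {q0}) * (\<Prod>q\<in>UNIV. (real (nq q) / real n) ^ nq q)) *
    (\<Sum>z\<in>assignments n nq. iexp (\<Sum>i<n. A i (z i)))"
proof -
  let ?J = "UNIV - {q0} :: 'q set"
  let ?P = "PiM ?J (\<lambda>_. lborel :: real measure)"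
  interpret product_sigma_finite "\<lambda>_::'q. lborel :: real measure" ..
  define p where "p q = real (nq q) / real n" for q
  define N where "N z q = card {i. i < n \<and> z i = q}" for z :: "nat \<Rightarrow> 'q" and q
  let ?r = "sqrt n"
  have r: "?r > 0" using n by simp
  let ?h = "\<lambda>z q t. indicator {-(pi * ?r)..pi * ?r} t *\<^sub>R iexp (t * of_int (int (N z q) - int (nq q)) / ?r)"
  define W where "W z = (\<Prod>i<n. of_real (p (z i)) * iexp (A i (z i)))" for z
  have expand: "freq_box q0 n s * freq_fun q0 n nq A s = (\<Sum>z\<in>PiE {..<n} (\<lambda>_. UNIV). W z * (\<Prod>q\<in>?J. ?h z q (s q)))" for s
  proof -
    have "(\<Prod>i<n. \<Sum>q\<in>UNIV. of_real (p q) * iexp (A i q + ext0 q0 s q / ?r)) =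
       (\<Sum>z\<in>PiE {..<n} (\<lambda>_. UNIV). \<Prod>i<n. of_real (p (z i)) * iexp (A i (z i) + ext0 q0 s (z i) / ?r))"
      by (subst prod_sum_PiE) auto
    also have "\<dots> = (\<Sum>z\<in>PiE {..<n} (\<lambda>_. UNIV). W z * iexp ((\<Sum>q\<in>?J. real (N z q) * s q) / ?r))"
    proof (rule sum.cong[OF refl])
      fix z
      have "(\<Sum>i<n. ext0 q0 s (z i) / ?r) = (\<Sum>q\<in>?J. real (N z q) * s q) / ?r"
        unfolding sum_divide_distrib[symmetric] sum_by_label[of "ext0 q0 s"] sum_ext0 N_def ..
      moreover have "(\<Prod>i<n. of_real (p (z i)) * iexp (A i (z i) + ext0 q0 s (z i) / ?r)) = W z * iexp (\<Sum>i<n. ext0 q0 s (z i) / ?r)"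
        unfolding W_def iexp_sum[OF finite_lessThan] prod.distrib[symmetric]
        by (rule prod.cong) (auto simp: exp_add distrib_left)
      ultimately show "(\<Prod>i<n. of_real (p (z i)) * iexp (A i (z i) + ext0 q0 s (z i) / ?r)) = W z * iexp ((\<Sum>q\<in>?J. real (N z q) * s q) / ?r)"
        by simp
    qed
    finally have 1: "freq_fun q0 n nq A s = (\<Sum>z\<in>PiE {..<n} (\<lambda>_. UNIV). W z *
        (iexp ((\<Sum>q\<in>?J. real (N z q) * s q) / ?r) * iexp (- (\<Sum>q\<in>?J. real (nq q) * s q) / ?r)))"
      unfolding freq_fun_def p_def[symmetric] sum_ext0 by (simp add: sum_distrib_right mult.assoc)
    have 2: "iexp ((\<Sum>q\<in>?J. real (N z q) * s q) / ?r) * iexp (- (\<Sum>q\<in>?J. real (nq q) * s q) / ?r) =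
       (\<Prod>q\<in>?J. iexp (s q * of_int (int (N z q) - int (nq q)) / ?r))" for z
    proof -
      have "(\<Sum>q\<in>?J. s q * of_int (int (N z q) - int (nq q)) / ?r) = (\<Sum>q\<in>?J. real (N z q) * s q) / ?r + - (\<Sum>q\<in>?J. real (nq q) * s q) / ?r"
        by (simp add: sum_divide_distrib sum_subtractf[symmetric] algebra_simps diff_divide_distrib)
      then show ?thesis
        unfolding iexp_sum[symmetric, OF finite] by (simp only: exp_add[symmetric] distrib_left[symmetric] of_real_add[symmetric])
    qed
    show ?thesis unfolding 1 2 freq_box_def sum_distrib_left
    proof (rule sum.cong[OF refl])
      fix z
      have "(\<Prod>q\<in>?J. ?h z q (s q)) = (\<Prod>q\<in>?J. indicator {-(pi * ?r)..pi * ?r} (s q)) * (\<Prod>q\<in>?J. iexp (s q * of_int (int (N z q) - int (nq q)) / ?r))"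
        unfolding prod.distrib[symmetric] by (rule prod.cong) (auto simp: indicator_def)
      then show "(\<Prod>q\<in>?J. indicator {-(pi * ?r)..pi * ?r} (s q)) * (W z * (\<Prod>q\<in>?J. iexp (s q * of_int (int (N z q) - int (nq q)) / ?r))) = W z * (\<Prod>q\<in>?J. ?h z q (s q))"
        by simp
    qed
  qed
  have inth: "integrable lborel (?h z q)" for z q
    by (rule borel_integrable_compact) (use r in \<open>auto intro!: continuous_intros\<close>)
  have int: "integrable ?P (\<lambda>s. \<Prod>q\<in>?J. ?h z q (s q))" for z
    by (rule product_integrable_prod[OF finite inth])
  have "(\<integral>s. freq_box q0 n s * freq_fun q0 n nq A s \<partial>?P) = (\<Sum>z\<in>PiE {..<n} (\<lambda>_. UNIV). W z * (\<integral>s. (\<Prod>q\<in>?J. ?h z q (s q)) \<partial>?P))"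
    unfolding expand by (subst Bochner_Integration.integral_sum) (use int in auto)
  also have "\<dots> = (\<Sum>z\<in>PiE {..<n} (\<lambda>_. UNIV). W z * (\<Prod>q\<in>?J. integral\<^sup>L lborel (?h z q)))"
    using inth by (subst product_integral_prod) auto
  also have "\<dots> = (\<Sum>z\<in>PiE {..<n} (\<lambda>_. UNIV). W z * (\<Prod>q\<in>?J. if int (N z q) - int (nq q) = 0 then of_real (2 * pi * ?r) else 0))"
    unfolding integral_indicator_iexp[OF r] ..
  also have "\<dots> = (\<Sum>z\<in>assignments n nq. W z * of_real (2 * pi * ?r) ^ card ?J)"
  proof (rule sum.mono_neutral_cong_right)
    show "finite (PiE {..<n} (\<lambda>_. UNIV :: 'q set))" by (auto intro: finite_PiE)
    show "assignments n nq \<subseteq> PiE {..<n} (\<lambda>_. UNIV)"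
      by (auto simp: assignments_def PiE_def extensional_def)
    show "W z * (\<Prod>q\<in>?J. if int (N z q) - int (nq q) = 0 then of_real (2 * pi * ?r) else 0) = W z * of_real (2 * pi * ?r) ^ card ?J"
      if "z \<in> assignments n nq" for z
      using that by (auto simp: assignments_def N_def)
    show "\<forall>z\<in>PiE {..<n} (\<lambda>_. UNIV) - assignments n nq. W z * (\<Prod>q\<in>?J. if int (N z q) - int (nq q) = 0 then of_real (2 * pi * ?r) else 0) = 0"
    proof
      fix z assume z: "z \<in> PiE {..<n} (\<lambda>_. UNIV) - assignments n nq"
      have "\<exists>q\<in>?J. N z q \<noteq> nq q"
      proof (rule ccontr)
        assume "\<not> ?thesis"
        then have eq: "N z q = nq q" if "q \<noteq> q0" for q using that by auto
        have "N z q0 + (\<Sum>q\<in>?J. N z q) = nq q0 + (\<Sum>q\<in>?J. nq q)"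
          using sum_card_labels[where z=z and n=n] nq by (simp add: N_def sum.remove[of UNIV q0])
        moreover have "(\<Sum>q\<in>?J. N z q) = (\<Sum>q\<in>?J. nq q)" by (rule sum.cong) (auto simp: eq)
        ultimately have "N z q0 = nq q0" by simp
        then have "\<forall>q. N z q = nq q" using eq by metis
        then have "z \<in> assignments n nq" using z by (auto simp: assignments_def N_def PiE_def extensional_def)
        then show False using z by simp
      qed
      then show "W z * (\<Prod>q\<in>?J. if int (N z q) - int (nq q) = 0 then of_real (2 * pi * ?r) else 0) = 0"
        by auto
    qed
  qed
  also have "\<dots> = (\<Sum>z\<in>assignments n nq. of_real ((2 * pi * ?r) ^ card ?J * (\<Prod>q\<in>UNIV. p q ^ nq q)) * iexp (\<Sum>i<n. A i (z i)))"
  proof (rule sum.cong[OF refl])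
    fix z assume "z \<in> assignments n nq"
    then have z: "card {i. i < n \<and> z i = q} = nq q" for q by (auto simp: assignments_def)
    have "W z = of_real (\<Prod>i<n. p (z i)) * iexp (\<Sum>i<n. A i (z i))"
      unfolding W_def iexp_sum[OF finite_lessThan] prod.distrib of_real_prod ..
    also have "(\<Prod>i<n. p (z i)) = (\<Prod>q\<in>UNIV. p q ^ nq q)" unfolding prod_by_label[of p z n] z ..
    finally show "W z * of_real (2 * pi * ?r) ^ card ?J = of_real ((2 * pi * ?r) ^ card ?J * (\<Prod>q\<in>UNIV. p q ^ nq q)) * iexp (\<Sum>i<n. A i (z i))"
      by (simp del: of_real_prod of_real_sum add: mult_ac)
  qed
  finally show ?thesis unfolding p_def by (simp only: sum_distrib_left)
qed

lemma iexp_quadratic_bound: "cmod (iexp x - (1 + \<i> * x - of_real (x\<^sup>2 / 2))) \<le> \<bar>x\<bar> ^ 3"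
proof -
  have "(\<Sum>k\<le>2. (\<i> * x) ^ k / fact k) = 1 + \<i> * x - of_real (x\<^sup>2 / 2)"
    by (simp add: numeral_2_eq_2 power2_eq_square complex_eq_iff)
  then have "cmod (iexp x - (1 + \<i> * x - of_real (x\<^sup>2 / 2))) \<le> \<bar>x\<bar> ^ 3 / fact 3"
    using iexp_approx1[of x 2] by (simp add: eval_nat_numeral)
  also have "\<dots> \<le> \<bar>x\<bar> ^ 3" by (simp add: fact_numeral)
  finally show ?thesis .
qed

lemma exp_minus_quadratic_bound:
  fixes y :: real assumes "y \<ge> 0"
  shows "\<bar>exp (- y) - (1 - y)\<bar> \<le> y\<^sup>2"
proof -
  have "1 - y \<le> exp (- y)" using exp_ge_add_one_self[of "- y"] by simp
  moreover have "exp (- y) \<le> 1 / (1 + y)"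
    using exp_ge_add_one_self[of y] assms by (simp add: exp_minus field_simps)
  moreover have "1 / (1 + y) \<le> 1 - y + y\<^sup>2"
    using assms by (simp add: field_simps power2_eq_square)
  ultimately show ?thesis by linarith
qed

lemma finite_char_approx:
  fixes p X :: "'q::finite \<Rightarrow> real"
  assumes p: "\<And>q. p q \<ge> 0" "(\<Sum>q\<in>UNIV. p q) = 1" and mean: "(\<Sum>q\<in>UNIV. p q * X q) = 0"
    and X: "\<And>q. \<bar>X q\<bar> \<le> d"
  defines "v \<equiv> (\<Sum>q\<in>UNIV. p q * (X q)\<^sup>2)"
  shows "cmod ((\<Sum>q\<in>UNIV. of_real (p q) * iexp (X q)) - of_real (exp (- v / 2))) \<le> (d + d\<^sup>2) * v"
proof -
  have d: "d \<ge> 0" using X[of undefined] by linarith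
  have v0: "v \<ge> 0" unfolding v_def by (intro sum_nonneg mult_nonneg_nonneg p) auto
  have vd: "v \<le> d\<^sup>2"
  proof -
    have "v \<le> (\<Sum>q\<in>UNIV. p q * d\<^sup>2)" unfolding v_def
      using X by (intro sum_mono mult_left_mono p) (metis abs_le_square_iff abs_of_nonneg d)
    then show ?thesis using p(2) by (simp flip: sum_distrib_right)
  qed
  have quad: "(\<Sum>q\<in>UNIV. of_real (p q) * (1 + \<i> * X q - of_real ((X q)\<^sup>2 / 2))) = complex_of_real (1 - v / 2)"
  proof -
    have "(\<Sum>q\<in>UNIV. of_real (p q) * (1 + \<i> * X q - of_real ((X q)\<^sup>2 / 2))) =
      of_real (\<Sum>q\<in>UNIV. p q) + \<i> * of_real (\<Sum>q\<in>UNIV. p q * X q) - of_real (v / 2)"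
      unfolding v_def
      by (simp add: algebra_simps sum.distrib sum_subtractf sum_distrib_left sum_divide_distrib)
    then show ?thesis using p(2) mean by simp
  qed
  have "cmod ((\<Sum>q\<in>UNIV. of_real (p q) * iexp (X q)) - of_real (1 - v / 2)) =
     cmod (\<Sum>q\<in>UNIV. of_real (p q) * (iexp (X q) - (1 + \<i> * X q - of_real ((X q)\<^sup>2 / 2))))"
    unfolding quad[symmetric] by (simp add: sum_subtractf[symmetric] right_diff_distrib)
  also have "\<dots> \<le> (\<Sum>q\<in>UNIV. p q * (d * (X q)\<^sup>2))"
  proof (rule sum_norm_le)
    fix q
    have "cmod (of_real (p q) * (iexp (X q) - (1 + \<i> * X q - of_real ((X q)\<^sup>2 / 2)))) \<le> p q * \<bar>X q\<bar> ^ 3"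
      unfolding norm_mult norm_of_real using p(1)[of q] iexp_quadratic_bound[of "X q"] by (simp add: mult_left_mono)
    also have "\<bar>X q\<bar> ^ 3 = \<bar>X q\<bar> * (X q)\<^sup>2" by (simp add: power3_eq_cube power2_eq_square)
    also have "p q * (\<bar>X q\<bar> * (X q)\<^sup>2) \<le> p q * (d * (X q)\<^sup>2)"
      by (intro mult_left_mono mult_right_mono X p) auto
    finally show "cmod (of_real (p q) * (iexp (X q) - (1 + \<i> * X q - of_real ((X q)\<^sup>2 / 2)))) \<le> p q * (d * (X q)\<^sup>2)" .
  qed
  also have "\<dots> = d * v" unfolding v_def by (simp add: sum_distrib_left mult_ac)
  finally have 1: "cmod ((\<Sum>q\<in>UNIV. of_real (p q) * iexp (X q)) - of_real (1 - v / 2)) \<le> d * v" .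
  have "cmod (of_real (1 - v / 2) - of_real (exp (- v / 2))) = \<bar>exp (- (v / 2)) - (1 - v / 2)\<bar>"
    by (simp only: of_real_diff[symmetric] norm_of_real abs_minus_commute) simp
  also have "\<dots> \<le> (v / 2)\<^sup>2" by (rule exp_minus_quadratic_bound) (use v0 in simp)
  also have "\<dots> \<le> v * v" using v0 by (simp add: power2_eq_square)
  also have "\<dots> \<le> d\<^sup>2 * v" using vd v0 by (rule mult_right_mono)
  finally have 2: "cmod (of_real (1 - v / 2) - of_real (exp (- v / 2))) \<le> d\<^sup>2 * v" .
  show ?thesis
    using norm_triangle_ineq[of "(\<Sum>q\<in>UNIV. of_real (p q) * iexp (X q)) - of_real (1 - v / 2)" "of_real (1 - v / 2) - of_real (exp (- v / 2))"] 1 2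
    by (simp add: algebra_simps)
qed

lemma one_minus_cos_ge:
  assumes "\<bar>t\<bar> \<le> pi"
  shows "t\<^sup>2 / 16 \<le> 1 - cos t"
proof -
  have sin_half: "y / 2 \<le> sin y" if y: "0 \<le> y" "y \<le> pi / 4" for y
  proof -
    have "sin 0 - 0 / 2 \<le> sin y - y / 2"
    proof (rule DERIV_nonneg_imp_nondecreasing[OF y(1), where f="\<lambda>y. sin y - y / 2"])
      fix u assume u: "0 \<le> u" "u \<le> y"
      have "cos (pi / 3) \<le> cos u" using u y by (intro cos_monotone_0_pi_le) auto
      then have "0 \<le> cos u - 1 / 2" by (simp add: cos_60)
      moreover have "((\<lambda>y. sin y - y / 2) has_real_derivative cos u - 1 / 2) (at u)"
        by (auto intro!: derivative_eq_intros)
      ultimately show "\<exists>D. ((\<lambda>y. sin y - y / 2) has_real_derivative D) (at u) \<and> 0 \<le> D" by blast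
    qed
    then show ?thesis by simp
  qed
  have "\<bar>t\<bar> / 8 \<le> sin (\<bar>t\<bar> / 4)" using sin_half[of "\<bar>t\<bar> / 4"] assms by simp
  then have "(\<bar>t\<bar> / 8)\<^sup>2 \<le> (sin (\<bar>t\<bar> / 4))\<^sup>2" by (rule power_mono) simp
  then have 1: "t\<^sup>2 / 64 \<le> (sin (\<bar>t\<bar> / 4))\<^sup>2" by (simp add: power_divide)
  have c0: "0 \<le> cos (\<bar>t\<bar> / 2)" using assms by (intro cos_ge_zero) auto
  have 2: "1 - cos (\<bar>t\<bar> / 2) = 2 * (sin (\<bar>t\<bar> / 4))\<^sup>2"
    using cos_double_sin[of "\<bar>t\<bar> / 4"] by simp
  have "1 - cos \<bar>t\<bar> = 2 * (sin (\<bar>t\<bar> / 2))\<^sup>2" using cos_double_sin[of "\<bar>t\<bar> / 2"] by simp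
  also have "\<dots> = 2 * ((1 - cos (\<bar>t\<bar> / 2)) * (1 + cos (\<bar>t\<bar> / 2)))"
    unfolding sin_squared_eq by (simp add: algebra_simps power2_eq_square)
  also have "\<dots> \<ge> 2 * ((1 - cos (\<bar>t\<bar> / 2)) * 1)"
    using c0 by (intro mult_left_mono) auto
  finally have "2 * (1 - cos (\<bar>t\<bar> / 2)) \<le> 1 - cos \<bar>t\<bar>" by simp
  then show ?thesis using 1 2 by simp
qed

lemma one_minus_cos_shift:
  fixes t u :: real
  shows "(1 - cos t) / 2 - u\<^sup>2 / 2 \<le> 1 - cos (u + t)"
proof -
  have n: "(cmod (iexp y - 1))\<^sup>2 = 2 * (1 - cos y)" for y
  proof -
    have "(cmod (iexp y - 1))\<^sup>2 = (cos y - 1)\<^sup>2 + (sin y)\<^sup>2"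
      by (simp add: cmod_power2 Re_exp Im_exp)
    also have "\<dots> = 2 * (1 - cos y)"
      using sin_cos_squared_add[of y] by (simp add: power2_eq_square algebra_simps)
    finally show ?thesis .
  qed
  have "iexp t - 1 = iexp (- u) * (iexp (u + t) - 1) + (iexp (- u) - 1)"
    by (simp add: algebra_simps exp_add[symmetric])
  then have "cmod (iexp t - 1) \<le> cmod (iexp (- u) * (iexp (u + t) - 1)) + cmod (iexp (- u) - 1)"
    by (metis norm_triangle_ineq)
  then have "cmod (iexp t - 1) \<le> cmod (iexp (u + t) - 1) + cmod (iexp (- u) - 1)"
    by (simp only: norm_mult norm_exp_i_times mult_1)
  moreover have "cmod (iexp (- u) - 1) \<le> \<bar>u\<bar>" using iexp_approx1[of "- u" 0] by simp
  ultimately have "cmod (iexp t - 1) \<le> cmod (iexp (u + t) - 1) + \<bar>u\<bar>" by linarith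
  then have "(cmod (iexp t - 1))\<^sup>2 \<le> (cmod (iexp (u + t) - 1) + \<bar>u\<bar>)\<^sup>2"
    by (rule power_mono) simp
  also have "\<dots> \<le> 2 * (cmod (iexp (u + t) - 1))\<^sup>2 + 2 * u\<^sup>2"
    using sum_squares_bound[of "cmod (iexp (u + t) - 1)" "\<bar>u\<bar>"] by (simp add: power2_sum)
  finally show ?thesis unfolding n by (simp add: field_simps)
qed

lemma cmod_finite_char_sq:
  fixes p X :: "'q::finite \<Rightarrow> real"
  assumes "(\<Sum>q\<in>UNIV. p q) = 1"
  shows "1 - (cmod (\<Sum>q\<in>UNIV. of_real (p q) * iexp (X q)))\<^sup>2 = (\<Sum>q\<in>UNIV. \<Sum>r\<in>UNIV. p q * p r * (1 - cos (X q - X r)))"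
proof -
  have "(cmod (\<Sum>q\<in>UNIV. of_real (p q) * iexp (X q)))\<^sup>2 = (\<Sum>q\<in>UNIV. p q * cos (X q))\<^sup>2 + (\<Sum>q\<in>UNIV. p q * sin (X q))\<^sup>2"
    by (simp add: cmod_power2 Re_exp Im_exp)
  also have "\<dots> = (\<Sum>q\<in>UNIV. \<Sum>r\<in>UNIV. p q * p r * cos (X q - X r))"
    unfolding power2_eq_square sum_product sum.distrib[symmetric] cos_diff
    by (intro sum.cong refl) (simp add: algebra_simps)
  finally have "1 - (cmod (\<Sum>q\<in>UNIV. of_real (p q) * iexp (X q)))\<^sup>2 = (\<Sum>q\<in>UNIV. p q) * (\<Sum>q\<in>UNIV. p q) - (\<Sum>q\<in>UNIV. \<Sum>r\<in>UNIV. p q * p r * cos (X q - X r))"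
    using assms by simp
  also have "\<dots> = (\<Sum>q\<in>UNIV. \<Sum>r\<in>UNIV. p q * p r * (1 - cos (X q - X r)))"
    unfolding sum_product by (simp add: sum_subtractf[symmetric] right_diff_distrib)
  finally show ?thesis .
qed

lemma cmod_finite_char_le:
  fixes p X :: "'q::finite \<Rightarrow> real"
  assumes p: "\<And>q. p q \<ge> 0" "(\<Sum>q\<in>UNIV. p q) = 1"
  shows "cmod (\<Sum>q\<in>UNIV. of_real (p q) * iexp (X q)) \<le> exp (- (\<Sum>q\<in>UNIV - {q0}. p q * p q0 * (1 - cos (X q - X q0))) / 2)"
proof -
  let ?c = "cmod (\<Sum>q\<in>UNIV. of_real (p q) * iexp (X q))"
  let ?S = "\<Sum>q\<in>UNIV - {q0}. p q * p q0 * (1 - cos (X q - X q0))"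
  have nn: "0 \<le> p q * p r * (1 - cos (X q - X r))" for q r
    using p by (intro mult_nonneg_nonneg) auto
  have "?S \<le> (\<Sum>q\<in>UNIV - {q0}. \<Sum>r\<in>UNIV. p q * p r * (1 - cos (X q - X r)))"
    by (intro sum_mono member_le_sum) (use nn in auto)
  also have "\<dots> \<le> (\<Sum>q\<in>UNIV. \<Sum>r\<in>UNIV. p q * p r * (1 - cos (X q - X r)))"
    by (intro sum_mono2) (use nn in \<open>auto intro!: sum_nonneg\<close>)
  also have "\<dots> = 1 - ?c\<^sup>2" by (rule cmod_finite_char_sq[OF p(2), symmetric])
  finally have "?c\<^sup>2 \<le> 1 + (- ?S)" by simp
  also have "\<dots> \<le> exp (- ?S)" by (rule exp_ge_add_one_self)
  also have "\<dots> = (exp (- ?S / 2))\<^sup>2" by (simp add: power2_eq_square exp_add[symmetric])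
  finally show ?thesis by (rule power2_le_imp_le) simp
qed

definition lab_var :: "('q::finite \<Rightarrow> real) \<Rightarrow> ('q \<Rightarrow> real) \<Rightarrow> real" where
  "lab_var p X = (\<Sum>q\<in>UNIV. p q * (X q)\<^sup>2) - (\<Sum>q\<in>UNIV. p q * X q)\<^sup>2"

lemma lab_var_centered:
  assumes "(\<Sum>q\<in>UNIV. p q) = 1"
  shows "lab_var p X = (\<Sum>q\<in>UNIV. p q * (X q - (\<Sum>r\<in>UNIV. p r * X r))\<^sup>2)"
proof -
  let ?m = "\<Sum>r\<in>UNIV. p r * X r"
  have "(\<Sum>q\<in>UNIV. p q * (X q - ?m)\<^sup>2) = (\<Sum>q\<in>UNIV. p q * (X q)\<^sup>2 - 2 * ?m * (p q * X q) + ?m\<^sup>2 * p q)"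
    by (intro sum.cong refl) (simp add: power2_eq_square algebra_simps)
  also have "\<dots> = (\<Sum>q\<in>UNIV. p q * (X q)\<^sup>2) - 2 * ?m * ?m + ?m\<^sup>2 * (\<Sum>q\<in>UNIV. p q)"
    by (simp only: sum.distrib sum_subtractf sum_distrib_left)
  finally show ?thesis using assms by (simp add: lab_var_def power2_eq_square)
qed

lemma lab_var_nonneg:
  assumes "(\<Sum>q\<in>UNIV. p q) = 1" "\<And>q. p q \<ge> 0"
  shows "lab_var p X \<ge> 0"
  unfolding lab_var_centered[OF assms(1)] by (intro sum_nonneg mult_nonneg_nonneg assms) auto

lemma sum_lab_var_shift:
  fixes A :: "nat \<Rightarrow> 'q::finite \<Rightarrow> real"
  assumes A: "\<And>q. (\<Sum>i<n. A i q) = 0"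
  shows "(\<Sum>i<n. lab_var p (\<lambda>q. A i q + t q)) = (\<Sum>i<n. lab_var p (A i)) + real n * lab_var p t"
proof -
  have *: "lab_var p (\<lambda>q. A i q + t q) = lab_var p (A i) + lab_var p t + 2 * ((\<Sum>q\<in>UNIV. p q * t q * A i q) -
      (\<Sum>q\<in>UNIV. p q * t q) * (\<Sum>q\<in>UNIV. p q * A i q))" for i
  proof -
    have e1: "(\<Sum>q\<in>UNIV. p q * (A i q + t q)\<^sup>2) = (\<Sum>q\<in>UNIV. p q * (A i q)\<^sup>2) + (\<Sum>q\<in>UNIV. p q * (t q)\<^sup>2) + 2 * (\<Sum>q\<in>UNIV. p q * t q * A i q)"
      by (simp add: sum_distrib_left sum.distrib[symmetric] power2_sum algebra_simps)
    have e2: "(\<Sum>q\<in>UNIV. p q * (A i q + t q)) = (\<Sum>q\<in>UNIV. p q * A i q) + (\<Sum>q\<in>UNIV. p q * t q)"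
      by (simp add: sum.distrib[symmetric] algebra_simps)
    show ?thesis unfolding lab_var_def e1 e2 by (simp add: power2_sum algebra_simps)
  qed
  have "(\<Sum>i<n. \<Sum>q\<in>UNIV. p q * t q * A i q) = 0"
    by (subst sum.swap) (simp add: sum_distrib_left[symmetric] A)
  moreover have "(\<Sum>i<n. \<Sum>q\<in>UNIV. p q * A i q) = 0"
    by (subst sum.swap) (simp add: sum_distrib_left[symmetric] A)
  ultimately show ?thesis unfolding *
    by (simp add: sum.distrib sum_distrib_left[symmetric] sum_subtractf)
qed

lemma lab_var_scale: "lab_var p (\<lambda>q. X q / c) = lab_var p X / c\<^sup>2"
  by (simp add: lab_var_def power_divide sum_divide_distrib[symmetric] diff_divide_distrib)

lemma freq_fun_approx:
  fixes nq :: "'q::finite \<Rightarrow> nat"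
  assumes n: "n > 0" and nq: "(\<Sum>q\<in>UNIV. nq q) = n" and A: "\<And>q. (\<Sum>i<n. A i q) = 0"
    and small: "\<And>i q. i < n \<Longrightarrow> \<bar>A i q\<bar> \<le> e" and S: "\<And>q. \<bar>ext0 q0 s q\<bar> \<le> S"
  defines "p \<equiv> \<lambda>q. real (nq q) / real n"
  defines "v \<equiv> (\<Sum>i<n. lab_var p (A i)) + lab_var p (ext0 q0 s)"
  defines "d \<equiv> 2 * (e + S / sqrt n)"
  shows "cmod (freq_fun q0 n nq A s - of_real (exp (- v / 2))) \<le> (d + d\<^sup>2) * v"
proof -
  let ?t = "\<lambda>q. ext0 q0 s q / sqrt n"
  let ?X = "\<lambda>i q. A i q + ?t q"
  define mu where "mu i = (\<Sum>q\<in>UNIV. p q * ?X i q)" for i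
  have p: "\<And>q. p q \<ge> 0" "(\<Sum>q\<in>UNIV. p q) = 1"
    using n nq by (auto simp: p_def sum_divide_distrib[symmetric] of_nat_sum[symmetric] simp del: of_nat_sum)
  have Xb: "\<bar>?X i q\<bar> \<le> d / 2" if "i < n" for i q
  proof -
    have "\<bar>?X i q\<bar> \<le> \<bar>A i q\<bar> + \<bar>?t q\<bar>" by (rule abs_triangle_ineq)
    also have "\<bar>?t q\<bar> \<le> S / sqrt n" using S[of q] n by (simp add: divide_right_mono)
    finally show ?thesis using small[OF that, of q] by (simp add: d_def)
  qed
  have mub: "\<bar>mu i\<bar> \<le> d / 2" if "i < n" for i
  proof -
    have "\<bar>mu i\<bar> \<le> (\<Sum>q\<in>UNIV. \<bar>p q * ?X i q\<bar>)" unfolding mu_def by (rule sum_abs)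
    also have "\<dots> \<le> (\<Sum>q\<in>UNIV. p q * (d / 2))"
    proof (rule sum_mono)
      fix q
      show "\<bar>p q * ?X i q\<bar> \<le> p q * (d / 2)"
        unfolding abs_mult abs_of_nonneg[OF p(1)] by (rule mult_left_mono[OF Xb[OF that] p(1)])
    qed
    also have "\<dots> = d / 2" using p(2) by (simp flip: sum_distrib_right sum_divide_distrib)
    finally show ?thesis .
  qed
  have cent: "\<bar>?X i q - mu i\<bar> \<le> d" if "i < n" for i q
    using Xb[OF that, of q] mub[OF that] by linarith
  have summu: "(\<Sum>i<n. mu i) = (\<Sum>q\<in>UNIV. real (nq q) * ext0 q0 s q) / sqrt n"
  proof -
    have "(\<Sum>i<n. mu i) = (\<Sum>q\<in>UNIV. p q * (\<Sum>i<n. ?X i q))"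
      unfolding mu_def by (subst sum.swap) (simp add: sum_distrib_left)
    also have "\<dots> = (\<Sum>q\<in>UNIV. p q * (real n * ?t q))" by (simp add: sum.distrib A)
    also have "\<dots> = (\<Sum>q\<in>UNIV. real (nq q) * ext0 q0 s q) / sqrt n"
      using n by (simp add: p_def sum_divide_distrib)
    finally show ?thesis .
  qed
  have F: "freq_fun q0 n nq A s = (\<Prod>i<n. \<Sum>q\<in>UNIV. of_real (p q) * iexp (?X i q - mu i))"
  proof -
    have "freq_fun q0 n nq A s = (\<Prod>i<n. \<Sum>q\<in>UNIV. of_real (p q) * iexp (?X i q)) * iexp (\<Sum>i<n. - mu i)"
      unfolding freq_fun_def sum_negf summu p_def by simp
    also have "\<dots> = (\<Prod>i<n. (\<Sum>q\<in>UNIV. of_real (p q) * iexp (?X i q)) * iexp (- mu i))"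
      unfolding iexp_sum[OF finite_lessThan] prod.distrib ..
    also have "\<dots> = (\<Prod>i<n. \<Sum>q\<in>UNIV. of_real (p q) * iexp (?X i q - mu i))"
      unfolding sum_distrib_right mult.assoc exp_add[symmetric] distrib_left[symmetric] of_real_add[symmetric] by simp
    finally show ?thesis .
  qed
  have mean0: "(\<Sum>q\<in>UNIV. p q * (?X i q - mu i)) = 0" for i
    using p(2) by (simp add: right_diff_distrib sum_subtractf mu_def flip: sum_distrib_right)
  define vi where "vi i = lab_var p (?X i)" for i
  have vi: "vi i = (\<Sum>q\<in>UNIV. p q * (?X i q - mu i)\<^sup>2)" for i
    unfolding vi_def mu_def by (rule lab_var_centered[OF p(2)])
  have vi0: "vi i \<ge> 0" for i unfolding vi_def by (rule lab_var_nonneg[OF p(2,1)])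
  have sumv: "(\<Sum>i<n. vi i) = v"
    unfolding vi_def v_def sum_lab_var_shift[OF A] lab_var_scale using n by simp
  have "of_real (exp (- v / 2)) = (\<Prod>i<n. complex_of_real (exp (- vi i / 2)))"
    unfolding sumv[symmetric] of_real_prod[symmetric] exp_sum[OF finite_lessThan, symmetric]
    by (simp add: sum_negf sum_divide_distrib)
  then have "cmod (freq_fun q0 n nq A s - of_real (exp (- v / 2))) \<le>
     (\<Sum>i<n. cmod ((\<Sum>q\<in>UNIV. of_real (p q) * iexp (?X i q - mu i)) - of_real (exp (- vi i / 2))))"
    unfolding F
  proof (simp only:, intro norm_prod_diff)
    fix i
    have "cmod (\<Sum>q\<in>UNIV. of_real (p q) * iexp (?X i q - mu i)) \<le> (\<Sum>q\<in>UNIV. p q)"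
      by (rule sum_norm_le) (simp only: norm_mult norm_exp_i_times norm_of_real, use p in simp)
    then show "cmod (\<Sum>q\<in>UNIV. of_real (p q) * iexp (?X i q - mu i)) \<le> 1" using p by simp
    show "cmod (of_real (exp (- vi i / 2))) \<le> 1" using vi0[of i] by simp
  qed
  also have "\<dots> \<le> (\<Sum>i<n. (d + d\<^sup>2) * vi i)"
    unfolding vi by (intro sum_mono finite_char_approx p mean0 cent) auto
  also have "\<dots> = (d + d\<^sup>2) * v" by (simp add: sum_distrib_left[symmetric] sumv)
  finally show ?thesis .
qed

lemma freq_fun_bound:
  fixes nq :: "'q::finite \<Rightarrow> nat"
  assumes n: "n > 0" and nq: "(\<Sum>q\<in>UNIV. nq q) = n"
    and B: "(\<Sum>i<n. \<Sum>q\<in>UNIV. (A i q)\<^sup>2) \<le> B"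
    and b: "\<And>q. b \<le> (real (nq q) / real n) * (real (nq q0) / real n)" "b \<ge> 0"
  shows "cmod (freq_box q0 n s * freq_fun q0 n nq A s) \<le> exp (real CARD('q) * B) * (\<Prod>q\<in>UNIV - {q0}. exp (- (b / 64) * (s q)\<^sup>2))"
proof (cases "\<forall>q\<in>UNIV - {q0}. \<bar>s q\<bar> \<le> pi * sqrt n")
  case False
  then obtain q where "q \<in> UNIV - {q0}" "\<not> \<bar>s q\<bar> \<le> pi * sqrt n" by auto
  then have "freq_box q0 n s = 0" unfolding freq_box_def by (intro prod_zero bexI[of _ q]) (auto simp: indicator_def)
  then show ?thesis by (simp add: prod_nonneg)
next
  case True
  let ?J = "UNIV - {q0} :: 'q set"
  define p where "p q = real (nq q) / real n" for q
  let ?X = "\<lambda>i q. A i q + ext0 q0 s q / sqrt n"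
  have p: "\<And>q. p q \<ge> 0" "(\<Sum>q\<in>UNIV. p q) = 1"
    using n nq by (auto simp: p_def sum_divide_distrib[symmetric] of_nat_sum[symmetric] simp del: of_nat_sum)
  have p1: "p q \<le> 1" for q
    using member_le_sum[of q UNIV p] p by auto
  have pp1: "p q * p q0 \<le> 1" for q using mult_mono[OF p1[of q] p1[of q0]] p by simp
  have box: "cmod (freq_box q0 n s) \<le> 1"
    unfolding freq_box_def prod_norm[symmetric] by (intro prod_le_1) (auto simp: indicator_def)
  have trm: "(b / 32) * (s q)\<^sup>2 / n - ((A i q)\<^sup>2 + (A i q0)\<^sup>2) \<le> p q * p q0 * (1 - cos (?X i q - ?X i q0))" if q: "q \<in> ?J" for i q
  proof -
    let ?u = "A i q - A i q0" and ?t = "s q / sqrt n"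
    have X: "?X i q - ?X i q0 = ?u + ?t" using q by (simp add: ext0_def)
    have "\<bar>?t\<bar> \<le> pi" using True q n by (simp add: field_simps)
    then have "?t\<^sup>2 / 16 \<le> 1 - cos ?t" by (rule one_minus_cos_ge)
    then have 1: "?t\<^sup>2 / 32 - ?u\<^sup>2 / 2 \<le> 1 - cos (?u + ?t)"
      using one_minus_cos_shift[of ?t ?u] by (simp add: field_simps)
    have u2: "?u\<^sup>2 / 2 \<le> (A i q)\<^sup>2 + (A i q0)\<^sup>2"
      using sum_squares_bound[of "A i q" "- A i q0"] by (simp add: power2_diff)
    have "(b / 32) * (s q)\<^sup>2 / n - ((A i q)\<^sup>2 + (A i q0)\<^sup>2) \<le> p q * p q0 * (?t\<^sup>2 / 32) - p q * p q0 * (?u\<^sup>2 / 2)"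
    proof (rule diff_mono)
      have "(b / 32) * (s q)\<^sup>2 / n = b * (?t\<^sup>2 / 32)" by (simp add: power_divide)
      also have "\<dots> \<le> p q * p q0 * (?t\<^sup>2 / 32)" using b(1)[of q] by (intro mult_right_mono) (auto simp: p_def)
      finally show "(b / 32) * (s q)\<^sup>2 / n \<le> p q * p q0 * (?t\<^sup>2 / 32)" .
      have "p q * p q0 * (?u\<^sup>2 / 2) \<le> 1 * ((A i q)\<^sup>2 + (A i q0)\<^sup>2)"
        using pp1 u2 p by (intro mult_mono) auto
      then show "p q * p q0 * (?u\<^sup>2 / 2) \<le> (A i q)\<^sup>2 + (A i q0)\<^sup>2" by simp
    qed
    also have "\<dots> \<le> p q * p q0 * (1 - cos (?u + ?t))"
      unfolding right_diff_distrib[symmetric] using 1 p by (intro mult_left_mono) auto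
    finally show ?thesis unfolding X .
  qed
  let ?T = "\<lambda>i. \<Sum>q\<in>?J. p q * p q0 * (1 - cos (?X i q - ?X i q0))"
  have "(\<Sum>q\<in>?J. (b / 32) * (s q)\<^sup>2) - real CARD('q) * B \<le> (\<Sum>i<n. ?T i)"
  proof -
    have "(\<Sum>i<n. \<Sum>q\<in>?J. (A i q)\<^sup>2 + (A i q0)\<^sup>2) = (\<Sum>q\<in>?J. \<Sum>i<n. (A i q)\<^sup>2 + (A i q0)\<^sup>2)"
      by (rule sum.swap)
    also have "\<dots> \<le> (\<Sum>q\<in>?J. \<Sum>i<n. \<Sum>q\<in>UNIV. (A i q)\<^sup>2)"
    proof (intro sum_mono)
      fix q i assume "q \<in> ?J"
      then have "(A i q)\<^sup>2 + (A i q0)\<^sup>2 = (\<Sum>r\<in>{q, q0}. (A i r)\<^sup>2)" by auto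
      also have "\<dots> \<le> (\<Sum>r\<in>UNIV. (A i r)\<^sup>2)" by (intro sum_mono2) auto
      finally show "(A i q)\<^sup>2 + (A i q0)\<^sup>2 \<le> (\<Sum>r\<in>UNIV. (A i r)\<^sup>2)" .
    qed
    also have "\<dots> \<le> (\<Sum>q\<in>?J. B)" by (intro sum_mono B)
    also have "\<dots> = real (card ?J) * B" by simp
    also have "\<dots> \<le> real CARD('q) * B"
    proof (rule mult_right_mono)
      show "0 \<le> B" by (rule order_trans[OF _ B]) (intro sum_nonneg, simp)
      show "real (card ?J) \<le> real CARD('q)" by (simp add: card_mono)
    qed
    finally have 2: "(\<Sum>i<n. \<Sum>q\<in>?J. (A i q)\<^sup>2 + (A i q0)\<^sup>2) \<le> real CARD('q) * B" .
    have 3: "(\<Sum>i<n. \<Sum>q\<in>?J. (b / 32) * (s q)\<^sup>2 / n) = (\<Sum>q\<in>?J. (b / 32) * (s q)\<^sup>2)"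
      using n by (subst sum.swap) simp
    have "(\<Sum>i<n. \<Sum>q\<in>?J. (b / 32) * (s q)\<^sup>2 / n - ((A i q)\<^sup>2 + (A i q0)\<^sup>2)) \<le> (\<Sum>i<n. ?T i)"
      by (intro sum_mono trm)
    then show ?thesis using 2 3 by (simp only: sum_subtractf)
  qed
  then have ex: "(\<Sum>i<n. - ?T i / 2) \<le> real CARD('q) * B + (\<Sum>q\<in>?J. - (b / 64) * (s q)\<^sup>2)"
  proof -
    assume h: "(\<Sum>q\<in>?J. (b / 32) * (s q)\<^sup>2) - real CARD('q) * B \<le> (\<Sum>i<n. ?T i)"
    have "(\<Sum>i<n. - ?T i / 2) = - (\<Sum>i<n. ?T i) / 2" by (simp only: sum_negf sum_divide_distrib[symmetric])
    also have "\<dots> \<le> real CARD('q) * B / 2 - (\<Sum>q\<in>?J. (b / 32) * (s q)\<^sup>2) / 2" using h by simp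
    also have "(\<Sum>q\<in>?J. (b / 32) * (s q)\<^sup>2) / 2 = - (\<Sum>q\<in>?J. - (b / 64) * (s q)\<^sup>2)"
      by (simp add: sum_negf sum_divide_distrib)
    also have "real CARD('q) * B / 2 \<le> real CARD('q) * B"
      using order_trans[OF _ B, of 0] by (simp add: sum_nonneg)
    finally show ?thesis by simp
  qed
  have "cmod (freq_box q0 n s * freq_fun q0 n nq A s) \<le> 1 * (\<Prod>i<n. cmod (\<Sum>q\<in>UNIV. of_real (p q) * iexp (?X i q)))"
    unfolding freq_fun_def norm_mult[of "freq_box q0 n s"] norm_mult[of "prod _ _"] norm_exp_i_times prod_norm p_def
    using box by (intro mult_mono) auto
  also have "\<dots> \<le> (\<Prod>i<n. exp (- ?T i / 2))"
    unfolding mult_1 by (intro prod_mono conjI cmod_finite_char_le p) auto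
  also have "\<dots> = exp (\<Sum>i<n. - ?T i / 2)" by (rule exp_sum[symmetric]) simp
  also have "\<dots> \<le> exp (real CARD('q) * B + (\<Sum>q\<in>?J. - (b / 64) * (s q)\<^sup>2))" using ex by simp
  also have "\<dots> = exp (real CARD('q) * B) * (\<Prod>q\<in>?J. exp (- (b / 64) * (s q)\<^sup>2))"
    by (simp only: exp_add exp_sum finite)
  finally show ?thesis .
qed

lemma integrable_exp_square:
  assumes c: "c > 0"
  shows "integrable lborel (\<lambda>t::real. exp (- c * t\<^sup>2))"
proof -
  define s where "s = sqrt (1 / (2 * c))"
  have s: "s > 0" "s\<^sup>2 = 1 / (2 * c)" using c by (auto simp: s_def)
  have "integrable lborel (\<lambda>t. sqrt (2 * pi * s\<^sup>2) * normal_density 0 s t)"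
    using s by (intro integrable_mult_right integrable_normal_density)
  also have "(\<lambda>t. sqrt (2 * pi * s\<^sup>2) * normal_density 0 s t) = (\<lambda>t. exp (- c * t\<^sup>2))"
    using s c by (auto simp: normal_density_def fun_eq_iff)
  finally show ?thesis .
qed

lemma eventually_pos_at_top:
  fixes n :: "'a \<Rightarrow> nat"
  assumes "filterlim n at_top F"
  shows "\<forall>\<^sub>F m in F. n m > 0"
  using assms[unfolded filterlim_at_top, rule_format, of 1] by eventually_elim simp

lemma freq_integral_tendsto:
  fixes n :: "nat \<Rightarrow> nat" and nq :: "nat \<Rightarrow> 'q::finite \<Rightarrow> nat" and A :: "nat \<Rightarrow> nat \<Rightarrow> 'q \<Rightarrow> real"
  assumes nq_sum: "\<And>m. (\<Sum>q\<in>UNIV. nq m q) = n m"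
    and n_lim: "filterlim n at_top sequentially"
    and c: "\<And>q. c q > 0" "\<And>q. (\<lambda>m. real (nq m q) / real (n m)) \<longlonglongrightarrow> c q"
    and A0: "\<And>m q. (\<Sum>i<n m. A m i q) = 0"
    and small: "\<And>m i q. i < n m \<Longrightarrow> \<bar>A m i q\<bar> \<le> e m" "e \<longlonglongrightarrow> 0"
    and var: "(\<lambda>m. \<Sum>i<n m. lab_var (\<lambda>q. real (nq m q) / real (n m)) (A m i)) \<longlonglongrightarrow> v"
    and B: "\<And>m. (\<Sum>i<n m. \<Sum>q\<in>UNIV. (A m i q)\<^sup>2) \<le> B"
  shows "(\<lambda>m. \<integral>s. freq_box q0 (n m) s * freq_fun q0 (n m) (nq m) (A m) s \<partial>PiM (UNIV - {q0}) (\<lambda>_. lborel)) \<longlonglongrightarrow>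
    of_real (exp (- v / 2)) * of_real (\<integral>s. exp (- lab_var c (ext0 q0 s) / 2) \<partial>PiM (UNIV - {q0}) (\<lambda>_. lborel))"
proof -
  let ?J = "UNIV - {q0} :: 'q set"
  let ?P = "PiM ?J (\<lambda>_. lborel :: real measure)"
  interpret product_sigma_finite "\<lambda>_::'q. lborel :: real measure" ..
  define b where "b = Min (range (\<lambda>q. c q * c q0 / 2))"
  have b_le: "b \<le> c q * c q0 / 2" for q unfolding b_def by (intro Min_le) auto
  have "b \<in> range (\<lambda>q. c q * c q0 / 2)" unfolding b_def by (rule Min_in) auto
  then have b0: "b > 0" using c(1) by auto
  have npos: "\<forall>\<^sub>F m in sequentially. n m > 0"
    by (rule eventually_pos_at_top[OF n_lim])
  have "\<forall>\<^sub>F m in sequentially. b < (real (nq m q) / real (n m)) * (real (nq m q0) / real (n m))" for q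
  proof -
    have "b < c q * c q0" using b_le[of q] mult_pos_pos[OF c(1)[of q] c(1)[of q0]] by linarith
    moreover have "(\<lambda>m. (real (nq m q) / real (n m)) * (real (nq m q0) / real (n m))) \<longlonglongrightarrow> c q * c q0"
      by (intro tendsto_mult c)
    ultimately show ?thesis by (intro order_tendstoD(1))
  qed
  then have "\<forall>\<^sub>F m in sequentially. \<forall>q\<in>UNIV. b < (real (nq m q) / real (n m)) * (real (nq m q0) / real (n m))"
    by (intro eventually_ball_finite) auto
  with npos have "\<forall>\<^sub>F m in sequentially. n m > 0 \<and> (\<forall>q. b < (real (nq m q) / real (n m)) * (real (nq m q0) / real (n m)))"
    by eventually_elim auto
  then obtain m0 where m0: "\<And>m. m \<ge> m0 \<Longrightarrow> n m > 0" "\<And>m q. m \<ge> m0 \<Longrightarrow> b \<le> (real (nq m q) / real (n m)) * (real (nq m q0) / real (n m))"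
    unfolding eventually_sequentially by (meson less_imp_le)
  have sqn: "filterlim (\<lambda>m. sqrt (real (n m))) at_top sequentially"
    by (intro filterlim_compose[OF sqrt_at_top] filterlim_compose[OF filterlim_real_sequentially n_lim])
  have ptw: "(\<lambda>m. freq_box q0 (n m) s * freq_fun q0 (n m) (nq m) (A m) s) \<longlonglongrightarrow>
     of_real (exp (- v / 2)) * of_real (exp (- lab_var c (ext0 q0 s) / 2))" for s
  proof -
    define S where "S = (\<Sum>q\<in>UNIV. \<bar>ext0 q0 s q\<bar>)"
    have S: "\<bar>ext0 q0 s q\<bar> \<le> S" for q unfolding S_def by (rule member_le_sum) auto
    have "\<forall>\<^sub>F m in sequentially. S \<le> pi * sqrt (real (n m))"
    proof -
      have "\<forall>\<^sub>F m in sequentially. S / pi \<le> sqrt (real (n m))"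
        using sqn by (auto simp: filterlim_at_top)
      then show ?thesis by eventually_elim (simp add: field_simps)
    qed
    then have box: "(\<lambda>m. freq_box q0 (n m) s) \<longlonglongrightarrow> 1"
    proof (intro tendsto_eventually, eventually_elim)
      case (elim m)
      have "indicator {-(pi * sqrt (n m))..pi * sqrt (n m)} (s q) = (1::complex)" if "q \<in> ?J" for q
        using S[of q] elim that by (auto simp: indicator_def ext0_def abs_le_iff)
      then show ?case unfolding freq_box_def by (intro prod.neutral) auto
    qed
    define d where "d m = 2 * (e m + S / sqrt (n m))" for m
    define vv where "vv m = (\<Sum>i<n m. lab_var (\<lambda>q. real (nq m q) / real (n m)) (A m i)) + lab_var (\<lambda>q. real (nq m q) / real (n m)) (ext0 q0 s)" for m
    have d0: "d \<longlonglongrightarrow> 0"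
    proof -
      have "(\<lambda>m. S / sqrt (n m)) \<longlonglongrightarrow> 0"
        by (rule tendsto_divide_0[OF tendsto_const filterlim_at_top_imp_at_infinity[OF sqn]])
      from tendsto_mult[OF tendsto_const[of 2] tendsto_add[OF small(2) this]] show ?thesis unfolding d_def by simp
    qed
    have vv: "vv \<longlonglongrightarrow> v + lab_var c (ext0 q0 s)"
      unfolding vv_def by (intro tendsto_add var) (unfold lab_var_def, intro tendsto_intros c)
    have "(\<lambda>m. (d m + (d m)\<^sup>2) * vv m) \<longlonglongrightarrow> (0 + 0\<^sup>2) * (v + lab_var c (ext0 q0 s))"
      by (intro tendsto_intros d0 vv)
    then have lim0: "(\<lambda>m. (d m + (d m)\<^sup>2) * vv m) \<longlonglongrightarrow> 0" by simp
    have "(\<lambda>m. freq_fun q0 (n m) (nq m) (A m) s - of_real (exp (- vv m / 2))) \<longlonglongrightarrow> 0"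
    proof (rule Lim_null_comparison[OF _ lim0])
      show "\<forall>\<^sub>F m in sequentially. norm (freq_fun q0 (n m) (nq m) (A m) s - of_real (exp (- vv m / 2))) \<le> (d m + (d m)\<^sup>2) * vv m"
        using npos
      proof eventually_elim
        case (elim m)
        show ?case unfolding d_def vv_def
          by (rule freq_fun_approx[OF elim nq_sum A0 small(1) S])
      qed
    qed
    moreover have "(\<lambda>m. complex_of_real (exp (- vv m / 2))) \<longlonglongrightarrow> of_real (exp (- (v + lab_var c (ext0 q0 s)) / 2))"
      by (intro tendsto_intros vv) auto
    ultimately have "(\<lambda>m. freq_fun q0 (n m) (nq m) (A m) s - of_real (exp (- vv m / 2)) + of_real (exp (- vv m / 2))) \<longlonglongrightarrow>
        0 + of_real (exp (- (v + lab_var c (ext0 q0 s)) / 2))"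
      by (rule tendsto_add)
    then have "(\<lambda>m. freq_fun q0 (n m) (nq m) (A m) s) \<longlonglongrightarrow> of_real (exp (- (v + lab_var c (ext0 q0 s)) / 2))"
      by simp
    from tendsto_mult[OF box this]
    show ?thesis
      unfolding of_real_mult[symmetric] exp_add[symmetric] by (simp only: mult_1 minus_add_distrib add_divide_distrib)
  qed
  have meas [measurable]: "(\<lambda>s. lab_var c (ext0 q0 s)) \<in> borel_measurable ?P"
    unfolding lab_var_def by measurable
  have "(\<lambda>m. \<integral>s. freq_box q0 (n (m + m0)) s * freq_fun q0 (n (m + m0)) (nq (m + m0)) (A (m + m0)) s \<partial>?P) \<longlonglongrightarrow>
      (\<integral>s. of_real (exp (- v / 2)) * of_real (exp (- lab_var c (ext0 q0 s) / 2)) \<partial>?P)"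
  proof (rule integral_dominated_convergence[where w="\<lambda>s. exp (real CARD('q) * B) * (\<Prod>q\<in>UNIV - {q0}. exp (- (b / 64) * (s q)\<^sup>2))"])
    show "integrable ?P (\<lambda>s. exp (real CARD('q) * B) * (\<Prod>q\<in>UNIV - {q0}. exp (- (b / 64) * (s q)\<^sup>2)))"
      using b0 by (intro integrable_mult_right product_integrable_prod integrable_exp_square) auto
    show "AE s in ?P. (\<lambda>m. freq_box q0 (n (m + m0)) s * freq_fun q0 (n (m + m0)) (nq (m + m0)) (A (m + m0)) s) \<longlonglongrightarrow>
        of_real (exp (- v / 2)) * of_real (exp (- lab_var c (ext0 q0 s) / 2))"
      by (intro AE_I2 LIMSEQ_ignore_initial_segment ptw)
    show "AE s in ?P. norm (freq_box q0 (n (m + m0)) s * freq_fun q0 (n (m + m0)) (nq (m + m0)) (A (m + m0)) s) \<le>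
        exp (real CARD('q) * B) * (\<Prod>q\<in>UNIV - {q0}. exp (- (b / 64) * (s q)\<^sup>2))" for m
      using b0 by (intro AE_I2 freq_fun_bound m0 nq_sum B) auto
  qed measurable
  then have "(\<lambda>m. \<integral>s. freq_box q0 (n m) s * freq_fun q0 (n m) (nq m) (A m) s \<partial>?P) \<longlonglongrightarrow>
      (\<integral>s. of_real (exp (- v / 2)) * of_real (exp (- lab_var c (ext0 q0 s) / 2)) \<partial>?P)"
    by (rule LIMSEQ_offset)
  also have "(\<integral>s. of_real (exp (- v / 2)) * of_real (exp (- lab_var c (ext0 q0 s) / 2)) \<partial>?P) =
     complex_of_real (exp (- v / 2)) * of_real (\<integral>s. exp (- lab_var c (ext0 q0 s) / 2) \<partial>?P)"
    by (simp only: integral_mult_right_zero integral_complex_of_real)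
  finally show ?thesis .
qed

lemma gauss_lab_var_integral_pos:
  fixes c :: "'q::finite \<Rightarrow> real"
  assumes c: "\<And>q. c q > 0" "(\<Sum>q\<in>UNIV. c q) = 1"
  shows "(\<integral>s. exp (- lab_var c (ext0 q0 s) / 2) \<partial>PiM (UNIV - {q0}) (\<lambda>_. lborel)) \<noteq> 0"
proof
  let ?J = "UNIV - {q0} :: 'q set"
  let ?P = "PiM ?J (\<lambda>_. lborel :: real measure)"
  interpret product_sigma_finite "\<lambda>_::'q. lborel :: real measure" ..
  interpret finite_product_sigma_finite "\<lambda>_::'q. lborel :: real measure" ?J by standard auto
  have meas [measurable]: "(\<lambda>s. lab_var c (ext0 q0 s)) \<in> borel_measurable ?P"
    unfolding lab_var_def by measurable
  define b where "b = Min (range (\<lambda>q. c q * c q0))"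
  have b_le: "b \<le> c q * c q0" for q unfolding b_def by (intro Min_le) auto
  have "b \<in> range (\<lambda>q. c q * c q0)" unfolding b_def by (rule Min_in) auto
  then have b0: "b > 0" using c(1) by auto
  have lower: "(\<Sum>q\<in>?J. (b / real CARD('q)) * (s q)\<^sup>2) \<le> lab_var c (ext0 q0 s)" for s
  proof -
    define mu where "mu = (\<Sum>r\<in>UNIV. c r * ext0 q0 s r)"
    have lv: "lab_var c (ext0 q0 s) = (\<Sum>q\<in>UNIV. c q * (ext0 q0 s q - mu)\<^sup>2)"
      unfolding mu_def by (rule lab_var_centered[OF c(2)])
    have "(b / real CARD('q)) * (s q)\<^sup>2 \<le> lab_var c (ext0 q0 s) / real CARD('q)" if q: "q \<in> ?J" for q
    proof -
      have id: "c q * (s q - mu)\<^sup>2 + c q0 * mu\<^sup>2 = (c q * c q0 * (s q)\<^sup>2 + (c q * (s q - mu) - c q0 * mu)\<^sup>2) / (c q + c q0)"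
        using c(1)[of q] c(1)[of q0] by (simp add: divide_simps add_pos_pos) (simp add: power2_eq_square algebra_simps)
      have cc: "c q + c q0 \<le> 1"
      proof -
        have "c q + c q0 = (\<Sum>r\<in>{q, q0}. c r)" using q by auto
        also have "\<dots> \<le> (\<Sum>r\<in>UNIV. c r)" by (intro sum_mono2) (auto intro: less_imp_le c)
        finally show ?thesis using c(2) by simp
      qed
      have "b * (s q)\<^sup>2 \<le> c q * c q0 * (s q)\<^sup>2" using b_le by (intro mult_right_mono) auto
      also have "\<dots> \<le> c q * c q0 * (s q)\<^sup>2 + (c q * (s q - mu) - c q0 * mu)\<^sup>2" by simp
      also have "\<dots> \<le> (c q * c q0 * (s q)\<^sup>2 + (c q * (s q - mu) - c q0 * mu)\<^sup>2) / (c q + c q0)"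
      proof -
        have "0 \<le> c q * c q0 * (s q)\<^sup>2 + (c q * (s q - mu) - c q0 * mu)\<^sup>2"
          using c(1)[of q] c(1)[of q0] by (intro add_nonneg_nonneg mult_nonneg_nonneg) auto
        then show ?thesis using cc c(1)[of q] c(1)[of q0] by (simp add: le_divide_eq add_pos_pos mult_left_le)
      qed
      also have "\<dots> = (\<Sum>r\<in>{q, q0}. c r * (ext0 q0 s r - mu)\<^sup>2)" unfolding id[symmetric] using q by (auto simp: ext0_def)
      also have "\<dots> \<le> lab_var c (ext0 q0 s)" unfolding lv
        by (intro sum_mono2) (auto intro!: less_imp_le[OF c(1)] mult_nonneg_nonneg)
      finally show ?thesis by (simp add: divide_right_mono)
    qed
    then have "(\<Sum>q\<in>?J. (b / real CARD('q)) * (s q)\<^sup>2) \<le> (\<Sum>q\<in>?J. lab_var c (ext0 q0 s) / real CARD('q))"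
      by (rule sum_mono)
    also have "\<dots> = real (card ?J) * (lab_var c (ext0 q0 s) / real CARD('q))" by simp
    also have "\<dots> \<le> real CARD('q) * (lab_var c (ext0 q0 s) / real CARD('q))"
    proof (rule mult_right_mono)
      show "real (card ?J) \<le> real CARD('q)" by (simp add: card_mono)
      show "0 \<le> lab_var c (ext0 q0 s) / real CARD('q)" using lab_var_nonneg[OF c(2) less_imp_le[OF c(1)]] by simp
    qed
    finally show ?thesis by simp
  qed
  have int: "integrable ?P (\<lambda>s. exp (- lab_var c (ext0 q0 s) / 2))"
  proof (rule Bochner_Integration.integrable_bound)
    show "integrable ?P (\<lambda>s. \<Prod>q\<in>?J. exp (- (b / real CARD('q) / 2) * (s q)\<^sup>2))"
      using b0 by (intro product_integrable_prod integrable_exp_square) auto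
    have "exp (- lab_var c (ext0 q0 s) / 2) \<le> (\<Prod>q\<in>?J. exp (- (b / real CARD('q) / 2) * (s q)\<^sup>2))" for s
    proof -
      have "(\<Prod>q\<in>?J. exp (- (b / real CARD('q) / 2) * (s q)\<^sup>2)) = exp (- (\<Sum>q\<in>?J. (b / real CARD('q)) * (s q)\<^sup>2) / 2)"
        by (simp add: exp_sum[symmetric] sum_negf sum_divide_distrib)
      then show ?thesis using lower[of s] by simp
    qed
    then show "AE s in ?P. norm (exp (- lab_var c (ext0 q0 s) / 2)) \<le> norm (\<Prod>q\<in>?J. exp (- (b / real CARD('q) / 2) * (s q)\<^sup>2))"
      by (intro AE_I2) (auto simp: abs_prod)
  qed measurable
  assume "(\<integral>s. exp (- lab_var c (ext0 q0 s) / 2) \<partial>?P) = 0"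
  then have "AE s in ?P. exp (- lab_var c (ext0 q0 s) / 2) = 0"
    using integral_nonneg_eq_0_iff_AE[OF int] by simp
  then have "AE s in ?P. False" by simp
  then have "emeasure ?P (space ?P) = 0" using AE_iff_null[of ?P "\<lambda>_. False"] by auto
  moreover have "emeasure ?P (PiE ?J (\<lambda>_. {0..1})) \<le> emeasure ?P (space ?P)"
    by (rule emeasure_space)
  moreover have "emeasure ?P (PiE ?J (\<lambda>_. {0..1})) = 1"
    by (subst emeasure_PiM) auto
  ultimately show False by simp
qed

lemma group_share_limit_sum:
  fixes nq :: "nat \<Rightarrow> 'q::finite \<Rightarrow> nat"
  assumes nq_sum: "\<And>m. (\<Sum>q\<in>UNIV. nq m q) = n m"
    and n_lim: "filterlim n at_top sequentially"
    and c: "\<And>q. (\<lambda>m. real (nq m q) / real (n m)) \<longlonglongrightarrow> c q"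
  shows "(\<Sum>q\<in>UNIV. c q) = 1"
proof -
  have "(\<lambda>m. \<Sum>q\<in>UNIV. real (nq m q) / real (n m)) \<longlonglongrightarrow> (\<Sum>q\<in>UNIV. c q)"
    by (intro tendsto_sum c)
  moreover have "\<forall>\<^sub>F m in sequentially. n m > 0"
    by (rule eventually_pos_at_top[OF n_lim])
  then have "\<forall>\<^sub>F m in sequentially. (\<Sum>q\<in>UNIV. real (nq m q) / real (n m)) = 1"
  proof eventually_elim
    case (elim m)
    have "(\<Sum>q\<in>UNIV. real (nq m q)) = real (n m)" using nq_sum[of m] by (simp flip: of_nat_sum)
    then show ?case using elim by (simp flip: sum_divide_distrib)
  qed
  then have "(\<lambda>m. \<Sum>q\<in>UNIV. real (nq m q) / real (n m)) \<longlonglongrightarrow> 1" by (rule tendsto_eventually)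
  ultimately show ?thesis by (rule LIMSEQ_unique)
qed

theorem combinatorial_clt:
  fixes n :: "nat \<Rightarrow> nat" and nq :: "nat \<Rightarrow> 'q::finite \<Rightarrow> nat" and A :: "nat \<Rightarrow> nat \<Rightarrow> 'q \<Rightarrow> real"
  assumes nq_sum: "\<And>m. (\<Sum>q\<in>UNIV. nq m q) = n m"
    and n_lim: "filterlim n at_top sequentially"
    and c: "\<And>q. c q > 0" "\<And>q. (\<lambda>m. real (nq m q) / real (n m)) \<longlonglongrightarrow> c q"
    and A0: "\<And>m q. (\<Sum>i<n m. A m i q) = 0"
    and small: "\<And>m i q. i < n m \<Longrightarrow> \<bar>A m i q\<bar> \<le> e m" "e \<longlonglongrightarrow> 0"
    and var: "(\<lambda>m. \<Sum>i<n m. lab_var (\<lambda>q. real (nq m q) / real (n m)) (A m i)) \<longlonglongrightarrow> v"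
    and B: "\<And>m. (\<Sum>i<n m. \<Sum>q\<in>UNIV. (A m i q)\<^sup>2) \<le> B"
  shows "(\<lambda>m. \<integral>z. iexp (\<Sum>i<n m. A m i (z i)) \<partial>measure_pmf (CRFE (n m) (nq m))) \<longlonglongrightarrow> of_real (exp (- v / 2))"
    and "\<forall>\<^sub>F m in sequentially. assignments (n m) (nq m) \<noteq> {}"
proof -
  obtain q0 :: 'q where True by simp
  let ?P = "PiM (UNIV - {q0}) (\<lambda>_. lborel :: real measure)"
  define G where "G = (\<integral>s. exp (- lab_var c (ext0 q0 s) / 2) \<partial>?P)"
  have G: "G \<noteq> 0" unfolding G_def
    by (rule gauss_lab_var_integral_pos[OF c(1) group_share_limit_sum[OF nq_sum n_lim c(2)]])
  define I where "I m A = (\<integral>s. freq_box q0 (n m) s * freq_fun q0 (n m) (nq m) A s \<partial>?P)" for m A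
  have I1: "(\<lambda>m. I m (A m)) \<longlonglongrightarrow> of_real (exp (- v / 2)) * of_real G"
    unfolding I_def G_def by (rule freq_integral_tendsto[OF nq_sum n_lim c A0 small var B])
  have I0: "(\<lambda>m. I m (\<lambda>i q. 0)) \<longlonglongrightarrow> of_real (exp (- 0 / 2)) * of_real G"
    unfolding I_def G_def
    by (rule freq_integral_tendsto[OF nq_sum n_lim c, where e="\<lambda>_. 0" and B=0]) (auto simp: lab_var_def)
  then have I0': "(\<lambda>m. I m (\<lambda>i q. 0)) \<longlonglongrightarrow> of_real G" by simp
  have npos: "\<forall>\<^sub>F m in sequentially. n m > 0"
    by (rule eventually_pos_at_top[OF n_lim])
  have I0ne: "\<forall>\<^sub>F m in sequentially. I m (\<lambda>i q. 0) \<noteq> 0"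
    using tendsto_imp_eventually_ne[OF I0'] G by simp
  have key: "\<forall>\<^sub>F m in sequentially. assignments (n m) (nq m) \<noteq> {} \<and>
     I m (A m) / I m (\<lambda>i q. 0) = (\<integral>z. iexp (\<Sum>i<n m. A m i (z i)) \<partial>measure_pmf (CRFE (n m) (nq m)))"
    using npos I0ne
  proof eventually_elim
    case (elim m)
    let ?S = "assignments (n m) (nq m)"
    obtain k where k: "\<And>A. I m A = k * (\<Sum>z\<in>?S. iexp (\<Sum>i<n m. A i (z i)))"
      unfolding I_def fourier_assignments[OF elim(1) nq_sum] by blast
    have ne: "?S \<noteq> {}" using elim(2) unfolding k by auto
    have k0: "k \<noteq> 0" using elim(2) unfolding k by auto
    have "I m (A m) / I m (\<lambda>i q. 0) = (\<Sum>z\<in>?S. iexp (\<Sum>i<n m. A m i (z i))) / real (card ?S)"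
      unfolding k using k0 by simp
    also have "\<dots> = (\<integral>z. iexp (\<Sum>i<n m. A m i (z i)) \<partial>measure_pmf (CRFE (n m) (nq m)))"
      unfolding CRFE_def using ne finite_assignments[of "n m" "nq m"]
      by (subst integral_measure_pmf[of ?S]) (auto simp: scaleR_conv_of_real sum_divide_distrib set_pmf_of_set)
    finally show ?case using ne by simp
  qed
  then show "\<forall>\<^sub>F m in sequentially. assignments (n m) (nq m) \<noteq> {}" by eventually_elim auto
  have "(\<lambda>m. I m (A m) / I m (\<lambda>i q. 0)) \<longlonglongrightarrow> of_real (exp (- v / 2)) * of_real G / of_real G"
    using G by (intro tendsto_divide I1 I0') auto
  then have "(\<lambda>m. I m (A m) / I m (\<lambda>i q. 0)) \<longlonglongrightarrow> of_real (exp (- v / 2))"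
    using G by simp
  then show "(\<lambda>m. \<integral>z. iexp (\<Sum>i<n m. A m i (z i)) \<partial>measure_pmf (CRFE (n m) (nq m))) \<longlonglongrightarrow> of_real (exp (- v / 2))"
    by (rule Lim_transform_eventually) (use key in \<open>eventually_elim, auto\<close>)
qed

section \<open>Square roots of positive semidefinite matrices\<close>

lemma symmetric_dot: "transpose A = A \<Longrightarrow> (A *v x) \<bullet> y = x \<bullet> (A *v y)" for A :: "real^'n^'n"
  by (metis dot_lmul_matrix transpose_matrix_vector vector_transpose_matrix)

lemma linear_term_zero:
  fixes b c :: real
  assumes "\<And>t. 2 * t * b \<le> t\<^sup>2 * c"
  shows "b = 0"
proof (rule ccontr)
  assume b: "b \<noteq> 0"
  define k where "k = \<bar>c\<bar> + 1"
  have k: "k > 0" "c < k" by (auto simp: k_def)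
  have "2 * (b / k) * b \<le> (b / k)\<^sup>2 * c" by (rule assms)
  then have "2 * b\<^sup>2 / k \<le> b\<^sup>2 * c / k\<^sup>2" by (simp add: power2_eq_square)
  then have "2 * b\<^sup>2 * k \<le> b\<^sup>2 * c" using k by (simp add: field_simps power2_eq_square)
  then have "2 * k \<le> c" using b by (simp add: mult_ac)
  then show False using k by linarith
qed

lemma symmetric_eigenvector:
  fixes A :: "real^'n^'n"
  assumes sym: "transpose A = A" and S: "subspace S" and inv: "\<And>x. x \<in> S \<Longrightarrow> A *v x \<in> S" and ne: "S \<noteq> {0}"
  obtains b l where "b \<in> S" "norm b = 1" "A *v b = l *\<^sub>R b"
proof -
  let ?K = "S \<inter> sphere 0 1"
  let ?f = "\<lambda>x. x \<bullet> (A *v x)"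
  have c1: "compact ?K" using closed_subspace[OF S] by (intro closed_Int_compact) auto
  have c2: "?K \<noteq> {}"
  proof -
    obtain x where x: "x \<in> S" "x \<noteq> 0" using ne subspace_0[OF S] by auto
    then have "x /\<^sub>R norm x \<in> ?K" using S by (auto simp: subspace_scale)
    then show ?thesis by blast
  qed
  have c3: "continuous_on ?K ?f"
    by (intro continuous_intros linear_continuous_on matrix_vector_mul_bounded_linear)
  obtain b where b: "b \<in> ?K" and max: "\<And>x. x \<in> ?K \<Longrightarrow> ?f x \<le> ?f b"
    using continuous_attains_sup[OF c1 c2 c3] by blast
  define l where "l = ?f b"
  have bS: "b \<in> S" and b1: "norm b = 1" using b by auto
  have bb: "b \<bullet> b = 1" using b1 by (simp add: norm_eq_1)
  have ineq: "?f x \<le> l * (x \<bullet> x)" if x: "x \<in> S" for x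
  proof (cases "x = 0")
    case False
    then have "x /\<^sub>R norm x \<in> ?K" using S x by (auto simp: subspace_scale)
    from max[OF this] have "?f x / (norm x * norm x) \<le> l"
      by (simp add: l_def matrix_vector_mult_scaleR divide_inverse mult_ac)
    then show ?thesis using False by (simp add: field_simps dot_square_norm power2_eq_square)
  qed (simp add: l_def)
  have "A *v b = l *\<^sub>R b"
  proof -
    define w where "w = A *v b - l *\<^sub>R b"
    have w: "w \<in> S" unfolding w_def using S inv bS by (simp add: subspace_diff subspace_scale)
    have "2 * t * (w \<bullet> w) \<le> t\<^sup>2 * (l * (w \<bullet> w) - w \<bullet> (A *v w))" for t
    proof -
      have bt: "b + t *\<^sub>R w \<in> S" using S bS w by (simp add: subspace_add subspace_scale)
      have "?f (b + t *\<^sub>R w) = l + 2 * t * (w \<bullet> (A *v b)) + t\<^sup>2 * (w \<bullet> (A *v w))"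
        using symmetric_dot[OF sym, of b w]
        by (simp add: l_def matrix_vector_right_distrib matrix_vector_mult_scaleR inner_add_left inner_add_right
            power2_eq_square inner_commute algebra_simps)
      moreover have "(b + t *\<^sub>R w) \<bullet> (b + t *\<^sub>R w) = 1 + 2 * t * (w \<bullet> b) + t\<^sup>2 * (w \<bullet> w)"
        using bb by (simp add: inner_add_left inner_add_right power2_eq_square inner_commute algebra_simps)
      ultimately have "l + 2 * t * (w \<bullet> (A *v b)) + t\<^sup>2 * (w \<bullet> (A *v w)) \<le> l * (1 + 2 * t * (w \<bullet> b) + t\<^sup>2 * (w \<bullet> w))"
        using ineq[OF bt] by simp
      moreover have "w \<bullet> (A *v b) = w \<bullet> w + l * (w \<bullet> b)" by (simp add: w_def inner_diff_right)
      ultimately show ?thesis by (simp add: algebra_simps)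
    qed
    then have "w \<bullet> w = 0" by (rule linear_term_zero)
    then show ?thesis by (simp add: w_def)
  qed
  then show thesis using bS b1 that by blast
qed

lemma symmetric_eigenbasis:
  fixes A :: "real^'n^'n"
  assumes sym: "transpose A = A"
  shows "subspace S \<Longrightarrow> (\<And>x. x \<in> S \<Longrightarrow> A *v x \<in> S) \<Longrightarrow>
    \<exists>B. finite B \<and> B \<subseteq> S \<and> span B = S \<and> pairwise orthogonal B \<and> (\<forall>b\<in>B. norm b = 1 \<and> (\<exists>l. A *v b = l *\<^sub>R b))"
proof (induction "dim S" arbitrary: S rule: less_induct)
  case less
  note S = less.prems(1) and inv = less.prems(2)
  show ?case
  proof (cases "S = {0}")
    case True
    then show ?thesis by (intro exI[of _ "{}"]) auto
  next
    case False
    obtain b l where b: "b \<in> S" "norm b = 1" "A *v b = l *\<^sub>R b"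
      using symmetric_eigenvector[OF sym S inv False] .
    have bb: "b \<bullet> b = 1" using b(2) by (simp add: norm_eq_1)
    define T where "T = S \<inter> {x. b \<bullet> x = 0}"
    have T: "subspace T" unfolding T_def by (intro subspace_inter S subspace_hyperplane)
    have Tinv: "A *v x \<in> T" if "x \<in> T" for x
      using that inv b(3) symmetric_dot[OF sym, of b x] by (auto simp: T_def)
    have TS: "T \<subseteq> S" by (auto simp: T_def)
    have "dim T < dim S"
    proof (rule ccontr)
      assume "\<not> dim T < dim S"
      then have "T = S" using subspace_dim_equal[OF T S TS] by simp
      then have "b \<in> T" using b(1) by simp
      then show False using bb by (simp add: T_def)
    qed
    from less.hyps[OF this T Tinv]
    obtain B where B: "finite B" "B \<subseteq> T" "span B = T" "pairwise orthogonal B" "\<forall>b\<in>B. norm b = 1 \<and> (\<exists>l. A *v b = l *\<^sub>R b)"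
      by blast
    have "span (insert b B) = S"
    proof
      show "span (insert b B) \<subseteq> S" using B(2) b(1) TS by (intro span_minimal S) auto
      show "S \<subseteq> span (insert b B)"
      proof
        fix x assume x: "x \<in> S"
        have "x - (b \<bullet> x) *\<^sub>R b \<in> T" using x b(1) S bb
          by (auto simp: T_def subspace_diff subspace_scale inner_diff_right)
        then show "x \<in> span (insert b B)" unfolding span_insert B(3) by blast
      qed
    qed
    moreover have "pairwise orthogonal (insert b B)"
      using B(2,4) by (auto simp: pairwise_insert orthogonal_def T_def inner_commute)
    ultimately show ?thesis using B b TS by (intro exI[of _ "insert b B"]) auto
  qed
qed

lemma matrix_eq_on_span:
  fixes A B :: "real^'n^'m"
  assumes "span S = UNIV" "\<And>x. x \<in> S \<Longrightarrow> A *v x = B *v x"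
  shows "A = B"
proof -
  have "A *v x = B *v x" for x
    by (rule linear_eq_on[of "(*v) A" "(*v) B" x S]) (use assms in auto)
  then show ?thesis by (simp add: matrix_eq)
qed

lemma psd_sqrt_eigenvector:
  fixes R :: "real^'n^'n"
  assumes R: "psd_mat R" and eig: "(R ** R) *v b = l *\<^sub>R b" and l: "l \<ge> 0"
  shows "R *v b = sqrt l *\<^sub>R b"
proof -
  have sym: "transpose R = R" and pos: "\<And>v. 0 \<le> v \<bullet> (R *v v)" using R by (auto simp: psd_mat_def)
  have RR: "R *v (R *v b) = l *\<^sub>R b" using eig by (simp add: matrix_vector_mul_assoc)
  show ?thesis
  proof (cases "l = 0")
    case True
    have "(R *v b) \<bullet> (R *v b) = b \<bullet> (R *v (R *v b))" using symmetric_dot[OF sym] by simp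
    then show ?thesis using RR True by simp
  next
    case False
    define w where "w = R *v b - sqrt l *\<^sub>R b"
    have "R *v w = - sqrt l *\<^sub>R w"
      using RR l by (simp add: w_def matrix_vector_mult_diff_distrib matrix_vector_mult_scaleR algebra_simps)
    then have "0 \<le> - sqrt l * (w \<bullet> w)" using pos[of w] by simp
    moreover have "sqrt l > 0" using False l by simp
    ultimately have "w \<bullet> w \<le> 0" by (simp add: mult_le_0_iff zero_le_mult_iff)
    then have "w = 0" by (metis inner_gt_zero_iff not_le)
    then show ?thesis by (simp add: w_def)
  qed
qed

theorem psd_sqrt_unique_exists:
  fixes A :: "real^'n^'n"
  assumes A: "psd_mat A"
  shows "\<exists>!R. psd_mat R \<and> R ** R = A"
proof -
  have sym: "transpose A = A" and pos: "\<And>v. 0 \<le> v \<bullet> (A *v v)" using A by (auto simp: psd_mat_def)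
  obtain B where B: "finite B" "span B = UNIV" "pairwise orthogonal B" "\<And>b. b \<in> B \<Longrightarrow> norm b = 1" "\<forall>b\<in>B. \<exists>l. A *v b = l *\<^sub>R b"
    using symmetric_eigenbasis[OF sym, of UNIV] by auto
  from B(5) obtain l where l: "\<And>b. b \<in> B \<Longrightarrow> A *v b = l b *\<^sub>R b" by metis
  have bb: "b \<bullet> b = 1" if "b \<in> B" for b using B(4)[OF that] by (simp add: norm_eq_1)
  have orth: "b \<bullet> d = 0" if "b \<in> B" "d \<in> B" "b \<noteq> d" for b d
    using B(3) that by (auto simp: pairwise_def orthogonal_def)
  have l0: "l b \<ge> 0" if "b \<in> B" for b using pos[of b] l[OF that] bb[OF that] by simp
  define r where "r x = (\<Sum>b\<in>B. (sqrt (l b) * (b \<bullet> x)) *\<^sub>R b)" for x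
  have lin: "linear r" unfolding r_def
    by (rule linearI) (auto simp: inner_add_right algebra_simps scaleR_add_left sum.distrib scaleR_sum_right)
  define R where "R = matrix r"
  have R: "R *v x = r x" for x unfolding R_def using lin by (simp add: matrix_works)
  have Rb: "R *v d = sqrt (l d) *\<^sub>R d" if d: "d \<in> B" for d
  proof -
    have "r d = (\<Sum>b\<in>B. if b = d then sqrt (l d) *\<^sub>R d else 0)"
      unfolding r_def using d bb orth by (intro sum.cong) auto
    then show ?thesis using R d B(1) by simp
  qed
  have sq: "R ** R = A"
  proof (rule matrix_eq_on_span[OF B(2)])
    fix b assume b: "b \<in> B"
    show "(R ** R) *v b = A *v b"
      using Rb[OF b] l[OF b] l0[OF b] by (simp add: matrix_vector_mul_assoc[symmetric] matrix_vector_mult_scaleR)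
  qed
  have "x \<bullet> r y = (\<Sum>b\<in>B. sqrt (l b) * (b \<bullet> x) * (b \<bullet> y))" for x y
    unfolding r_def by (simp add: inner_sum_right inner_commute mult_ac)
  then have form: "x \<bullet> (R *v y) = (\<Sum>b\<in>B. sqrt (l b) * (b \<bullet> x) * (b \<bullet> y))" for x y using R by simp
  have symR: "transpose R = R"
  proof -
    have "x \<bullet> (transpose R *v y) = x \<bullet> (R *v y)" for x y
    proof -
      have "(transpose R *v y) \<bullet> x = y \<bullet> (R *v x)"
        by (simp add: dot_lmul_matrix transpose_matrix_vector)
      also have "\<dots> = x \<bullet> (R *v y)" unfolding form by (simp add: mult_ac)
      finally show ?thesis by (simp add: inner_commute)
    qed
    then have "transpose R *v y = R *v y" for y using vector_eq_ldot by blast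
    then show ?thesis by (simp add: matrix_eq)
  qed
  have posR: "0 \<le> v \<bullet> (R *v v)" for v
    unfolding form using l0 by (intro sum_nonneg) (simp add: mult.assoc)
  have psdR: "psd_mat R" using symR posR by (simp add: psd_mat_def)
  show ?thesis
  proof (rule ex1I[of _ R])
    show "psd_mat R \<and> R ** R = A" using psdR sq by simp
    fix R' assume R': "psd_mat R' \<and> R' ** R' = A"
    show "R' = R"
    proof (rule matrix_eq_on_span[OF B(2)])
      fix b assume b: "b \<in> B"
      show "R' *v b = R *v b"
        using psd_sqrt_eigenvector[of R' b "l b"] R' l[OF b] l0[OF b] Rb[OF b] by simp
    qed
  qed
qed

lemma mat_sqrt:
  assumes "psd_mat A"
  shows "psd_mat (mat_sqrt A)" "mat_sqrt A ** mat_sqrt A = A"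
  using theI'[OF psd_sqrt_unique_exists[OF assms]] by (auto simp: mat_sqrt_def)

lemma norm_mat_sqrt_sq:
  fixes A :: "real^'n^'n"
  assumes "psd_mat A"
  shows "(norm (mat_sqrt A *v u))\<^sup>2 = u \<bullet> (A *v u)"
proof -
  have sym: "transpose (mat_sqrt A) = mat_sqrt A" using mat_sqrt[OF assms] by (simp add: psd_mat_def)
  have "(norm (mat_sqrt A *v u))\<^sup>2 = u \<bullet> (mat_sqrt A *v (mat_sqrt A *v u))"
    using symmetric_dot[OF sym, of u "mat_sqrt A *v u"] by (simp add: dot_square_norm)
  then show ?thesis using mat_sqrt(2)[OF assms] by (simp add: matrix_vector_mul_assoc)
qed

section \<open>Factorial designs\<close>

lemma valid_design_iota:
  assumes "valid_design iota eff"
  shows "iota q k * iota q k = 1"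
proof -
  have "iota q \<in> Pi UNIV (\<lambda>_. {-1, 1})" using assms by (auto simp: valid_design_def bij_betw_def)
  then have "iota q k \<in> {-1, 1}" by auto
  then show ?thesis by auto
qed

lemma gcoef_prod_UNIV: "gcoef iota eff f q = (\<Prod>k\<in>UNIV. if k \<in> eff f then iota q k else 1)"
  unfolding gcoef_def by (rule prod.mono_neutral_cong_left) auto

lemma sum_character:
  fixes iota :: "'q::finite \<Rightarrow> 'k::finite \<Rightarrow> real"
  assumes "valid_design iota eff" and A: "A \<noteq> {}"
  shows "(\<Sum>q\<in>UNIV. \<Prod>k\<in>UNIV. if k \<in> A then iota q k else 1) = 0"
proof -
  have b: "bij_betw iota UNIV (PiE UNIV (\<lambda>_. {-1, 1}))"
    using assms(1) by (simp add: valid_design_def PiE_UNIV_domain)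
  have "(\<Sum>q\<in>UNIV. \<Prod>k\<in>UNIV. if k \<in> A then iota q k else 1) =
      (\<Sum>s\<in>PiE UNIV (\<lambda>_. {-1, 1}). \<Prod>k\<in>UNIV. if k \<in> A then s k else (1::real))"
    by (rule sum.reindex_bij_betw[OF b])
  also have "\<dots> = (\<Prod>k\<in>UNIV. \<Sum>y\<in>{-1, 1}. if k \<in> A then y else 1)"
    by (rule prod_sum_PiE[symmetric]) auto
  also have "\<dots> = 0" using A by (intro prod_zero) auto
  finally show ?thesis .
qed

lemma sum_gcoef:
  assumes "valid_design iota eff"
  shows "(\<Sum>q\<in>UNIV. gcoef iota eff f q) = 0"
proof -
  have "bij_betw eff UNIV {A. A \<noteq> {}}" using assms by (simp add: valid_design_def)
  from bij_betwE[OF this] have "eff f \<noteq> {}" by blast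
  then show ?thesis unfolding gcoef_prod_UNIV by (rule sum_character[OF assms])
qed

lemma gcoef_row_orthogonal:
  fixes iota :: "'q::finite \<Rightarrow> 'k::finite \<Rightarrow> real"
  assumes d: "valid_design iota eff"
  shows "(\<Sum>q\<in>UNIV. gcoef iota eff f q * gcoef iota eff g q) = (if f = g then real CARD('q) else 0)"
proof -
  let ?D = "(eff f - eff g) \<union> (eff g - eff f)"
  have "gcoef iota eff f q * gcoef iota eff g q = (\<Prod>k\<in>UNIV. if k \<in> ?D then iota q k else 1)" for q
    unfolding gcoef_prod_UNIV prod.distrib[symmetric]
    by (intro prod.cong refl) (auto simp: valid_design_iota[OF d])
  then have eq: "(\<Sum>q\<in>UNIV. gcoef iota eff f q * gcoef iota eff g q) = (\<Sum>q\<in>UNIV. \<Prod>k\<in>UNIV. if k \<in> ?D then iota q k else 1)"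
    by simp
  show ?thesis
  proof (cases "f = g")
    case True
    then show ?thesis unfolding eq by simp
  next
    case False
    have "inj eff" using d by (auto simp: valid_design_def bij_betw_def)
    then have "?D \<noteq> {}" using False by (auto dest: injD)
    then show ?thesis unfolding eq sum_character[OF d \<open>?D \<noteq> {}\<close>] using False by simp
  qed
qed

lemma gcoef_column_orthogonal:
  fixes iota :: "'q::finite \<Rightarrow> 'k::finite \<Rightarrow> real" and eff :: "'f::finite \<Rightarrow> 'k set"
  assumes d: "valid_design iota eff"
  shows "(\<Sum>f\<in>UNIV. gcoef iota eff f q * gcoef iota eff f r) = (if q = r then 2 ^ CARD('k) else 0) - 1"
proof -
  let ?h = "\<lambda>A. \<Prod>k\<in>A. iota q k * iota r k"
  have "(\<Sum>f\<in>UNIV. gcoef iota eff f q * gcoef iota eff f r) = (\<Sum>f\<in>UNIV. ?h (eff f))"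
    unfolding gcoef_def prod.distrib ..
  also have "\<dots> = (\<Sum>A\<in>{A. A \<noteq> {}}. ?h A)"
    using d by (intro sum.reindex_bij_betw) (simp add: valid_design_def)
  also have "\<dots> = (\<Sum>A\<in>UNIV. ?h A) - 1"
  proof -
    have U: "UNIV = insert {} {A :: 'k set. A \<noteq> {}}" by auto
    have "(\<Sum>A\<in>UNIV. ?h A) = ?h {} + (\<Sum>A\<in>{A. A \<noteq> {}}. ?h A)"
      by (subst U, subst sum.insert) auto
    then show ?thesis by simp
  qed
  also have "(\<Sum>A\<in>UNIV. ?h A) = (\<Prod>k\<in>UNIV. iota q k * iota r k + 1)"
    by (subst prod_add) auto
  also have "\<dots> = (if q = r then 2 ^ CARD('k) else 0)"
  proof (cases "q = r")
    case True
    then show ?thesis by (simp add: valid_design_iota[OF d])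
  next
    case False
    have "inj iota" using d by (auto simp: valid_design_def bij_betw_def)
    then have "iota q \<noteq> iota r" using False by (auto dest: injD)
    then obtain k where k: "iota q k \<noteq> iota r k" by auto
    have "iota q k * iota r k + 1 = 0"
    proof -
      have "(iota q k - iota r k) * (iota q k + iota r k) = 0"
        using valid_design_iota[OF d, of q k] valid_design_iota[OF d, of r k] by (simp add: algebra_simps)
      then have "iota q k = - iota r k" using k by auto
      then show ?thesis using valid_design_iota[OF d, of r k] by simp
    qed
    then have "(\<Prod>k\<in>UNIV. iota q k * iota r k + 1) = 0" by (intro prod_zero) auto
    then show ?thesis using False by simp
  qed
  finally show ?thesis .
qed

lemma matrix_inv_mult:
  fixes M :: "real^'n^'n"
  assumes "invertible M"
  shows "M ** matrix_inv M = mat 1" "matrix_inv M ** M = mat 1"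
proof -
  have "M ** matrix_inv M = mat 1 \<and> matrix_inv M ** M = mat 1"
    using assms unfolding invertible_def matrix_inv_def by (rule someI_ex)
  then show "M ** matrix_inv M = mat 1" "matrix_inv M ** M = mat 1" by auto
qed

lemma matrix_inv_tendsto:
  fixes A :: "nat \<Rightarrow> real^'n^'n"
  assumes lim: "A \<longlonglongrightarrow> L" and inv: "\<And>m. invertible (A m)" "invertible L"
  shows "(\<lambda>m. matrix_inv (A m)) \<longlonglongrightarrow> matrix_inv L"
proof -
  have entry: "matrix_inv M $ k $ j = det (\<chi> i l. if l = k then axis j 1 $ i else M $ i $ l) / det M"
    if M: "invertible M" for M :: "real^'n^'n" and k j
  proof -
    have d: "det M \<noteq> 0" using M by (simp add: invertible_det_nz)
    have "M *v (matrix_inv M *v axis j 1) = axis j 1"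
      using matrix_inv_mult(1)[OF M] by (simp add: matrix_vector_mul_assoc)
    then have "matrix_inv M *v axis j 1 = (\<chi> k. det (\<chi> i l. if l = k then axis j 1 $ i else M $ i $ l) / det M)"
      using cramer[OF d] by blast
    moreover have "matrix_inv M $ k $ j = (matrix_inv M *v axis j 1) $ k"
      by (simp add: matrix_vector_mult_basis column_def)
    ultimately show ?thesis by simp
  qed
  have e: "(\<lambda>m. A m $ i $ l) \<longlonglongrightarrow> L $ i $ l" for i l
    by (intro tendsto_vec_nth lim)
  have detlim: "(\<lambda>m. det (B m)) \<longlonglongrightarrow> det B'" if "\<And>i l. (\<lambda>m. B m $ i $ l) \<longlonglongrightarrow> B' $ i $ l" for B :: "nat \<Rightarrow> real^'n^'n" and B'
    unfolding det_def by (intro tendsto_sum tendsto_mult tendsto_const tendsto_prod that)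
  show ?thesis
  proof (intro vec_tendstoI)
    fix k j
    show "(\<lambda>m. matrix_inv (A m) $ k $ j) \<longlonglongrightarrow> matrix_inv L $ k $ j"
      unfolding entry[OF inv(1)] entry[OF inv(2)]
    proof (intro tendsto_divide detlim)
      show "det L \<noteq> 0" using inv(2) by (simp add: invertible_det_nz)
      show "(\<lambda>m. (\<chi> i l. if l = k then axis j 1 $ i else A m $ i $ l) $ i $ l) \<longlonglongrightarrow> (\<chi> i l. if l = k then axis j 1 $ i else L $ i $ l) $ i $ l" for i l
        using e by (cases "l = k") auto
    qed (rule e)
  qed
qed

lemma outerp_mult: "outerp a b *v u = (b \<bullet> u) *\<^sub>R a" for a :: "real^'a" and b u :: "real^'b::finite"
  by (simp add: vec_eq_iff outerp_def matrix_vector_mult_def inner_vec_def sum_distrib_left mult_ac)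

lemma sum_matrix_mult: "(\<Sum>i\<in>I. A i) *v u = (\<Sum>i\<in>I. A i *v u)" for A :: "'i \<Rightarrow> real^'b^'a"
  by (induction I rule: infinite_finite_induct) (auto simp: matrix_vector_mult_add_rdistrib)

lemma scaleR_matrix_mult: "(c *\<^sub>R A) *v u = c *\<^sub>R (A *v u)" for A :: "real^'b^'a"
  by (rule scaleR_matrix_vector_assoc[symmetric])

lemma pcov_mat_form: "u \<bullet> (pcov_mat n t *v v) = (\<Sum>i<n. (u \<bullet> (t i - pmean n t)) * ((t i - pmean n t) \<bullet> v)) / (real n - 1)"
  for u v :: "real^'a"
  unfolding pcov_mat_def scaleR_matrix_mult sum_matrix_mult outerp_mult
  by (simp add: inner_sum_right sum_distrib_left sum_divide_distrib mult_ac)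

lemma pcov_mat_entry_sym: "pcov_mat n t $ r $ c = pcov_mat n t $ c $ r"
  by (simp add: pcov_mat_def outerp_def mult.commute)

lemma pcov_mat_symmetric: "transpose (pcov_mat n t) = pcov_mat n t"
  by (simp add: vec_eq_iff transpose_def pcov_mat_entry_sym)

lemma pmean_centered: "n > 0 \<Longrightarrow> (\<Sum>i<n. t i - pmean n t) = 0"
  by (simp add: sum_subtractf pmean_def sum_constant_scaleR)

lemma sum_square_expand:
  fixes a :: "'q::finite \<Rightarrow> real"
  shows "(\<Sum>q\<in>UNIV. a q)\<^sup>2 = (\<Sum>q\<in>UNIV. \<Sum>r\<in>UNIV. a q * a r)"
  by (simp add: power2_eq_square sum_product)

locale factorial_population =
  fixes iota :: "'q::finite \<Rightarrow> 'k::finite \<Rightarrow> real" and eff :: "'f::finite \<Rightarrow> 'k set"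
    and n :: nat and nq :: "'q \<Rightarrow> nat" and Y :: "nat \<Rightarrow> 'q \<Rightarrow> real" and x :: "nat \<Rightarrow> real^'l::finite"
  assumes design: "valid_design iota eff"
    and nq_pos: "\<And>q. 1 \<le> nq q"
    and nq_sum: "(\<Sum>q\<in>UNIV. nq q) = n"
    and S_inv: "invertible (pcov_mat n x)"
begin

abbreviation "Sxx \<equiv> pcov_mat n x"
abbreviation "Vx \<equiv> Vxx iota eff n nq x"
abbreviation "Vperp \<equiv> Vmat iota eff n nq (Yperp n Y x)"
abbreviation "Vpar \<equiv> Vmat iota eff n nq (Ypar n Y x)"
abbreviation "pcov_perp q r \<equiv> pcov n (\<lambda>i. Yperp n Y x i q) (\<lambda>i. Yperp n Y x i r)"
abbreviation "pcov_par q r \<equiv> pcov n (\<lambda>i. Ypar n Y x i q) (\<lambda>i. Ypar n Y x i r)"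
abbreviation "tauhx \<equiv> tau_hat_x iota eff n nq x"
abbreviation "tauerr z \<equiv> tau_hat iota eff n nq Y z - tau_pop iota eff n Y"

definition xc :: "nat \<Rightarrow> real^'l" where "xc i = x i - pmean n x"

definition slope :: "'q \<Rightarrow> real^'l" where
  "slope q = pcov_sv n (\<lambda>i. Y i q) x v* matrix_inv (Sxx)"

definition resid :: "nat \<Rightarrow> 'q \<Rightarrow> real" where "resid i q = Yperp n Y x i q"

definition weight :: "real^'f \<Rightarrow> 'q \<Rightarrow> real" where
  "weight u q = (u \<bullet> bvec iota eff q) / 2 ^ (CARD('k) - 1)"

definition xweight :: "real^('f \<times> 'l) \<Rightarrow> 'q \<Rightarrow> real^'l" where
  "xweight y q = (\<chi> l. (\<Sum>f\<in>UNIV. gcoef iota eff f q * y $ (f, l)) / 2 ^ (CARD('k) - 1))"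

lemma n_ge_2: "n \<ge> 2"
proof (rule ccontr)
  assume "\<not> n \<ge> 2"
  then have "n = 0 \<or> n = 1" by auto
  then have "Sxx = 0" by (auto simp: pcov_mat_def)
  then have "det (Sxx) = 0" by (metis det_0 mat_0)
  then show False using S_inv by (simp add: invertible_det_nz)
qed

lemma real_n: "real n - 1 > 0" "real n > 0" using n_ge_2 by auto

lemma real_nq: "real (nq q) > 0" using nq_pos[of q] by linarith

lemma sum_xc: "(\<Sum>i<n. xc i) = 0"
  unfolding xc_def using n_ge_2 by (intro pmean_centered) auto

lemma sum_xc_inner: "(\<Sum>i<n. a \<bullet> xc i) = 0"
  using sum_xc by (simp flip: inner_sum_right)

lemma Sxx_form: "u \<bullet> (Sxx *v v) = (\<Sum>i<n. (u \<bullet> xc i) * (v \<bullet> xc i)) / (real n - 1)"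
  unfolding pcov_mat_form xc_def by (simp add: inner_commute)

lemma Sxx_slope: "Sxx *v slope q = pcov_sv n (\<lambda>i. Y i q) x"
proof -
  let ?S = "Sxx" and ?s = "pcov_sv n (\<lambda>i. Y i q) x"
  have "?S *v slope q = slope q v* ?S"
    by (metis pcov_mat_symmetric transpose_matrix_vector)
  also have "\<dots> = ?s v* (matrix_inv ?S ** ?S)"
    by (simp add: slope_def vector_matrix_mul_assoc)
  also have "\<dots> = ?s" using matrix_inv_mult(2)[OF S_inv] by simp
  finally show ?thesis .
qed

lemma Ypar_eq: "Ypar n Y x i q = pmean n (\<lambda>j. Y j q) + slope q \<bullet> xc i"
  by (simp add: Ypar_def slope_def xc_def dot_lmul_matrix)

lemma resid_eq: "resid i q = (Y i q - pmean n (\<lambda>j. Y j q)) - slope q \<bullet> xc i"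
  by (simp add: resid_def Yperp_def Ypar_eq)

lemma sum_resid: "(\<Sum>i<n. resid i q) = 0"
  unfolding resid_eq sum_subtractf[of _ "\<lambda>i. slope q \<bullet> xc i"] sum_xc_inner
  using pmean_centered[of n "\<lambda>j. Y j q"] n_ge_2 by simp

lemma sum_Y_xc: "(\<Sum>i<n. (Y i q - pmean n (\<lambda>j. Y j q)) * (a \<bullet> xc i)) = (real n - 1) * (a \<bullet> pcov_sv n (\<lambda>i. Y i q) x)"
  using real_n by (simp add: pcov_sv_def xc_def inner_sum_right sum_distrib_left)

lemma sum_xc_xc: "(\<Sum>i<n. (u \<bullet> xc i) * (v \<bullet> xc i)) = (real n - 1) * (u \<bullet> (Sxx *v v))"
  using real_n by (simp add: Sxx_form)

lemma sum_resid_xc: "(\<Sum>i<n. resid i q * (a \<bullet> xc i)) = 0"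
proof -
  have "(\<Sum>i<n. resid i q * (a \<bullet> xc i)) = (\<Sum>i<n. (Y i q - pmean n (\<lambda>j. Y j q)) * (a \<bullet> xc i)) - (\<Sum>i<n. (a \<bullet> xc i) * (slope q \<bullet> xc i))"
    by (simp add: resid_eq sum_subtractf[symmetric] algebra_simps)
  then show ?thesis unfolding sum_Y_xc sum_xc_xc Sxx_slope by simp
qed

lemma pmean_Ypar: "pmean n (\<lambda>i. Ypar n Y x i q) = pmean n (\<lambda>j. Y j q)"
  unfolding Ypar_eq using real_n sum_xc_inner[of "slope q"]
  by (simp add: pmean_def sum.distrib)

lemma pmean_Yperp: "pmean n (\<lambda>i. Yperp n Y x i q) = 0"
  using sum_resid[of q] by (simp add: pmean_def resid_def)

lemma pcov_Ypar: "pcov_par q r = slope q \<bullet> pcov_sv n (\<lambda>i. Y i r) x"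
  unfolding pcov_def unfolding pmean_Ypar unfolding Ypar_eq using real_n by (simp add: sum_xc_xc Sxx_slope)

lemma pcov_Yperp: "pcov_perp q r =
   pcov n (\<lambda>i. Y i q) (\<lambda>i. Y i r) - slope q \<bullet> pcov_sv n (\<lambda>i. Y i r) x"
proof -
  have "(\<Sum>i<n. resid i q * resid i r) = (\<Sum>i<n. resid i q * (Y i r - pmean n (\<lambda>j. Y j r)))"
    using sum_resid_xc[of q "slope r"] by (simp add: resid_eq[of _ r] right_diff_distrib sum_subtractf)
  also have "\<dots> = (\<Sum>i<n. (Y i q - pmean n (\<lambda>j. Y j q)) * (Y i r - pmean n (\<lambda>j. Y j r))) -
      (\<Sum>i<n. (Y i r - pmean n (\<lambda>j. Y j r)) * (slope q \<bullet> xc i))"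
    by (simp add: resid_eq sum_subtractf[symmetric] algebra_simps)
  finally show ?thesis
    unfolding pcov_def unfolding pmean_Yperp unfolding resid_def[symmetric] sum_Y_xc
    using real_n by (simp add: diff_divide_distrib)
qed

lemma sum_resid_sq: "(\<Sum>i<n. (resid i q)\<^sup>2) = (real n - 1) * pcov_perp q q"
  unfolding pcov_def unfolding pmean_Yperp unfolding resid_def[symmetric] using real_n by (simp add: power2_eq_square)

lemma weight_sum: "u \<bullet> tau_i iota eff Z i = (\<Sum>q\<in>UNIV. weight u q * Z i q)"
  by (simp add: tau_i_def weight_def inner_sum_right sum_divide_distrib mult_ac)

lemma inner_pmean: "u \<bullet> pmean n t = pmean n (\<lambda>i. u \<bullet> t i)"
  by (simp add: pmean_def inner_sum_right)

lemma pmean_sum_weight: "pmean n (\<lambda>i. \<Sum>q\<in>UNIV. w q * Z i q) = (\<Sum>q\<in>UNIV. w q * pmean n (\<lambda>i. Z i q))"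
  for Z :: "nat \<Rightarrow> 'q \<Rightarrow> real"
  unfolding pmean_def by (subst sum.swap) (simp add: sum_distrib_left mult_ac)

lemma centered_tau_i: "u \<bullet> (tau_i iota eff Z i - pmean n (tau_i iota eff Z)) = (\<Sum>q\<in>UNIV. weight u q * (Z i q - pmean n (\<lambda>j. Z j q)))"
  unfolding inner_diff_right inner_pmean weight_sum pmean_sum_weight
  by (simp add: sum_subtractf right_diff_distrib)

lemma tau_cov_form: "u \<bullet> (pcov_mat n (tau_i iota eff Z) *v v) = (\<Sum>q\<in>UNIV. \<Sum>r\<in>UNIV. weight u q * weight v r * pcov n (\<lambda>i. Z i q) (\<lambda>i. Z i r))"
proof -
  let ?d = "\<lambda>i q. Z i q - pmean n (\<lambda>j. Z j q)"
  have "u \<bullet> (pcov_mat n (tau_i iota eff Z) *v v) = (\<Sum>i<n. (\<Sum>q\<in>UNIV. weight u q * ?d i q) * (\<Sum>r\<in>UNIV. weight v r * ?d i r)) / (real n - 1)"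
    unfolding pcov_mat_form inner_commute[of _ v] centered_tau_i ..
  also have "\<dots> = (\<Sum>i<n. \<Sum>q\<in>UNIV. \<Sum>r\<in>UNIV. weight u q * weight v r * (?d i q * ?d i r)) / (real n - 1)"
    by (simp add: sum_product mult_ac)
  also have "(\<Sum>i<n. \<Sum>q\<in>UNIV. \<Sum>r\<in>UNIV. weight u q * weight v r * (?d i q * ?d i r)) = (\<Sum>q\<in>UNIV. \<Sum>r\<in>UNIV. \<Sum>i<n. weight u q * weight v r * (?d i q * ?d i r))"
    by (subst sum.swap, rule sum.cong[OF refl], subst sum.swap, rule refl)
  also have "\<dots> / (real n - 1) = (\<Sum>q\<in>UNIV. \<Sum>r\<in>UNIV. weight u q * weight v r * pcov n (\<lambda>i. Z i q) (\<lambda>i. Z i r))"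
    unfolding pcov_def by (simp add: sum_distrib_left sum_divide_distrib)
  finally show ?thesis .
qed

lemma Vmat_form: "u \<bullet> (Vmat iota eff n nq Z *v v) =
   (\<Sum>q\<in>UNIV. weight u q * weight v q * pcov n (\<lambda>i. Z i q) (\<lambda>i. Z i q) / real (nq q)) -
   (\<Sum>q\<in>UNIV. \<Sum>r\<in>UNIV. weight u q * weight v r * pcov n (\<lambda>i. Z i q) (\<lambda>i. Z i r)) / real n"
proof -
  have p: "(2::real) ^ (2 * (CARD('k) - 1)) = 2 ^ (CARD('k) - 1) * 2 ^ (CARD('k) - 1)"
    by (simp only: mult_2 power_add)
  have "u \<bullet> (Vmat iota eff n nq Z *v v) =
    (1 / 2 ^ (2 * (CARD('k) - 1))) * (\<Sum>q\<in>UNIV. (pcov n (\<lambda>i. Z i q) (\<lambda>i. Z i q) / real (nq q)) * ((bvec iota eff q \<bullet> v) * (u \<bullet> bvec iota eff q)))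
    - (1 / real n) * (u \<bullet> (pcov_mat n (tau_i iota eff Z) *v v))"
    unfolding Vmat_def matrix_vector_mult_diff_rdistrib scaleR_matrix_mult sum_matrix_mult outerp_mult
    by (simp add: inner_diff_right inner_sum_right mult.assoc)
  also have "(1 / 2 ^ (2 * (CARD('k) - 1))) * (\<Sum>q\<in>UNIV. (pcov n (\<lambda>i. Z i q) (\<lambda>i. Z i q) / real (nq q)) * ((bvec iota eff q \<bullet> v) * (u \<bullet> bvec iota eff q))) =
      (\<Sum>q\<in>UNIV. weight u q * weight v q * pcov n (\<lambda>i. Z i q) (\<lambda>i. Z i q) / real (nq q))"
    unfolding sum_distrib_left p weight_def by (intro sum.cong refl) (simp add: inner_commute)
  finally show ?thesis unfolding tau_cov_form by simp
qed

lemma sum_xweight: "(\<Sum>q\<in>UNIV. xweight y q) = 0"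
proof -
  have "(\<Sum>q\<in>UNIV. xweight y q $ l) = 0" for l
  proof -
    have "(\<Sum>q\<in>UNIV. \<Sum>f\<in>UNIV. gcoef iota eff f q * y $ (f, l)) = 0"
      by (subst sum.swap) (simp add: sum_gcoef[OF design] flip: sum_distrib_right)
    then show ?thesis by (simp add: xweight_def flip: sum_divide_distrib)
  qed
  then show ?thesis by (simp add: vec_eq_iff)
qed

lemma xweight_surj:
  assumes w: "(\<Sum>q\<in>UNIV. w q) = 0"
  obtains y where "\<And>q. xweight y q = w q"
proof
  define y :: "real^('f \<times> 'l)" where
    "y = (\<chi> r. (2 ^ (CARD('k) - 1) / 2 ^ CARD('k)) * (\<Sum>q\<in>UNIV. gcoef iota eff (fst r) q * w q $ snd r))"
  fix q
  have w': "(\<Sum>r\<in>UNIV. w r $ l) = 0" for l using w by (simp flip: sum_component)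
  have "xweight y q $ l = w q $ l" for l
  proof -
    have "(\<Sum>f\<in>UNIV. gcoef iota eff f q * (\<Sum>r\<in>UNIV. gcoef iota eff f r * w r $ l)) =
      (\<Sum>r\<in>UNIV. (\<Sum>f\<in>UNIV. gcoef iota eff f q * gcoef iota eff f r) * w r $ l)"
      unfolding sum_distrib_left sum_distrib_right by (subst sum.swap) (simp add: mult_ac)
    also have "\<dots> = (\<Sum>r\<in>UNIV. (if q = r then 2 ^ CARD('k) * w r $ l else 0) - w r $ l)"
      unfolding gcoef_column_orthogonal[OF design] by (intro sum.cong refl) (auto simp: algebra_simps)
    also have "\<dots> = 2 ^ CARD('k) * w q $ l" by (simp add: sum_subtractf w')
    finally have 1: "(\<Sum>f\<in>UNIV. gcoef iota eff f q * (\<Sum>r\<in>UNIV. gcoef iota eff f r * w r $ l)) = 2 ^ CARD('k) * w q $ l" .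
    have "xweight y q $ l = (2 ^ (CARD('k) - 1) / 2 ^ CARD('k)) * (\<Sum>f\<in>UNIV. gcoef iota eff f q * (\<Sum>r\<in>UNIV. gcoef iota eff f r * w r $ l)) / 2 ^ (CARD('k) - 1)"
    proof -
      define T where "T f = (\<Sum>r\<in>UNIV. gcoef iota eff f r * w r $ l)" for f
      define k where "k = (2::real) ^ (CARD('k) - 1) / 2 ^ CARD('k)"
      have "xweight y q $ l = (\<Sum>f\<in>UNIV. gcoef iota eff f q * (k * T f)) / 2 ^ (CARD('k) - 1)"
        by (simp add: xweight_def y_def T_def k_def)
      also have "(\<Sum>f\<in>UNIV. gcoef iota eff f q * (k * T f)) = k * (\<Sum>f\<in>UNIV. gcoef iota eff f q * T f)"
        by (simp add: sum_distrib_left mult_ac)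
      finally show ?thesis unfolding T_def k_def .
    qed
    also have "\<dots> = w q $ l" unfolding 1 by simp
    finally show ?thesis .
  qed
  then show "xweight y q = w q" by (simp add: vec_eq_iff)
qed

lemma xweight_inj:
  assumes "\<And>q. xweight y q = 0"
  shows "y = 0"
proof -
  have "y $ (g, l) = 0" for g l
  proof -
    have "(\<Sum>f\<in>UNIV. gcoef iota eff f q * y $ (f, l)) = 0" for q
      using assms[of q] by (simp add: vec_eq_iff xweight_def)
    then have "0 = (\<Sum>q\<in>UNIV. gcoef iota eff g q * (\<Sum>f\<in>UNIV. gcoef iota eff f q * y $ (f, l)))" by simp
    also have "\<dots> = (\<Sum>f\<in>UNIV. (\<Sum>q\<in>UNIV. gcoef iota eff g q * gcoef iota eff f q) * y $ (f, l))"
      unfolding sum_distrib_left sum_distrib_right by (subst sum.swap) (simp add: mult_ac)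
    also have "\<dots> = (\<Sum>f\<in>UNIV. if g = f then real CARD('q) * y $ (f, l) else 0)"
      unfolding gcoef_row_orthogonal[OF design] by (intro sum.cong refl) auto
    also have "\<dots> = real CARD('q) * y $ (g, l)" by simp
    finally show ?thesis by simp
  qed
  then show ?thesis by (auto simp: vec_eq_iff)
qed

lemma sum_pair_UNIV: "(\<Sum>r\<in>UNIV. h (fst r) (snd r)) = (\<Sum>l\<in>UNIV. \<Sum>f\<in>UNIV. h f l)"
  for h :: "'f \<Rightarrow> 'l \<Rightarrow> real"
  by (subst sum.swap) (simp add: UNIV_Times_UNIV[symmetric] sum.cartesian_product split_beta del: UNIV_Times_UNIV)

lemma contrast_inner:
  "y \<bullet> (\<chi> r. (1 / 2 ^ (CARD('k) - 1)) * (\<Sum>q\<in>UNIV. gcoef iota eff (fst r) q * d q $ snd r)) = (\<Sum>q\<in>UNIV. xweight y q \<bullet> d q)"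
  for y :: "real^('f \<times> 'l)"
proof -
  let ?c = "(2::real) ^ (CARD('k) - 1)"
  have "y \<bullet> (\<chi> r. (1 / ?c) * (\<Sum>q\<in>UNIV. gcoef iota eff (fst r) q * d q $ snd r)) =
    (\<Sum>r\<in>UNIV. \<Sum>q\<in>UNIV. gcoef iota eff (fst r) q * y $ (fst r, snd r) / ?c * d q $ snd r)"
    by (simp add: inner_vec_def sum_distrib_left mult_ac sum_divide_distrib)
  also have "\<dots> = (\<Sum>q\<in>UNIV. \<Sum>r\<in>UNIV. gcoef iota eff (fst r) q * y $ (fst r, snd r) / ?c * d q $ snd r)"
    by (rule sum.swap)
  also have "\<dots> = (\<Sum>q\<in>UNIV. \<Sum>l\<in>UNIV. \<Sum>f\<in>UNIV. gcoef iota eff f q * y $ (f, l) / ?c * d q $ l)"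
    by (intro sum.cong refl sum_pair_UNIV)
  also have "\<dots> = (\<Sum>q\<in>UNIV. xweight y q \<bullet> d q)"
    by (simp add: inner_vec_def xweight_def sum_divide_distrib sum_distrib_right)
  finally show ?thesis .
qed

lemma tau_hat_x_inner: "y \<bullet> tauhx z = (\<Sum>q\<in>UNIV. xweight y q \<bullet> grp_mean n nq z x q)"
  unfolding tau_hat_x_def by (rule contrast_inner)

lemma Vxx_mult: "Vx *v y = (\<chi> r. (1 / 2 ^ (CARD('k) - 1)) *
    (\<Sum>q\<in>UNIV. gcoef iota eff (fst r) q * ((1 / real (nq q)) *\<^sub>R (Sxx *v xweight y q)) $ snd r))"
proof -
  let ?S = "Sxx"
  let ?c = "(2::real) ^ (CARD('k) - 1)"
  let ?G = "gcoef iota eff"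
  have p: "(2::real) ^ (2 * (CARD('k) - 1)) = ?c * ?c"
    by (simp only: mult_2 power_add)
  have "(Vx *v y) $ r = (1 / ?c) * (\<Sum>q\<in>UNIV. ?G (fst r) q * ((1 / real (nq q)) *\<^sub>R (?S *v xweight y q)) $ snd r)" for r
  proof -
    have "(Vx *v y) $ r =
      (\<Sum>s\<in>UNIV. \<Sum>q\<in>UNIV. (1 / ?c) * (?G (fst r) q * (1 / real (nq q)) * (?S $ snd r $ snd s * (?G (fst s) q * y $ (fst s, snd s) / ?c))))"
      unfolding Vxx_def p by (simp add: matrix_vector_mult_def sum_distrib_left sum_distrib_right mult_ac)
    also have "\<dots> = (\<Sum>q\<in>UNIV. \<Sum>s\<in>UNIV. (1 / ?c) * (?G (fst r) q * (1 / real (nq q)) * (?S $ snd r $ snd s * (?G (fst s) q * y $ (fst s, snd s) / ?c))))"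
      by (rule sum.swap)
    also have "\<dots> = (\<Sum>q\<in>UNIV. \<Sum>l\<in>UNIV. \<Sum>f\<in>UNIV. (1 / ?c) * (?G (fst r) q * (1 / real (nq q)) * (?S $ snd r $ l * (?G f q * y $ (f, l) / ?c))))"
      by (intro sum.cong refl sum_pair_UNIV)
    also have "\<dots> = (1 / ?c) * (\<Sum>q\<in>UNIV. ?G (fst r) q * ((1 / real (nq q)) *\<^sub>R (?S *v xweight y q)) $ snd r)"
    proof -
      have xw: "(\<Sum>f\<in>UNIV. ?G f q * y $ (f, l) / ?c) = xweight y q $ l" for q l
        by (simp add: xweight_def sum_divide_distrib)
      show ?thesis unfolding sum_distrib_left[symmetric] xw by (simp add: matrix_vector_mult_def mult.assoc)
    qed
    finally show ?thesis .
  qed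
  then show ?thesis by (simp add: vec_eq_iff)
qed

lemma Vxx_form: "y \<bullet> (Vx *v y') = (\<Sum>q\<in>UNIV. (xweight y q \<bullet> (Sxx *v xweight y' q)) / real (nq q))"
  unfolding Vxx_mult contrast_inner by simp


lemma Sxx_nonneg: "0 \<le> v \<bullet> (Sxx *v v)"
  unfolding Sxx_form using real_n by (intro divide_nonneg_pos sum_nonneg) auto

lemma Sxx_pos:
  assumes "v \<bullet> (Sxx *v v) = 0"
  shows "v = 0"
proof -
  have "(\<Sum>i<n. (v \<bullet> xc i) * (v \<bullet> xc i)) = 0" using assms real_n unfolding Sxx_form by simp
  then have z: "v \<bullet> xc i = 0" if "i < n" for i
    using that by (subst (asm) sum_nonneg_eq_0_iff) auto
  have "u \<bullet> (Sxx *v v) = 0" for u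
    unfolding Sxx_form using z by simp
  then have "Sxx *v v = 0" by (metis inner_eq_zero_iff)
  then have "matrix_inv (Sxx) *v (Sxx *v v) = 0" by simp
  then show ?thesis using matrix_inv_mult(2)[OF S_inv] by (simp add: matrix_vector_mul_assoc)
qed

lemma Vxx_psd: "psd_mat (Vx)"
  unfolding psd_mat_def
proof (intro conjI allI)
  have "Sxx $ a $ b = Sxx $ b $ a" for a b
    by (rule pcov_mat_entry_sym)
  then show "transpose (Vx) = Vx"
    by (simp add: vec_eq_iff transpose_def Vxx_def mult_ac)
  show "0 \<le> v \<bullet> (Vx *v v)" for v
    unfolding Vxx_form using real_nq by (intro sum_nonneg divide_nonneg_pos Sxx_nonneg)
qed

lemma Vxx_term_le: "(xweight y q \<bullet> (Sxx *v xweight y q)) / real (nq q) \<le> y \<bullet> (Vx *v y)"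
  unfolding Vxx_form by (rule member_le_sum) (auto intro!: divide_nonneg_pos Sxx_nonneg real_nq)

lemma Vxx_pos:
  assumes "y \<bullet> (Vx *v y) = 0"
  shows "y = 0"
proof (rule xweight_inj)
  fix q
  have "(xweight y q \<bullet> (Sxx *v xweight y q)) / real (nq q) \<le> 0" using Vxx_term_le[of y q] assms by simp
  then have "xweight y q \<bullet> (Sxx *v xweight y q) \<le> 0" using real_nq[of q] by (simp add: divide_le_0_iff)
  then show "xweight y q = 0" using Sxx_nonneg[of "xweight y q"] by (intro Sxx_pos) simp
qed

lemma Vxx_invertible: "invertible (Vx)"
proof -
  have "inj ((*v) (Vx))"
  proof (rule injI)
    fix v w assume "Vx *v v = Vx *v w"
    then have "Vx *v (v - w) = 0" by (simp add: matrix_vector_mult_diff_distrib)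
    then have "v - w = 0" by (intro Vxx_pos) simp
    then show "v = w" by simp
  qed
  then show ?thesis using invertible_left_inverse matrix_left_invertible_injective by blast
qed

definition share :: "'q \<Rightarrow> real" where "share q = real (nq q) / real n"

lemma share_sum: "(\<Sum>q\<in>UNIV. share q) = 1"
proof -
  have "(\<Sum>q\<in>UNIV. real (nq q)) = real n" using nq_sum by (simp flip: of_nat_sum)
  then show ?thesis using real_n by (simp add: share_def flip: sum_divide_distrib)
qed

lemma share_nonneg: "0 \<le> share q" by (simp add: share_def)

definition clt_array :: "real^'f \<Rightarrow> real^('f \<times> 'l) \<Rightarrow> nat \<Rightarrow> 'q \<Rightarrow> real" where
  "clt_array u y i q = (sqrt (real n) * weight u q * resid i q + xweight y q \<bullet> xc i) / real (nq q)"

lemma sum_clt_array: "(\<Sum>i<n. clt_array u y i q) = 0"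
proof -
  have "(\<Sum>i<n. sqrt (real n) * weight u q * resid i q) = 0"
    using sum_resid[of q] by (simp flip: sum_distrib_left)
  then show ?thesis using sum_xc_inner[of "xweight y q"] by (simp add: clt_array_def sum.distrib flip: sum_divide_distrib)
qed

lemma sum_sq_combination:
  "(\<Sum>i<n. (b * resid i q + w \<bullet> xc i)\<^sup>2) = (real n - 1) *
    (b\<^sup>2 * pcov_perp q q + w \<bullet> (Sxx *v w))"
proof -
  have "(\<Sum>i<n. (b * resid i q + w \<bullet> xc i)\<^sup>2) = b\<^sup>2 * (\<Sum>i<n. (resid i q)\<^sup>2) + 2 * b * (\<Sum>i<n. resid i q * (w \<bullet> xc i)) + (\<Sum>i<n. (w \<bullet> xc i) * (w \<bullet> xc i))"
    by (simp add: sum_distrib_left sum.distrib[symmetric] power2_eq_square algebra_simps)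
  then show ?thesis unfolding sum_resid_xc sum_resid_sq sum_xc_xc by (simp add: algebra_simps)
qed

lemma sum_clt_array_sq:
  "(\<Sum>i<n. (clt_array u y i q)\<^sup>2) = (real n - 1) * (real n * (weight u q)\<^sup>2 * pcov_perp q q
     + xweight y q \<bullet> (Sxx *v xweight y q)) / (real (nq q))\<^sup>2"
  unfolding clt_array_def power_divide sum_divide_distrib[symmetric] sum_sq_combination
  using real_n by (simp add: power_mult_distrib)

lemma clt_array_variance:
  "(\<Sum>i<n. lab_var share (clt_array u y i)) = (real n - 1) / real n *
     (real n * (u \<bullet> (Vperp *v u)) + y \<bullet> (Vx *v y))"
proof -
  let ?P = "\<lambda>q r. pcov_perp q r"
  let ?k = "real n - 1"
  have 1: "(\<Sum>i<n. \<Sum>q\<in>UNIV. share q * (clt_array u y i q)\<^sup>2) = ?k / real n *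
     (real n * (\<Sum>q\<in>UNIV. weight u q * weight u q * ?P q q / real (nq q)) + y \<bullet> (Vx *v y))"
  proof -
    have "(\<Sum>i<n. \<Sum>q\<in>UNIV. share q * (clt_array u y i q)\<^sup>2) = (\<Sum>q\<in>UNIV. share q * (\<Sum>i<n. (clt_array u y i q)\<^sup>2))"
      by (subst sum.swap) (simp add: sum_distrib_left)
    also have "\<dots> = (\<Sum>q\<in>UNIV. ?k / real n * (real n * (weight u q * weight u q * ?P q q / real (nq q)) + (xweight y q \<bullet> (Sxx *v xweight y q)) / real (nq q)))"
    proof (rule sum.cong[OF refl])
      fix q
      show "share q * (\<Sum>i<n. (clt_array u y i q)\<^sup>2) = ?k / real n * (real n * (weight u q * weight u q * ?P q q / real (nq q)) + (xweight y q \<bullet> (Sxx *v xweight y q)) / real (nq q))"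
        unfolding sum_clt_array_sq share_def using real_nq[of q] real_n by (simp add: divide_simps power2_eq_square)
    qed
    also have "\<dots> = ?k / real n * (real n * (\<Sum>q\<in>UNIV. weight u q * weight u q * ?P q q / real (nq q)) + y \<bullet> (Vx *v y))"
      unfolding Vxx_form by (simp only: sum_distrib_left[symmetric] sum.distrib)
    finally show ?thesis .
  qed
  have 2: "(\<Sum>i<n. (\<Sum>q\<in>UNIV. share q * clt_array u y i q)\<^sup>2) = ?k / real n * (\<Sum>q\<in>UNIV. \<Sum>r\<in>UNIV. weight u q * weight u r * ?P q r)"
  proof -
    have inner: "(\<Sum>q\<in>UNIV. share q * clt_array u y i q) = (\<Sum>q\<in>UNIV. weight u q * resid i q) / sqrt (real n)" for i
    proof -
      have "share q * clt_array u y i q = weight u q * resid i q / sqrt (real n) + (xweight y q \<bullet> xc i) / real n" for q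
        unfolding share_def clt_array_def using real_nq[of q] real_n
        by (simp add: divide_simps) (simp add: algebra_simps)
      then have "(\<Sum>q\<in>UNIV. share q * clt_array u y i q) = (\<Sum>q\<in>UNIV. weight u q * resid i q) / sqrt (real n) + ((\<Sum>q\<in>UNIV. xweight y q) \<bullet> xc i) / real n"
        by (simp add: sum.distrib sum_divide_distrib inner_sum_left)
      then show ?thesis by (simp add: sum_xweight)
    qed
    have sr: "(\<Sum>i<n. resid i q * resid i r) = ?k * ?P q r" for q r
      unfolding pcov_def unfolding pmean_Yperp unfolding resid_def[symmetric] using real_n by simp
    have "(\<Sum>i<n. (\<Sum>q\<in>UNIV. weight u q * resid i q)\<^sup>2) = (\<Sum>i<n. \<Sum>q\<in>UNIV. \<Sum>r\<in>UNIV. weight u q * weight u r * (resid i q * resid i r))"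
      unfolding sum_square_expand by (simp add: mult_ac)
    also have "\<dots> = (\<Sum>q\<in>UNIV. \<Sum>r\<in>UNIV. \<Sum>i<n. weight u q * weight u r * (resid i q * resid i r))"
      by (subst sum.swap, rule sum.cong[OF refl], subst sum.swap, rule refl)
    also have "\<dots> = (\<Sum>q\<in>UNIV. \<Sum>r\<in>UNIV. ?k * (weight u q * weight u r * ?P q r))"
      unfolding sum_distrib_left[symmetric, of _ _ "{..<n}"] sr by (simp add: mult_ac)
    also have "\<dots> = ?k * (\<Sum>q\<in>UNIV. \<Sum>r\<in>UNIV. weight u q * weight u r * ?P q r)"
      by (simp only: sum_distrib_left)
    finally show ?thesis unfolding inner power_divide using real_n by (simp flip: sum_divide_distrib)
  qed
  show ?thesis
    unfolding lab_var_def sum_subtractf 1 2 Vmat_form using real_n by (simp add: field_simps)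
qed

lemma Vmat_symmetric: "transpose (Vmat iota eff n nq Z) = Vmat iota eff n nq Z"
proof -
  have "outerp b b $ r $ c = outerp b b $ c $ r" for b :: "real^'f" and r c by (simp add: outerp_def)
  moreover have "pcov_mat n t $ r $ c = pcov_mat n t $ c $ r" for t :: "nat \<Rightarrow> real^'f" and r c
    by (rule pcov_mat_entry_sym)
  ultimately show ?thesis by (simp add: vec_eq_iff transpose_def Vmat_def)
qed

lemma Vperp_psd: "psd_mat (Vperp)"
  unfolding psd_mat_def
proof (intro conjI allI Vmat_symmetric)
  fix u
  have "0 \<le> (\<Sum>i<n. lab_var share (clt_array u 0 i))"
    by (intro sum_nonneg lab_var_nonneg share_sum share_nonneg)
  then have "0 \<le> (real n - 1) * (u \<bullet> (Vperp *v u))"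
    unfolding clt_array_variance using real_n by simp
  then show "0 \<le> u \<bullet> (Vperp *v u)" using real_n by (simp add: zero_le_mult_iff)
qed

end

lemma quad_form_le_entry_sum:
  fixes A :: "real^'n^'n"
  shows "v \<bullet> (A *v v) \<le> (\<Sum>i\<in>UNIV. \<Sum>j\<in>UNIV. \<bar>A $ i $ j\<bar>) * (norm v)\<^sup>2"
proof -
  have "v \<bullet> (A *v v) = (\<Sum>i\<in>UNIV. \<Sum>j\<in>UNIV. v $ i * (A $ i $ j * v $ j))"
    by (simp add: inner_vec_def matrix_vector_mult_def sum_distrib_left)
  also have "\<dots> \<le> (\<Sum>i\<in>UNIV. \<Sum>j\<in>UNIV. \<bar>A $ i $ j\<bar> * (norm v)\<^sup>2)"
  proof (intro sum_mono)
    fix i j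
    have "v $ i * (A $ i $ j * v $ j) \<le> \<bar>v $ i * (A $ i $ j * v $ j)\<bar>" by simp
    also have "\<dots> = \<bar>A $ i $ j\<bar> * (\<bar>v $ i\<bar> * \<bar>v $ j\<bar>)" by (simp add: abs_mult)
    also have "\<dots> \<le> \<bar>A $ i $ j\<bar> * (norm v * norm v)"
      by (intro mult_left_mono mult_mono component_le_norm_cart) auto
    finally show "v $ i * (A $ i $ j * v $ j) \<le> \<bar>A $ i $ j\<bar> * (norm v)\<^sup>2" by (simp add: power2_eq_square)
  qed
  finally show ?thesis by (simp add: sum_distrib_right)
qed

lemma psd_cauchy_schwarz:
  fixes A :: "real^'n^'n"
  assumes sym: "transpose A = A" and pos: "\<And>v. 0 \<le> v \<bullet> (A *v v)"
  shows "(v \<bullet> (A *v w))\<^sup>2 \<le> (v \<bullet> (A *v v)) * (w \<bullet> (A *v w))"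
proof -
  have p: "psd_mat A" using assms by (simp add: psd_mat_def)
  let ?R = "mat_sqrt A"
  have symR: "transpose ?R = ?R" using mat_sqrt(1)[OF p] by (simp add: psd_mat_def)
  have "v \<bullet> (A *v w) = (?R *v v) \<bullet> (?R *v w)"
    using mat_sqrt(2)[OF p] symmetric_dot[OF symR, of v "?R *v w"] by (simp add: matrix_vector_mul_assoc)
  then show ?thesis
    using Cauchy_Schwarz_ineq[of "?R *v v" "?R *v w"] norm_mat_sqrt_sq[OF p, of v] norm_mat_sqrt_sq[OF p, of w]
    by (simp add: dot_square_norm)
qed

context factorial_population begin

lemma sum_over_groups: "(\<Sum>q\<in>UNIV. \<Sum>i | i < n \<and> z i = q. h i q) = (\<Sum>i<n. h i (z i))"
  for z :: "nat \<Rightarrow> 'q" and h :: "nat \<Rightarrow> 'q \<Rightarrow> real"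
proof -
  have "(\<Sum>i<n. h i (z i)) = (\<Sum>q\<in>UNIV. \<Sum>i | i < n \<and> z i = q. h i (z i))"
    by (subst sum.group[where g=z and S="{..<n}" and T=UNIV, symmetric]) (auto intro!: sum.cong)
  also have "\<dots> = (\<Sum>q\<in>UNIV. \<Sum>i | i < n \<and> z i = q. h i q)"
    by (intro sum.cong refl) auto
  finally show ?thesis by simp
qed

lemma sum_label_const:
  assumes "z \<in> assignments n nq"
  shows "(\<Sum>i<n. g (z i) / real (nq (z i))) = (\<Sum>q\<in>UNIV. g q)"
proof -
  have "card {i. i < n \<and> z i = q} = nq q" for q using assms by (auto simp: assignments_def)
  then show ?thesis unfolding sum_by_label[of "\<lambda>q. g q / real (nq q)"]
    using real_nq by (intro sum.cong refl) (simp add: less_imp_neq[symmetric])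
qed

lemma tau_hat_inner: "u \<bullet> tau_hat iota eff n nq Y z = (\<Sum>i<n. weight u (z i) * Y i (z i) / real (nq (z i)))"
proof -
  have "u \<bullet> tau_hat iota eff n nq Y z = (\<Sum>q\<in>UNIV. weight u q * grp_mean n nq z (\<lambda>i. Y i (z i)) q)"
    by (simp add: tau_hat_def weight_def inner_sum_right sum_divide_distrib mult_ac)
  also have "\<dots> = (\<Sum>q\<in>UNIV. \<Sum>i | i < n \<and> z i = q. weight u q * Y i (z i) / real (nq q))"
    by (simp add: grp_mean_def sum_distrib_left mult_ac)
  also have "\<dots> = (\<Sum>i<n. weight u (z i) * Y i (z i) / real (nq (z i)))"
    by (rule sum_over_groups[where z=z and h="\<lambda>i q. weight u q * Y i (z i) / real (nq q)"])
  finally show ?thesis .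
qed

lemma tau_pop_inner: "u \<bullet> tau_pop iota eff n Y = (\<Sum>q\<in>UNIV. weight u q * pmean n (\<lambda>i. Y i q))"
  by (simp add: tau_pop_def weight_def inner_sum_right sum_divide_distrib mult_ac)

lemma tau_hat_error:
  assumes z: "z \<in> assignments n nq"
  shows "u \<bullet> tauerr z =
    (\<Sum>i<n. weight u (z i) * (resid i (z i) + slope (z i) \<bullet> xc i) / real (nq (z i)))"
proof -
  have "u \<bullet> tauerr z =
    (\<Sum>i<n. weight u (z i) * Y i (z i) / real (nq (z i))) - (\<Sum>i<n. weight u (z i) * pmean n (\<lambda>j. Y j (z i)) / real (nq (z i)))"
    unfolding inner_diff_right tau_hat_inner tau_pop_inner
    by (simp add: sum_label_const[OF z, of "\<lambda>q. weight u q * pmean n (\<lambda>j. Y j q)"])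
  also have "\<dots> = (\<Sum>i<n. weight u (z i) * (Y i (z i) - pmean n (\<lambda>j. Y j (z i))) / real (nq (z i)))"
    by (simp add: sum_subtractf[symmetric] right_diff_distrib diff_divide_distrib)
  finally show ?thesis by (simp add: resid_eq)
qed

lemma tau_hat_x_sum:
  assumes z: "z \<in> assignments n nq"
  shows "y \<bullet> tauhx z = (\<Sum>i<n. (xweight y (z i) \<bullet> xc i) / real (nq (z i)))"
proof -
  have "y \<bullet> tauhx z = (\<Sum>q\<in>UNIV. \<Sum>i | i < n \<and> z i = q. (xweight y q \<bullet> x i) / real (nq q))"
    unfolding tau_hat_x_inner by (simp add: grp_mean_def inner_sum_right sum_divide_distrib)
  also have "\<dots> = (\<Sum>i<n. (xweight y (z i) \<bullet> x i) / real (nq (z i)))"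
    by (rule sum_over_groups[where z=z and h="\<lambda>i q. (xweight y q \<bullet> x i) / real (nq q)"])
  also have "\<dots> = (\<Sum>i<n. (xweight y (z i) \<bullet> xc i) / real (nq (z i))) + (\<Sum>i<n. (xweight y (z i) \<bullet> pmean n x) / real (nq (z i)))"
    by (simp add: xc_def sum.distrib[symmetric] inner_diff_right diff_divide_distrib)
  also have "(\<Sum>i<n. (xweight y (z i) \<bullet> pmean n x) / real (nq (z i))) = 0"
    unfolding sum_label_const[OF z, of "\<lambda>q. xweight y q \<bullet> pmean n x"] inner_sum_left[symmetric] sum_xweight by simp
  finally show ?thesis by simp
qed

text \<open>The regression part of the estimation error is a linear function of \<open>tau_hat_x\<close>, because the
  group means of the covariates are determined by their contrasts and their overall mean. The shift
  by a multiple of \<open>nq q\<close> makes the coefficients sum to zero without changing the functional.\<close>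

lemma projection_coefficient:
  obtains y where
    "\<And>z. z \<in> assignments n nq \<Longrightarrow> u \<bullet> tauerr z =
       (\<Sum>i<n. weight u (z i) * resid i (z i) / real (nq (z i))) + y \<bullet> tauhx z"
    "y \<bullet> (Vx *v y) = u \<bullet> (Vpar *v u)"
proof -
  let ?S = "Sxx"
  define g where "g q = weight u q *\<^sub>R slope q" for q
  define G where "G = (\<Sum>q\<in>UNIV. g q)"
  define w where "w q = g q - (real (nq q) / real n) *\<^sub>R G" for q
  have "(\<Sum>q\<in>UNIV. w q) = G - (\<Sum>q\<in>UNIV. share q) *\<^sub>R G"
    by (simp add: w_def sum_subtractf G_def share_def scaleR_sum_left)
  then have "(\<Sum>q\<in>UNIV. w q) = 0" by (simp add: share_sum)
  then obtain y where y: "\<And>q. xweight y q = w q" using xweight_surj by blast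
  show thesis
  proof
    fix z assume z: "z \<in> assignments n nq"
    have "y \<bullet> tauhx z = (\<Sum>i<n. weight u (z i) * (slope (z i) \<bullet> xc i) / real (nq (z i)) - (G \<bullet> xc i) / real n)"
      unfolding tau_hat_x_sum[OF z] y w_def g_def
      using real_nq real_n by (intro sum.cong refl) (simp add: inner_diff_left diff_divide_distrib less_imp_neq[symmetric])
    also have "\<dots> = (\<Sum>i<n. weight u (z i) * (slope (z i) \<bullet> xc i) / real (nq (z i)))"
      unfolding sum_subtractf sum_divide_distrib[symmetric] sum_xc_inner by simp
    finally show "u \<bullet> tauerr z =
       (\<Sum>i<n. weight u (z i) * resid i (z i) / real (nq (z i))) + y \<bullet> tauhx z"
      unfolding tau_hat_error[OF z] by (simp add: sum.distrib[symmetric] distrib_left add_divide_distrib)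
  next
    have symS: "a \<bullet> (?S *v b) = b \<bullet> (?S *v a)" for a b unfolding Sxx_form by (simp add: mult.commute)
    have trm: "(w q \<bullet> (?S *v w q)) / real (nq q) = (g q \<bullet> (?S *v g q)) / real (nq q) - 2 * (g q \<bullet> (?S *v G)) / real n
        + share q * (G \<bullet> (?S *v G)) / real n" for q
    proof -
      have "w q \<bullet> (?S *v w q) = g q \<bullet> (?S *v g q) - 2 * share q * (g q \<bullet> (?S *v G)) + (share q)\<^sup>2 * (G \<bullet> (?S *v G))"
        unfolding w_def share_def[symmetric]
        by (simp add: matrix_vector_mult_diff_distrib matrix_vector_mult_scaleR inner_diff_left inner_diff_right symS[of G "g q"] power2_eq_square algebra_simps)
      then show ?thesis unfolding share_def using real_nq[of q] real_n by (simp add: field_simps power2_eq_square)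
    qed
    have "y \<bullet> (Vx *v y) = (\<Sum>q\<in>UNIV. (g q \<bullet> (?S *v g q)) / real (nq q)) - 2 * (\<Sum>q\<in>UNIV. g q \<bullet> (?S *v G)) / real n
        + (\<Sum>q\<in>UNIV. share q) * (G \<bullet> (?S *v G)) / real n"
      unfolding Vxx_form y trm
      by (simp add: sum.distrib sum_subtractf sum_divide_distrib sum_distrib_right sum_distrib_left)
    also have "(\<Sum>q\<in>UNIV. g q \<bullet> (?S *v G)) = G \<bullet> (?S *v G)" by (simp add: G_def inner_sum_left)
    finally have 1: "y \<bullet> (Vx *v y) = (\<Sum>q\<in>UNIV. (g q \<bullet> (?S *v g q)) / real (nq q)) - (G \<bullet> (?S *v G)) / real n"
      by (simp add: share_sum)
    have gg: "g q \<bullet> (?S *v g r) = weight u q * weight u r * pcov_par q r" for q r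
      unfolding g_def pcov_Ypar by (simp add: matrix_vector_mult_scaleR Sxx_slope)
    have GG: "G \<bullet> (?S *v G) = (\<Sum>q\<in>UNIV. \<Sum>r\<in>UNIV. g q \<bullet> (?S *v g r))"
    proof -
      have "?S *v G = (\<Sum>r\<in>UNIV. ?S *v g r)" unfolding G_def by (rule linear_sum[OF matrix_vector_mul_linear])
      then show ?thesis by (simp add: G_def inner_sum_left inner_sum_right) (rule sum.swap)
    qed
    show "y \<bullet> (Vx *v y) = u \<bullet> (Vpar *v u)"
      unfolding 1 GG gg Vmat_form ..
  qed
qed

lemma clt_array_sum:
  assumes z: "z \<in> assignments n nq"
    and y: "u \<bullet> tauerr z =
       (\<Sum>i<n. weight u (z i) * resid i (z i) / real (nq (z i))) + y \<bullet> tauhx z"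
  shows "(\<Sum>i<n. clt_array u (sqrt (real n) *\<^sub>R y + y') i (z i)) =
    u \<bullet> (sqrt (real n) *\<^sub>R (tau_hat iota eff n nq Y z - tau_pop iota eff n Y)) + y' \<bullet> tauhx z"
proof -
  let ?Y = "sqrt (real n) *\<^sub>R y + y'"
  have "(\<Sum>i<n. clt_array u ?Y i (z i)) = sqrt (real n) * (\<Sum>i<n. weight u (z i) * resid i (z i) / real (nq (z i))) + ?Y \<bullet> tauhx z"
    unfolding tau_hat_x_sum[OF z, of ?Y] clt_array_def
    by (simp add: add_divide_distrib sum.distrib sum_distrib_left mult.assoc)
  also have "\<dots> = sqrt (real n) * (u \<bullet> tauerr z) + y' \<bullet> tauhx z"
    unfolding y by (simp add: inner_add_left distrib_left)
  finally show ?thesis by simp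
qed

lemma pcov_Yperp_nonneg: "0 \<le> pcov_perp q q"
proof -
  have "0 \<le> (real n - 1) * pcov_perp q q"
    unfolding sum_resid_sq[symmetric] by (intro sum_nonneg) auto
  then show ?thesis using real_n by (simp add: zero_le_mult_iff)
qed

lemma clt_array_sq_le:
  "(\<Sum>i<n. \<Sum>q\<in>UNIV. (clt_array u y i q)\<^sup>2) \<le>
    (\<Sum>q\<in>UNIV. (1 / share q)\<^sup>2 * (weight u q)\<^sup>2 * pcov_perp q q
       + (1 / share q) * (y \<bullet> (Vx *v y)))"
proof -
  have "(\<Sum>i<n. \<Sum>q\<in>UNIV. (clt_array u y i q)\<^sup>2) = (\<Sum>q\<in>UNIV. \<Sum>i<n. (clt_array u y i q)\<^sup>2)" by (rule sum.swap)
  also have "\<dots> \<le> (\<Sum>q\<in>UNIV. (1 / share q)\<^sup>2 * (weight u q)\<^sup>2 * pcov_perp q q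
       + (1 / share q) * (y \<bullet> (Vx *v y)))"
  proof (rule sum_mono)
    fix q
    let ?P = "pcov_perp q q"
    let ?W = "xweight y q \<bullet> (Sxx *v xweight y q)"
    have "(\<Sum>i<n. (clt_array u y i q)\<^sup>2) \<le> real n * (real n * (weight u q)\<^sup>2 * ?P + ?W) / (real (nq q))\<^sup>2"
      unfolding sum_clt_array_sq
      by (intro divide_right_mono mult_right_mono add_nonneg_nonneg mult_nonneg_nonneg pcov_Yperp_nonneg Sxx_nonneg) auto
    also have "\<dots> = (1 / share q)\<^sup>2 * (weight u q)\<^sup>2 * ?P + (1 / share q) * (?W / real (nq q))"
      unfolding share_def using real_nq[of q] real_n by (simp add: field_simps power2_eq_square)
    also have "\<dots> \<le> (1 / share q)\<^sup>2 * (weight u q)\<^sup>2 * ?P + (1 / share q) * (y \<bullet> (Vx *v y))"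
      using share_nonneg[of q] by (intro add_left_mono mult_left_mono Vxx_term_le) auto
    finally show "(\<Sum>i<n. (clt_array u y i q)\<^sup>2) \<le> (1 / share q)\<^sup>2 * (weight u q)\<^sup>2 * ?P + (1 / share q) * (y \<bullet> (Vx *v y))" .
  qed
  finally show ?thesis .
qed

definition Ymax :: "'q \<Rightarrow> real" where
  "Ymax q = Max ((\<lambda>i. (Y i q - pmean n (\<lambda>j. Y j q))\<^sup>2) ` {..<n}) / real n"

definition xmax :: real where
  "xmax = Max ((\<lambda>i. (norm (x i - pmean n x))\<^sup>2) ` {..<n}) / real n"

definition inv_bound :: real where
  "inv_bound = (\<Sum>i\<in>UNIV. \<Sum>j\<in>UNIV. \<bar>matrix_inv (Sxx) $ i $ j\<bar>)"

lemma Y_le_Ymax: "i < n \<Longrightarrow> \<bar>Y i q - pmean n (\<lambda>j. Y j q)\<bar> \<le> sqrt (real n) * sqrt (Ymax q)"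
proof -
  assume i: "i < n"
  have "(Y i q - pmean n (\<lambda>j. Y j q))\<^sup>2 \<le> real n * Ymax q"
    unfolding Ymax_def using i real_n by (auto intro!: Max_ge)
  then have "sqrt ((Y i q - pmean n (\<lambda>j. Y j q))\<^sup>2) \<le> sqrt (real n * Ymax q)" by (rule real_sqrt_le_mono)
  then show ?thesis by (simp add: real_sqrt_mult)
qed

lemma xc_le_xmax: "i < n \<Longrightarrow> norm (xc i) \<le> sqrt (real n) * sqrt xmax"
proof -
  assume i: "i < n"
  have "(norm (xc i))\<^sup>2 \<le> real n * xmax"
    unfolding xmax_def xc_def using i real_n by (auto intro!: Max_ge)
  then have "sqrt ((norm (xc i))\<^sup>2) \<le> sqrt (real n * xmax)" by (rule real_sqrt_le_mono)
  then show ?thesis by (simp add: real_sqrt_mult)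
qed

lemma xweight_xc_bound:
  assumes i: "i < n"
  shows "\<bar>xweight y q \<bullet> xc i\<bar> / real (nq q) \<le> sqrt (y \<bullet> (Vx *v y)) * sqrt inv_bound * sqrt (1 / share q) * sqrt xmax"
proof -
  let ?S = "Sxx" and ?w = "xweight y q"
  let ?V = "y \<bullet> (Vx *v y)"
  define t where "t = matrix_inv ?S *v xc i"
  have St: "?S *v t = xc i" unfolding t_def using matrix_inv_mult(1)[OF S_inv] by (simp add: matrix_vector_mul_assoc)
  have "(?w \<bullet> xc i)\<^sup>2 \<le> (?w \<bullet> (?S *v ?w)) * (t \<bullet> (?S *v t))"
    using psd_cauchy_schwarz[OF pcov_mat_symmetric Sxx_nonneg, of ?w t] by (simp add: St)
  also have "t \<bullet> (?S *v t) = xc i \<bullet> (matrix_inv ?S *v xc i)" unfolding St by (simp add: t_def inner_commute)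
  also have "(?w \<bullet> (?S *v ?w)) * (xc i \<bullet> (matrix_inv ?S *v xc i)) \<le> (real (nq q) * ?V) * (inv_bound * (real n * xmax))"
  proof (rule mult_mono)
    show "?w \<bullet> (?S *v ?w) \<le> real (nq q) * ?V" using Vxx_term_le[of y q] real_nq[of q] by (simp add: field_simps)
    have "(norm (xc i))\<^sup>2 \<le> real n * xmax"
      unfolding xmax_def xc_def using i real_n by (auto intro!: Max_ge)
    moreover have "inv_bound \<ge> 0" unfolding inv_bound_def by (intro sum_nonneg) auto
    ultimately have "inv_bound * (norm (xc i))\<^sup>2 \<le> inv_bound * (real n * xmax)" by (rule mult_left_mono)
    then show "xc i \<bullet> (matrix_inv ?S *v xc i) \<le> inv_bound * (real n * xmax)"
      using quad_form_le_entry_sum[of "xc i" "matrix_inv ?S"] unfolding inv_bound_def by linarith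
    have V0: "0 \<le> ?V" using Vxx_psd by (simp add: psd_mat_def)
    then show "0 \<le> real (nq q) * ?V" by simp
    show "0 \<le> xc i \<bullet> (matrix_inv ?S *v xc i)"
      using Sxx_nonneg[of t] unfolding St by (simp add: t_def inner_commute)
  qed
  finally have "\<bar>?w \<bullet> xc i\<bar> \<le> sqrt ((real (nq q) * ?V) * (inv_bound * (real n * xmax)))"
    by (metis real_sqrt_abs real_sqrt_le_mono)
  then have "\<bar>?w \<bullet> xc i\<bar> / real (nq q) \<le> sqrt ((real (nq q) * ?V) * (inv_bound * (real n * xmax))) / sqrt ((real (nq q))\<^sup>2)"
    using real_nq[of q] by (simp add: divide_right_mono)
  also have "\<dots> = sqrt (((real (nq q) * ?V) * (inv_bound * (real n * xmax))) / (real (nq q))\<^sup>2)"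
    by (simp only: real_sqrt_divide)
  also have "((real (nq q) * ?V) * (inv_bound * (real n * xmax))) / (real (nq q))\<^sup>2 = ?V * inv_bound * (1 / share q) * xmax"
    unfolding share_def using real_nq[of q] real_n by (simp add: field_simps power2_eq_square)
  finally show ?thesis by (simp only: real_sqrt_mult)
qed

definition clt_bound :: "real^'f \<Rightarrow> real^('f \<times> 'l) \<Rightarrow> real" where
  "clt_bound u y = (\<Sum>q\<in>UNIV. (1 / share q) * \<bar>weight u q\<bar> * (sqrt (Ymax q) + norm (slope q) * sqrt xmax) +
     sqrt (y \<bullet> (Vx *v y)) * sqrt inv_bound * sqrt (1 / share q) * sqrt xmax)"

lemma clt_array_bound:
  assumes i: "i < n"
  shows "\<bar>clt_array u y i q\<bar> \<le> clt_bound u y"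
proof -
  let ?b = "\<lambda>q. (1 / share q) * \<bar>weight u q\<bar> * (sqrt (Ymax q) + norm (slope q) * sqrt xmax) +
     sqrt (y \<bullet> (Vx *v y)) * sqrt inv_bound * sqrt (1 / share q) * sqrt xmax"
  have le: "\<bar>clt_array u y i q\<bar> \<le> ?b q" for q
  proof -
    have r: "\<bar>resid i q\<bar> \<le> sqrt (real n) * (sqrt (Ymax q) + norm (slope q) * sqrt xmax)"
    proof -
      have "\<bar>resid i q\<bar> \<le> \<bar>Y i q - pmean n (\<lambda>j. Y j q)\<bar> + \<bar>slope q \<bullet> xc i\<bar>" unfolding resid_eq by (rule abs_triangle_ineq4)
      also have "\<bar>slope q \<bullet> xc i\<bar> \<le> norm (slope q) * norm (xc i)" by (rule Cauchy_Schwarz_ineq2)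
      also have "\<dots> \<le> norm (slope q) * (sqrt (real n) * sqrt xmax)" by (intro mult_left_mono xc_le_xmax[OF i]) auto
      finally show ?thesis using Y_le_Ymax[OF i, of q] by (simp add: algebra_simps)
    qed
    have "\<bar>clt_array u y i q\<bar> \<le> \<bar>sqrt (real n) * weight u q * resid i q\<bar> / real (nq q) + \<bar>xweight y q \<bullet> xc i\<bar> / real (nq q)"
      unfolding clt_array_def using real_nq[of q] by (simp add: add_divide_distrib[symmetric] divide_right_mono)
    also have "\<bar>sqrt (real n) * weight u q * resid i q\<bar> / real (nq q) = sqrt (real n) * \<bar>weight u q\<bar> * \<bar>resid i q\<bar> / real (nq q)"
      by (simp add: abs_mult)
    also have "\<dots> \<le> sqrt (real n) * \<bar>weight u q\<bar> * (sqrt (real n) * (sqrt (Ymax q) + norm (slope q) * sqrt xmax)) / real (nq q)"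
      using r by (intro divide_right_mono mult_left_mono) auto
    also have "\<dots> = (1 / share q) * \<bar>weight u q\<bar> * (sqrt (Ymax q) + norm (slope q) * sqrt xmax)"
    proof -
      have "sqrt (real n) * w * (sqrt (real n) * t) = (sqrt (real n) * sqrt (real n)) * w * t" for w t :: real
        by (simp only: mult_ac)
      then show ?thesis unfolding share_def by simp
    qed
    finally show ?thesis using xweight_xc_bound[OF i, of y q] by simp
  qed
  have "?b q \<le> (\<Sum>q\<in>UNIV. ?b q)"
    by (rule member_le_sum[OF UNIV_I order_trans[OF abs_ge_zero le] finite])
  then show ?thesis unfolding clt_bound_def using le[of q] by linarith
qed

end

section \<open>Rerandomization limit\<close>

lemma integral_uniform_measure:
  fixes f :: "'a \<Rightarrow> complex"
  assumes M: "prob_space M" and A [measurable]: "A \<in> sets M" and pos: "measure M A > 0"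
    and [measurable]: "f \<in> borel_measurable M"
  shows "integral\<^sup>L (uniform_measure M A) f = (\<integral>x. f x * indicator A x \<partial>M) / of_real (measure M A)"
proof -
  interpret M: prob_space M by fact
  have "uniform_measure M A = density M (\<lambda>x. ennreal (indicator A x / measure M A))"
    unfolding uniform_measure_def M.emeasure_eq_measure
    using pos by (intro density_cong) (auto simp: divide_ennreal indicator_def simp flip: ennreal_1)
  then have "integral\<^sup>L (uniform_measure M A) f = (\<integral>x. (indicator A x / measure M A) *\<^sub>R f x \<partial>M)"
    by (simp add: integral_density)
  also have "\<dots> = (\<integral>x. (f x * indicator A x) / of_real (measure M A) \<partial>M)"
    by (intro Bochner_Integration.integral_cong refl) (auto simp: indicator_def scaleR_conv_of_real)
  finally show ?thesis by simp
qed

lemma measurable_matrix_vector_mult [measurable (raw)]: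
  fixes A :: "real^'b^'c"
  assumes "f \<in> borel_measurable M"
  shows "(\<lambda>x. A *v f x) \<in> borel_measurable M"
proof -
  have "(*v) A \<in> borel_measurable borel"
    by (intro borel_measurable_continuous_onI linear_continuous_on matrix_vector_mul_bounded_linear)
  then show ?thesis using assms by (rule measurable_compose[rotated])
qed

lemma trunc_gauss_eq: "trunc_gauss a = uniform_measure (std_gauss :: (real^'d) measure) {d. (norm d)\<^sup>2 \<le> a}"
  by (simp add: trunc_gauss_def power2_norm_eq_inner)

lemma sets_trunc_gauss [measurable_cong, simp]: "sets (trunc_gauss a :: (real^'d) measure) = sets borel"
  by (simp add: trunc_gauss_def)

lemma space_trunc_gauss [simp]: "space (trunc_gauss a :: (real^'d) measure) = UNIV"
  by (simp add: trunc_gauss_def)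

lemma prob_space_trunc_gauss:
  assumes "a > 0"
  shows "prob_space (trunc_gauss a :: (real^'d) measure)"
  unfolding trunc_gauss_eq
proof (rule prob_space_uniform_measure)
  show "emeasure (std_gauss :: (real^'d) measure) {d. (norm d)\<^sup>2 \<le> a} \<noteq> 0"
    using std_gauss_ball_pos[OF assms, where 'd='d] by (simp add: std_gauss.emeasure_eq_measure)
  show "emeasure (std_gauss :: (real^'d) measure) {d. (norm d)\<^sup>2 \<le> a} \<noteq> \<infinity>"
    by (simp add: std_gauss.emeasure_eq_measure)
qed

lemma char_trunc_gauss:
  fixes w :: "real^'d"
  assumes a: "a > 0"
  shows "(\<integral>d. iexp (w \<bullet> d) \<partial>trunc_gauss a) = ball_char a w / ball_char a (0::real^'d)"
  unfolding trunc_gauss_eq ball_char_0 unfolding ball_char_def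
  by (rule integral_uniform_measure[OF prob_space_std_gauss _ std_gauss_ball_pos[OF a]]) measurable

lemma char_gauss_plus_trunc:
  fixes R :: "real^'g^'f" and C :: "real^'d^'f"
  assumes a: "a > 0"
  shows "(\<integral>y. iexp (v \<bullet> y) \<partial>distr ((std_gauss :: (real^'g) measure) \<Otimes>\<^sub>M (trunc_gauss a :: (real^'d) measure)) borel
       (\<lambda>(e, d). s *\<^sub>R (R *v e + C *v d))) =
    of_real (exp (- (s\<^sup>2 * (norm (v v* R))\<^sup>2) / 2)) * (ball_char a (s *\<^sub>R (v v* C)) / ball_char a (0::real^'d))"
proof -
  let ?P = "(std_gauss :: (real^'g) measure) \<Otimes>\<^sub>M (trunc_gauss a :: (real^'d) measure)"
  interpret T: prob_space "trunc_gauss a :: (real^'d) measure" by (rule prob_space_trunc_gauss[OF a])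
  interpret PP: pair_prob_space "std_gauss :: (real^'g) measure" "trunc_gauss a :: (real^'d) measure" ..
  let ?r = "s *\<^sub>R (v v* R)" and ?c = "s *\<^sub>R (v v* C)"
  have eq: "v \<bullet> (s *\<^sub>R (R *v e + C *v d)) = ?r \<bullet> e + ?c \<bullet> d" for e d
    by (simp add: inner_add_right dot_lmul_matrix distrib_left)
  have int: "integrable ?P (\<lambda>p. iexp (?r \<bullet> fst p) * iexp (?c \<bullet> snd p))"
  proof (rule PP.integrable_const_bound[where B=1])
    show "AE p in ?P. norm (iexp (?r \<bullet> fst p) * iexp (?c \<bullet> snd p)) \<le> 1"
      unfolding norm_mult norm_exp_i_times by simp
  qed measurable
  have "(\<integral>y. iexp (v \<bullet> y) \<partial>distr ?P borel (\<lambda>(e, d). s *\<^sub>R (R *v e + C *v d))) =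
     (\<integral>p. iexp (v \<bullet> (case p of (e, d) \<Rightarrow> s *\<^sub>R (R *v e + C *v d))) \<partial>?P)"
    by (rule integral_distr) measurable
  also have "\<dots> = (\<integral>p. iexp (?r \<bullet> fst p) * iexp (?c \<bullet> snd p) \<partial>?P)"
    unfolding split_beta eq of_real_add distrib_left exp_add ..
  also have "\<dots> = (\<integral>e. (\<integral>d. iexp (?r \<bullet> e) * iexp (?c \<bullet> d) \<partial>trunc_gauss a) \<partial>std_gauss)"
    using PP.integral_fst'[OF int] by simp
  also have "\<dots> = (\<integral>e. iexp (?r \<bullet> e) \<partial>std_gauss) * (\<integral>d. iexp (?c \<bullet> d) \<partial>trunc_gauss a)"
    by simp
  also have "\<dots> = of_real (exp (- (norm ?r)\<^sup>2 / 2)) * (ball_char a ?c / ball_char a (0::real^'d))"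
    unfolding char_std_gauss char_trunc_gauss[OF a] ..
  finally show ?thesis by (simp add: power_mult_distrib)
qed

locale factorial_sequence =
  fixes iota :: "'q::finite \<Rightarrow> 'k::finite \<Rightarrow> real"
    and eff :: "'f::finite \<Rightarrow> 'k set"
    and n :: "nat \<Rightarrow> nat"
    and nq :: "nat \<Rightarrow> 'q \<Rightarrow> nat"
    and Y :: "nat \<Rightarrow> nat \<Rightarrow> 'q \<Rightarrow> real"
    and x :: "nat \<Rightarrow> nat \<Rightarrow> real^'l::finite"
  assumes design: "valid_design iota eff"
    and nq_pos: "\<And>m q. 1 \<le> nq m q"
    and nq_sum: "\<And>m. (\<Sum>q\<in>UNIV. nq m q) = n m"
    and n_lim: "filterlim n at_top sequentially"
    and share_lim: "\<And>q. \<exists>c>0. (\<lambda>m. real (nq m q) / real (n m)) \<longlonglongrightarrow> c"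
    and Y_cov_lim: "\<And>q k. convergent (\<lambda>m. pcov (n m) (\<lambda>i. Y m i q) (\<lambda>i. Y m i k))"
    and Sxx_inv: "\<And>m. invertible (pcov_mat (n m) (x m))"
    and Sxx_lim: "\<exists>Sl. (\<lambda>m. pcov_mat (n m) (x m)) \<longlonglongrightarrow> Sl \<and> invertible Sl"
    and Yx_cov_lim: "\<And>q. convergent (\<lambda>m. pcov_sv (n m) (\<lambda>i. Y m i q) (x m))"
    and Y_max_lim: "\<And>q. (\<lambda>m. Max ((\<lambda>i. (Y m i q - pmean (n m) (\<lambda>j. Y m j q))\<^sup>2) ` {..<n m}) / real (n m)) \<longlonglongrightarrow> 0"
    and x_max_lim: "(\<lambda>m. Max ((\<lambda>i. (norm (x m i - pmean (n m) (x m)))\<^sup>2) ` {..<n m}) / real (n m)) \<longlonglongrightarrow> 0"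
begin

sublocale P: factorial_population iota eff "n m" "nq m" "Y m" "x m" for m
  using nq_pos by unfold_locales (auto simp: design nq_sum Sxx_inv)

definition lshare :: "'q \<Rightarrow> real" where "lshare q = lim (\<lambda>m. P.share m q)"

lemma lshare: "lshare q > 0" "(\<lambda>m. P.share m q) \<longlonglongrightarrow> lshare q"
proof -
  obtain c where c: "c > 0" "(\<lambda>m. P.share m q) \<longlonglongrightarrow> c" using share_lim[of q] unfolding P.share_def by blast
  then have "lshare q = c" unfolding lshare_def by (simp add: limI)
  then show "lshare q > 0" "(\<lambda>m. P.share m q) \<longlonglongrightarrow> lshare q" using c by auto
qed

lemma Sinv_convergent: "\<exists>L. (\<lambda>m. matrix_inv (pcov_mat (n m) (x m))) \<longlonglongrightarrow> L"
  using Sxx_lim matrix_inv_tendsto[of "\<lambda>m. pcov_mat (n m) (x m)", OF _ Sxx_inv] by blast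

lemma slope_convergent: "convergent (\<lambda>m. P.slope m q)"
proof -
  obtain L where L: "(\<lambda>m. matrix_inv (pcov_mat (n m) (x m))) \<longlonglongrightarrow> L" using Sinv_convergent by blast
  obtain s where s: "(\<lambda>m. pcov_sv (n m) (\<lambda>i. Y m i q) (x m)) \<longlonglongrightarrow> s" using Yx_cov_lim by (auto simp: convergent_def)
  have "(\<lambda>m. P.slope m q) \<longlonglongrightarrow> s v* L"
    unfolding P.slope_def
    by (intro vec_tendstoI)
       (simp add: vector_matrix_mult_def, intro tendsto_sum tendsto_mult tendsto_vec_nth L s)
  then show ?thesis by (auto simp: convergent_def)
qed

lemma Ypar_cov_convergent: "convergent (\<lambda>m. P.pcov_par m q r)"
proof -
  obtain s t where "(\<lambda>m. P.slope m q) \<longlonglongrightarrow> s" "(\<lambda>m. pcov_sv (n m) (\<lambda>i. Y m i r) (x m)) \<longlonglongrightarrow> t"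
    using slope_convergent[of q] Yx_cov_lim[of r] unfolding convergent_def by blast
  then have "(\<lambda>m. P.slope m q \<bullet> pcov_sv (n m) (\<lambda>i. Y m i r) (x m)) \<longlonglongrightarrow> s \<bullet> t" by (rule tendsto_inner)
  then show ?thesis unfolding P.pcov_Ypar by (auto simp: convergent_def)
qed

lemma Yperp_cov_convergent: "convergent (\<lambda>m. P.pcov_perp m q r)"
  unfolding P.pcov_Yperp
  by (intro convergent_diff Y_cov_lim Ypar_cov_convergent[unfolded P.pcov_Ypar])

lemma Vmat_limit:
  assumes conv: "\<And>q r. convergent (\<lambda>m. pcov (n m) (\<lambda>i. Z m i q) (\<lambda>i. Z m i r))"
    and pos: "\<And>m u. 0 \<le> u \<bullet> (Vmat iota eff (n m) (nq m) (Z m) *v u)"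
  obtains V where "psd_mat V" "\<And>u. (\<lambda>m. real (n m) * (u \<bullet> (Vmat iota eff (n m) (nq m) (Z m) *v u))) \<longlonglongrightarrow> u \<bullet> (V *v u)"
proof -
  let ?V = "\<lambda>m. Vmat iota eff (n m) (nq m) (Z m)"
  obtain L where L: "\<And>q r. (\<lambda>m. pcov (n m) (\<lambda>i. Z m i q) (\<lambda>i. Z m i r)) \<longlonglongrightarrow> L q r"
    using conv unfolding convergent_def by metis
  define F where "F u v = (\<Sum>q\<in>UNIV. P.weight u q * P.weight v q * L q q / lshare q) - (\<Sum>q\<in>UNIV. \<Sum>r\<in>UNIV. P.weight u q * P.weight v r * L q r)" for u v
  have lim: "(\<lambda>m. real (n m) * (u \<bullet> (?V m *v v))) \<longlonglongrightarrow> F u v" for u v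
  proof -
    have "(\<lambda>m. (\<Sum>q\<in>UNIV. P.weight u q * P.weight v q * pcov (n m) (\<lambda>i. Z m i q) (\<lambda>i. Z m i q) / P.share m q)
       - (\<Sum>q\<in>UNIV. \<Sum>r\<in>UNIV. P.weight u q * P.weight v r * pcov (n m) (\<lambda>i. Z m i q) (\<lambda>i. Z m i r))) \<longlonglongrightarrow> F u v"
      unfolding F_def using lshare(1)
      by (intro tendsto_diff tendsto_sum tendsto_divide tendsto_mult tendsto_const L lshare(2)) (simp add: less_imp_neq[symmetric])
    moreover have "real (n m) * (u \<bullet> (?V m *v v)) = (\<Sum>q\<in>UNIV. P.weight u q * P.weight v q * pcov (n m) (\<lambda>i. Z m i q) (\<lambda>i. Z m i q) / P.share m q)
       - (\<Sum>q\<in>UNIV. \<Sum>r\<in>UNIV. P.weight u q * P.weight v r * pcov (n m) (\<lambda>i. Z m i q) (\<lambda>i. Z m i r))" for m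
    proof -
      have "real (n m) * (\<Sum>q\<in>UNIV. t q / real (nq m q)) = (\<Sum>q\<in>UNIV. t q / P.share m q)" for t
        by (simp add: sum_distrib_left P.share_def mult_ac)
      then show ?thesis unfolding P.Vmat_form right_diff_distrib using P.real_n[of m] by simp
    qed
    ultimately show ?thesis by simp
  qed
  define V :: "real^'f^'f" where "V = (\<chi> f g. F (axis f 1) (axis g 1))"
  have entry: "(\<lambda>m. (real (n m) *\<^sub>R ?V m) $ f $ g) \<longlonglongrightarrow> V $ f $ g" for f g
  proof -
    have "(real (n m) *\<^sub>R ?V m) $ f $ g = real (n m) * (axis f 1 \<bullet> (?V m *v axis g 1))" for m
      by (simp add: inner_axis' matrix_vector_mult_basis column_def)
    then show ?thesis using lim[of "axis f 1" "axis g 1"] by (simp only: V_def vec_lambda_beta)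
  qed
  have form: "(\<lambda>m. real (n m) * (u \<bullet> (?V m *v u))) \<longlonglongrightarrow> u \<bullet> (V *v u)" for u
  proof -
    have "(\<lambda>m. \<Sum>i\<in>UNIV. u $ i * (\<Sum>j\<in>UNIV. (real (n m) *\<^sub>R ?V m) $ i $ j * u $ j)) \<longlonglongrightarrow> (\<Sum>i\<in>UNIV. u $ i * (\<Sum>j\<in>UNIV. V $ i $ j * u $ j))"
      by (intro tendsto_sum tendsto_mult tendsto_const entry)
    then have "(\<lambda>m. u \<bullet> ((real (n m) *\<^sub>R ?V m) *v u)) \<longlonglongrightarrow> u \<bullet> (V *v u)"
      by (simp add: inner_vec_def matrix_vector_mult_def)
    then show ?thesis by (simp add: scaleR_matrix_mult)
  qed
  have "psd_mat V" unfolding psd_mat_def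
  proof (intro conjI allI)
    have "V $ f $ g = V $ g $ f" for f g
    proof (rule LIMSEQ_unique[OF entry])
      have "?V m $ g $ f = ?V m $ f $ g" for m
        using P.Vmat_symmetric[of m "Z m"] by (simp add: transpose_def vec_eq_iff)
      then show "(\<lambda>m. (real (n m) *\<^sub>R ?V m) $ f $ g) \<longlonglongrightarrow> V $ g $ f" using entry[of g f] by simp
    qed
    then show "transpose V = V" by (simp add: transpose_def vec_eq_iff)
    show "0 \<le> u \<bullet> (V *v u)" for u
      by (rule LIMSEQ_le_const[OF form]) (auto intro!: exI mult_nonneg_nonneg pos)
  qed
  then show thesis using form that by blast
qed

lemma Vpar_nonneg: "0 \<le> u \<bullet> (P.Vpar m *v u)"
proof -
  obtain y where "y \<bullet> (P.Vx m *v y) = u \<bullet> (P.Vpar m *v u)"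
    using P.projection_coefficient[of m u] by metis
  then show ?thesis using P.Vxx_psd[of m] by (metis psd_mat_def)
qed

lemma crfe_clt:
  assumes V: "(\<lambda>m. real (n m) * (u \<bullet> (P.Vperp m *v u))) \<longlonglongrightarrow> v"
    and y: "(\<lambda>m. y m \<bullet> (P.Vx m *v y m)) \<longlonglongrightarrow> s"
  shows "(\<lambda>m. \<integral>z. iexp (\<Sum>i<n m. P.clt_array m u (y m) i (z i)) \<partial>measure_pmf (CRFE (n m) (nq m))) \<longlonglongrightarrow> of_real (exp (- (v + s) / 2))"
    and "\<forall>\<^sub>F m in sequentially. assignments (n m) (nq m) \<noteq> {}"
proof -
  let ?VV = "\<lambda>m. y m \<bullet> (P.Vx m *v y m)"
  have sh: "(\<lambda>m. real (nq m q) / real (n m)) \<longlonglongrightarrow> lshare q" for q using lshare(2)[of q] by (simp add: P.share_def)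
  have sh1: "(\<lambda>m. 1 / P.share m q) \<longlonglongrightarrow> 1 / lshare q" for q
    using lshare[of q] by (intro tendsto_divide tendsto_const) auto
  have ratio: "(\<lambda>m. (real (n m) - 1) / real (n m)) \<longlonglongrightarrow> 1"
  proof -
    have F: "filterlim (\<lambda>m. real (n m)) at_top sequentially"
      by (rule filterlim_compose[OF filterlim_real_sequentially n_lim])
    have "(\<lambda>m. 1 / real (n m)) \<longlonglongrightarrow> 0"
      by (rule tendsto_divide_0[OF tendsto_const filterlim_at_top_imp_at_infinity[OF F]])
    from tendsto_diff[OF tendsto_const[of 1] this] have "(\<lambda>m. 1 - 1 / real (n m)) \<longlonglongrightarrow> 1" by simp
    moreover have "(real (n m) - 1) / real (n m) = 1 - 1 / real (n m)" for m
      using P.real_n[of m] by (simp add: diff_divide_distrib)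
    ultimately show ?thesis by simp
  qed
  have "(\<lambda>m. (real (n m) - 1) / real (n m) * (real (n m) * (u \<bullet> (P.Vperp m *v u)) + ?VV m)) \<longlonglongrightarrow> 1 * (v + s)"
    by (intro tendsto_mult ratio tendsto_add V y)
  then have var: "(\<lambda>m. \<Sum>i<n m. lab_var (\<lambda>q. real (nq m q) / real (n m)) (P.clt_array m u (y m) i)) \<longlonglongrightarrow> v + s"
    unfolding P.clt_array_variance[symmetric] P.share_def by simp
  have "(\<lambda>m. P.clt_bound m u (y m)) \<longlonglongrightarrow> 0"
  proof -
    obtain L where L: "(\<lambda>m. matrix_inv (pcov_mat (n m) (x m))) \<longlonglongrightarrow> L" using Sinv_convergent by blast
    have ib: "(\<lambda>m. P.inv_bound m) \<longlonglongrightarrow> (\<Sum>i\<in>UNIV. \<Sum>j\<in>UNIV. \<bar>L $ i $ j\<bar>)"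
      unfolding P.inv_bound_def by (intro tendsto_sum tendsto_rabs tendsto_vec_nth L)
    have Ym: "(\<lambda>m. sqrt (P.Ymax m q)) \<longlonglongrightarrow> sqrt 0" for q
      unfolding P.Ymax_def by (intro tendsto_real_sqrt Y_max_lim)
    have xm: "(\<lambda>m. sqrt (P.xmax m)) \<longlonglongrightarrow> sqrt 0"
      unfolding P.xmax_def by (intro tendsto_real_sqrt x_max_lim)
    have "\<forall>q. \<exists>sl. (\<lambda>m. P.slope m q) \<longlonglongrightarrow> sl" using slope_convergent by (auto simp: convergent_def)
    from choice[OF this] obtain sl where sl: "\<And>q. (\<lambda>m. P.slope m q) \<longlonglongrightarrow> sl q" by blast
    have "(\<lambda>m. P.clt_bound m u (y m)) \<longlonglongrightarrow> (\<Sum>q\<in>UNIV. (1 / lshare q) * \<bar>P.weight u q\<bar> * (sqrt 0 + norm (sl q) * sqrt 0) +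
       sqrt s * sqrt (\<Sum>i\<in>UNIV. \<Sum>j\<in>UNIV. \<bar>L $ i $ j\<bar>) * sqrt (1 / lshare q) * sqrt 0)"
      unfolding P.clt_bound_def
      by (intro tendsto_sum tendsto_add tendsto_mult sh1 tendsto_const Ym tendsto_norm sl xm tendsto_real_sqrt y ib)
    then show ?thesis by simp
  qed
  note bound0 = this
  have "\<exists>B. \<forall>m. (\<Sum>i<n m. \<Sum>q\<in>UNIV. (P.clt_array m u (y m) i q)\<^sup>2) \<le> B"
  proof -
    have "\<forall>q. \<exists>L. (\<lambda>m. P.pcov_perp m q q) \<longlonglongrightarrow> L"
      by (intro allI Yperp_cov_convergent[unfolded convergent_def])
    from choice[OF this] obtain L where L: "\<And>q. (\<lambda>m. P.pcov_perp m q q) \<longlonglongrightarrow> L q"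
      by blast
    define h where "h m = (\<Sum>q\<in>UNIV. (1 / P.share m q)\<^sup>2 * (P.weight u q)\<^sup>2 * P.pcov_perp m q q
       + (1 / P.share m q) * ?VV m)" for m
    have "h \<longlonglongrightarrow> (\<Sum>q\<in>UNIV. (1 / lshare q)\<^sup>2 * (P.weight u q)\<^sup>2 * L q + (1 / lshare q) * s)"
      unfolding h_def by (intro tendsto_sum tendsto_add tendsto_mult tendsto_power sh1 tendsto_const L y)
    then have "Bseq h" by (intro convergent_imp_Bseq convergentI)
    then obtain K where K: "\<And>m. norm (h m) \<le> K" by (rule BseqE) blast
    have "(\<Sum>i<n m. \<Sum>q\<in>UNIV. (P.clt_array m u (y m) i q)\<^sup>2) \<le> K" for m
    proof -
      have "(\<Sum>i<n m. \<Sum>q\<in>UNIV. (P.clt_array m u (y m) i q)\<^sup>2) \<le> h m" unfolding h_def by (rule P.clt_array_sq_le)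
      also have "\<dots> \<le> K" using K[of m] by simp
      finally show ?thesis .
    qed
    then show ?thesis by blast
  qed
  then obtain B where B: "\<And>m. (\<Sum>i<n m. \<Sum>q\<in>UNIV. (P.clt_array m u (y m) i q)\<^sup>2) \<le> B" by blast
  show "(\<lambda>m. \<integral>z. iexp (\<Sum>i<n m. P.clt_array m u (y m) i (z i)) \<partial>measure_pmf (CRFE (n m) (nq m))) \<longlonglongrightarrow> of_real (exp (- (v + s) / 2))"
    by (rule combinatorial_clt(1)[OF nq_sum n_lim lshare(1) sh P.sum_clt_array P.clt_array_bound bound0 var B])
  show "\<forall>\<^sub>F m in sequentially. assignments (n m) (nq m) \<noteq> {}"
    by (rule combinatorial_clt(2)[OF nq_sum n_lim lshare(1) sh P.sum_clt_array P.clt_array_bound bound0 var B])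
qed

end

lemma integral_cond_pmf:
  fixes f :: "'a \<Rightarrow> complex"
  assumes "measure (measure_pmf p) A > 0"
  shows "integral\<^sup>L (measure_pmf (cond_pmf p A)) f = (\<integral>z. f z * indicator A z \<partial>measure_pmf p) / of_real (measure (measure_pmf p) A)"
proof -
  have "set_pmf p \<inter> A \<noteq> {}"
  proof
    assume "set_pmf p \<inter> A = {}"
    then have "measure (measure_pmf p) A = 0" by (simp add: measure_pmf_zero_iff)
    then show False using assms by simp
  qed
  then have "measure_pmf (cond_pmf p A) = uniform_measure (measure_pmf p) A" by (rule cond_pmf.rep_eq)
  then show ?thesis using integral_uniform_measure[OF measure_pmf.prob_space_axioms _ assms, of f] by simp
qed

lemma orthogonal_transformation_dot_inv:
  fixes T :: "real^'d \<Rightarrow> real^'d"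
  assumes T: "orthogonal_transformation T"
  shows "v \<bullet> T w = inv T v \<bullet> w" "norm (inv T v) = norm v"
proof -
  have "T (inv T v) = v" by (rule surj_f_inv_f[OF orthogonal_transformation_surj[OF T]])
  then have "v \<bullet> T w = T (inv T v) \<bullet> T w" by simp
  also have "\<dots> = inv T v \<bullet> w" using T by (simp add: orthogonal_transformation_def)
  finally show "v \<bullet> T w = inv T v \<bullet> w" .
  show "norm (inv T v) = norm v"
    using orthogonal_transformation_inv[OF T] by (simp add: orthogonal_transformation)
qed

lemma invertible_mat_sqrt:
  fixes A :: "real^'n^'n"
  assumes A: "psd_mat A" "invertible A"
  shows "invertible (mat_sqrt A)"
proof -
  have "det (mat_sqrt A) * det (mat_sqrt A) \<noteq> 0"
    using A(2) mat_sqrt(2)[OF A(1)] by (metis det_mul invertible_det_nz)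
  then show ?thesis by (simp add: invertible_det_nz)
qed

context factorial_population begin

definition whiten :: "real^('f \<times> 'l) \<Rightarrow> real^('f \<times> 'l)" where
  "whiten t = matrix_inv (mat_sqrt Vx) *v t"

lemma sqrt_whiten: "mat_sqrt Vx *v whiten t = t" "whiten (mat_sqrt Vx *v t) = t"
  unfolding whiten_def
  using matrix_inv_mult[OF invertible_mat_sqrt[OF Vxx_psd Vxx_invertible]]
  by (simp_all add: matrix_vector_mul_assoc)

lemma mat_sqrt_Vx_dot: "(mat_sqrt Vx *v s) \<bullet> t = s \<bullet> (mat_sqrt Vx *v t)"
  by (rule symmetric_dot) (use mat_sqrt(1)[OF Vxx_psd] in \<open>simp add: psd_mat_def\<close>)

lemma whiten_dot: "whiten s \<bullet> t = s \<bullet> whiten t"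
  using mat_sqrt_Vx_dot[of "whiten s" "whiten t"] by (simp add: sqrt_whiten)

lemma norm_whiten_tau_hat_x: "(norm (whiten (tauhx z)))\<^sup>2 = mahal iota eff n nq x z"
proof -
  let ?t = "tauhx z"
  have "Vx *v whiten (whiten ?t) = ?t"
    using sqrt_whiten(1) by (metis mat_sqrt(2)[OF Vxx_psd] matrix_vector_mul_assoc)
  then have "whiten (whiten ?t) = matrix_inv Vx *v ?t"
    by (metis matrix_inv_mult(2)[OF Vxx_invertible] matrix_vector_mul_assoc matrix_vector_mul_lid)
  moreover have "(norm (whiten ?t))\<^sup>2 = ?t \<bullet> whiten (whiten ?t)"
    using whiten_dot[of ?t "whiten ?t"] by (simp add: dot_square_norm)
  ultimately show ?thesis by (simp add: mahal_def)
qed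

end

context factorial_sequence begin

definition err :: "nat \<Rightarrow> (nat \<Rightarrow> 'q) \<Rightarrow> real^'f" where
  "err m z = sqrt (real (n m)) *\<^sub>R P.tauerr m z"

text \<open>For a fixed direction \<open>u\<close> the whitened covariate contrasts are rotated so that the regression
  part of \<open>u \<bullet> err\<close> becomes a multiple of the fixed unit vector \<open>e\<close>. Only the length of that multiple,
  which converges, then depends on the population.\<close>

lemma crfe_ball_limit:
  assumes Vp: "\<And>u. (\<lambda>m. real (n m) * (u \<bullet> (P.Vperp m *v u))) \<longlonglongrightarrow> u \<bullet> (Vp *v u)"
    and Vq: "\<And>u. (\<lambda>m. real (n m) * (u \<bullet> (P.Vpar m *v u))) \<longlonglongrightarrow> u \<bullet> (Vq *v u)"
    and pp: "0 \<le> u \<bullet> (Vp *v u)"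
    and w: "norm w = sqrt (u \<bullet> (Vq *v u))"
  shows "(\<lambda>m. \<integral>z. iexp (u \<bullet> err m z) * indicator {z. mahal iota eff (n m) (nq m) (x m) z \<le> a} z \<partial>measure_pmf (CRFE (n m) (nq m)))
     \<longlonglongrightarrow> of_real (exp (- (u \<bullet> (Vp *v u)) / 2)) * ball_char a (w :: real^('f \<times> 'l))"
proof -
  let ?N = "\<lambda>m. measure_pmf (CRFE (n m) (nq m))"
  let ?tx = "\<lambda>m z. P.tauhx m z"
  let ?R = "\<lambda>m. mat_sqrt (P.Vx m)"
  define r where "r = sqrt (u \<bullet> (Vq *v u))"
  obtain e :: "real^('f \<times> 'l)" where e: "norm e = 1" using vector_choose_size[of 1] by auto
  have "\<forall>m. \<exists>y. (\<forall>z \<in> assignments (n m) (nq m). u \<bullet> P.tauerr m z =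
       (\<Sum>i<n m. P.weight u (z i) * P.resid m i (z i) / real (nq m (z i))) + y \<bullet> ?tx m z) \<and>
    y \<bullet> (P.Vx m *v y) = u \<bullet> (P.Vpar m *v u)"
  proof
    fix m
    show "\<exists>y. (\<forall>z \<in> assignments (n m) (nq m). u \<bullet> P.tauerr m z =
       (\<Sum>i<n m. P.weight u (z i) * P.resid m i (z i) / real (nq m (z i))) + y \<bullet> ?tx m z) \<and>
      y \<bullet> (P.Vx m *v y) = u \<bullet> (P.Vpar m *v u)"
      by (rule P.projection_coefficient[of m u]) blast
  qed
  from choice[OF this] obtain yu where yu': "\<forall>m. (\<forall>z \<in> assignments (n m) (nq m). u \<bullet> P.tauerr m z =
       (\<Sum>i<n m. P.weight u (z i) * P.resid m i (z i) / real (nq m (z i))) + yu m \<bullet> ?tx m z) \<and>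
    yu m \<bullet> (P.Vx m *v yu m) = u \<bullet> (P.Vpar m *v u)" ..
  have yu: "\<And>m z. z \<in> assignments (n m) (nq m) \<Longrightarrow> u \<bullet> P.tauerr m z =
       (\<Sum>i<n m. P.weight u (z i) * P.resid m i (z i) / real (nq m (z i))) + yu m \<bullet> ?tx m z"
    "\<And>m. yu m \<bullet> (P.Vx m *v yu m) = u \<bullet> (P.Vpar m *v u)"
    using yu' by blast+
  define b where "b m = ?R m *v (sqrt (real (n m)) *\<^sub>R yu m)" for m
  have nb: "(norm (b m))\<^sup>2 = real (n m) * (u \<bullet> (P.Vpar m *v u))" for m
    unfolding b_def norm_mat_sqrt_sq[OF P.Vxx_psd] yu(2)[symmetric] by (simp add: matrix_vector_mult_scaleR)
  have rlim: "(\<lambda>m. norm (b m)) \<longlonglongrightarrow> r"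
  proof -
    have "(\<lambda>m. sqrt ((norm (b m))\<^sup>2)) \<longlonglongrightarrow> r" unfolding nb r_def by (intro tendsto_real_sqrt Vq)
    then show ?thesis by simp
  qed
  have "\<exists>T. orthogonal_transformation T \<and> T (b m) = norm (b m) *\<^sub>R e" for m
    by (rule orthogonal_transformation_exists[of "b m" "norm (b m) *\<^sub>R e"]) (auto simp: e)
  then obtain T where T: "\<And>m. orthogonal_transformation (T m)" "\<And>m. T m (b m) = norm (b m) *\<^sub>R e" by metis
  have invT: "inv (T m) (norm (b m) *\<^sub>R e) = b m" for m
    unfolding T(2)[symmetric] by (rule inv_f_f[OF orthogonal_transformation_inj[OF T(1)]])
  define W where "W m z = T m (P.whiten m (?tx m z))" for m z
  define yv where "yv m v = P.whiten m (inv (T m) v)" for m v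
  have yvW: "yv m v \<bullet> ?tx m z = v \<bullet> W m z" for m v z
    unfolding yv_def W_def P.whiten_dot orthogonal_transformation_dot_inv(1)[OF T(1)] ..
  have normW: "(norm (W m z))\<^sup>2 = mahal iota eff (n m) (nq m) (x m) z" for m z
    unfolding W_def P.norm_whiten_tau_hat_x[symmetric] using T(1)[of m] by (simp add: orthogonal_transformation)
  have yv_form: "yv m v \<bullet> (P.Vx m *v yv m v) = (norm v)\<^sup>2" for m v
    unfolding norm_mat_sqrt_sq[OF P.Vxx_psd, symmetric] yv_def P.sqrt_whiten orthogonal_transformation_dot_inv(2)[OF T(1)] ..
  have tot_form: "(sqrt (real (n m)) *\<^sub>R yu m + yv m v) \<bullet> (P.Vx m *v (sqrt (real (n m)) *\<^sub>R yu m + yv m v)) = (norm (norm (b m) *\<^sub>R e + v))\<^sup>2" for m v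
  proof -
    have lin: "linear (inv (T m))" using orthogonal_transformation_inv[OF T(1)] by (rule orthogonal_transformation_linear)
    have "?R m *v (sqrt (real (n m)) *\<^sub>R yu m + yv m v) = b m + inv (T m) v"
      unfolding matrix_vector_right_distrib b_def[symmetric] yv_def P.sqrt_whiten ..
    also have "\<dots> = inv (T m) (norm (b m) *\<^sub>R e + v)" unfolding linear_add[OF lin] invT ..
    finally show ?thesis unfolding norm_mat_sqrt_sq[OF P.Vxx_psd, symmetric]
      by (simp add: orthogonal_transformation_dot_inv(2)[OF T(1)])
  qed
  have V0: "(\<lambda>m. real (n m) * ((0::real^'f) \<bullet> (P.Vperp m *v 0))) \<longlonglongrightarrow> 0" by simp
  have asg: "\<forall>\<^sub>F m in sequentially. assignments (n m) (nq m) \<noteq> {}"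
    by (rule crfe_clt(2)[OF V0, of "\<lambda>_. 0" 0]) simp
  have transfer: "\<forall>\<^sub>F m in sequentially. (\<integral>z. f m z \<partial>?N m) = (\<integral>z. g m z \<partial>?N m)"
    if "\<And>m z. z \<in> assignments (n m) (nq m) \<Longrightarrow> f m z = g m z" for f g :: "nat \<Rightarrow> (nat \<Rightarrow> 'q) \<Rightarrow> complex"
    using asg
  proof eventually_elim
    case (elim m)
    have "set_pmf (CRFE (n m) (nq m)) = assignments (n m) (nq m)"
      unfolding CRFE_def by (rule set_pmf_of_set[OF elim finite_assignments])
    then show ?case using that by (intro integral_cong_AE) (auto simp: AE_measure_pmf_iff)
  qed
  have lim1: "(\<lambda>m. \<integral>z. iexp (v \<bullet> W m z) \<partial>?N m) \<longlonglongrightarrow> (\<integral>d. iexp (v \<bullet> d) \<partial>std_gauss)" for v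
  proof -
    have "(\<lambda>m. \<integral>z. iexp (\<Sum>i<n m. P.clt_array m 0 (yv m v) i (z i)) \<partial>?N m) \<longlonglongrightarrow> of_real (exp (- (0 + (norm v)\<^sup>2) / 2))"
      by (rule crfe_clt(1)[OF V0]) (simp add: yv_form)
    moreover have "(\<Sum>i<n m. P.clt_array m 0 (yv m v) i (z i)) = v \<bullet> W m z" if z: "z \<in> assignments (n m) (nq m)" for m z
      using P.clt_array_sum[OF z, of 0 0 "yv m v"] by (simp add: yvW P.weight_def)
    then have "\<forall>\<^sub>F m in sequentially. (\<integral>z. iexp (\<Sum>i<n m. P.clt_array m 0 (yv m v) i (z i)) \<partial>?N m) = (\<integral>z. iexp (v \<bullet> W m z) \<partial>?N m)"
      by (intro transfer) simp
    ultimately have "(\<lambda>m. \<integral>z. iexp (v \<bullet> W m z) \<partial>?N m) \<longlonglongrightarrow> of_real (exp (- (0 + (norm v)\<^sup>2) / 2))"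
      by (rule Lim_transform_eventually)
    then show ?thesis unfolding char_std_gauss by simp
  qed
  define K where "K = exp (- (u \<bullet> (Vp *v u)) / 2)"
  have K: "0 \<le> K" "K \<le> 1" using pp by (auto simp: K_def)
  have lim2: "(\<lambda>m. \<integral>z. iexp (u \<bullet> err m z) * iexp (v \<bullet> W m z) \<partial>?N m) \<longlonglongrightarrow>
     (\<integral>d. (of_real K * iexp ((r *\<^sub>R e) \<bullet> d)) * iexp (v \<bullet> d) \<partial>std_gauss)" for v
  proof -
    have "(\<lambda>m. \<integral>z. iexp (\<Sum>i<n m. P.clt_array m u (sqrt (real (n m)) *\<^sub>R yu m + yv m v) i (z i)) \<partial>?N m) \<longlonglongrightarrow>
       of_real (exp (- (u \<bullet> (Vp *v u) + (norm (r *\<^sub>R e + v))\<^sup>2) / 2))"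
      by (rule crfe_clt(1)[OF Vp]) (unfold tot_form, intro tendsto_power tendsto_norm tendsto_add tendsto_scaleR rlim tendsto_const)
    moreover have "iexp (\<Sum>i<n m. P.clt_array m u (sqrt (real (n m)) *\<^sub>R yu m + yv m v) i (z i)) = iexp (u \<bullet> err m z) * iexp (v \<bullet> W m z)"
      if z: "z \<in> assignments (n m) (nq m)" for m z
      unfolding P.clt_array_sum[OF z yu(1)[OF z]] yvW err_def[symmetric] of_real_add distrib_left exp_add ..
    then have "\<forall>\<^sub>F m in sequentially. (\<integral>z. iexp (\<Sum>i<n m. P.clt_array m u (sqrt (real (n m)) *\<^sub>R yu m + yv m v) i (z i)) \<partial>?N m) =
       (\<integral>z. iexp (u \<bullet> err m z) * iexp (v \<bullet> W m z) \<partial>?N m)"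
      by (intro transfer) simp
    ultimately have "(\<lambda>m. \<integral>z. iexp (u \<bullet> err m z) * iexp (v \<bullet> W m z) \<partial>?N m) \<longlonglongrightarrow> of_real (exp (- (u \<bullet> (Vp *v u) + (norm (r *\<^sub>R e + v))\<^sup>2) / 2))"
      by (rule Lim_transform_eventually)
    also have "of_real (exp (- (u \<bullet> (Vp *v u) + (norm (r *\<^sub>R e + v))\<^sup>2) / 2)) = (\<integral>d. (of_real K * iexp ((r *\<^sub>R e) \<bullet> d)) * iexp (v \<bullet> d) \<partial>std_gauss)"
    proof -
      have "(\<integral>d. (of_real K * iexp ((r *\<^sub>R e) \<bullet> d)) * iexp (v \<bullet> d) \<partial>std_gauss) = (\<integral>d. of_real K * iexp ((r *\<^sub>R e + v) \<bullet> d) \<partial>std_gauss)"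
        unfolding inner_add_left of_real_add distrib_left exp_add mult.assoc ..
      also have "\<dots> = of_real K * of_real (exp (- (norm (r *\<^sub>R e + v))\<^sup>2 / 2))"
        unfolding integral_mult_right_zero char_std_gauss ..
      also have "\<dots> = of_real (exp (- (u \<bullet> (Vp *v u) + (norm (r *\<^sub>R e + v))\<^sup>2) / 2))"
        unfolding K_def of_real_mult[symmetric] exp_add[symmetric] minus_add_distrib add_divide_distrib ..
      finally show ?thesis by simp
    qed
    finally show ?thesis .
  qed
  have "(\<lambda>m. \<integral>z. iexp (u \<bullet> err m z) * indicator {x. (norm x)\<^sup>2 \<le> a} (W m z) \<partial>?N m) \<longlonglongrightarrow>
     (\<integral>d. (of_real K * iexp ((r *\<^sub>R e) \<bullet> d)) * indicator {x. (norm x)\<^sup>2 \<le> a} d \<partial>std_gauss)"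
  proof (rule weighted_ball_tendsto[OF _ _ _ _ _ _ lim1 lim2])
    show "prob_space (?N m)" for m by (rule measure_pmf.prob_space_axioms)
    show "norm (of_real K * iexp ((r *\<^sub>R e) \<bullet> d)) \<le> 1" for d
      unfolding norm_mult norm_exp_i_times using K by simp
  qed auto
  moreover have "(\<integral>d. (of_real K * iexp ((r *\<^sub>R e) \<bullet> d)) * indicator {x. (norm x)\<^sup>2 \<le> a} d \<partial>std_gauss) = of_real K * ball_char a (r *\<^sub>R e)"
    unfolding ball_char_def mult.assoc integral_mult_right_zero ..
  moreover have "ball_char a (r *\<^sub>R e) = ball_char a w"
  proof (rule ball_char_radial)
    have "0 \<le> r" using w norm_ge_zero[of w] by (simp only: r_def)
    then show "norm (r *\<^sub>R e) = norm w" using e w by (simp add: r_def[symmetric])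
  qed
  moreover have "indicator {x. (norm x)\<^sup>2 \<le> a} (W m z) = (indicator {z. mahal iota eff (n m) (nq m) (x m) z \<le> a} z :: complex)" for m z
    by (simp add: indicator_def normW)
  ultimately show ?thesis unfolding K_def by simp
qed

lemma refm_char_limit:
  assumes a: "a > 0"
    and Vp: "\<And>u. (\<lambda>m. real (n m) * (u \<bullet> (P.Vperp m *v u))) \<longlonglongrightarrow> u \<bullet> (Vp *v u)"
    and Vq: "\<And>u. (\<lambda>m. real (n m) * (u \<bullet> (P.Vpar m *v u))) \<longlonglongrightarrow> u \<bullet> (Vq *v u)"
    and pp: "\<And>u. 0 \<le> u \<bullet> (Vp *v u)"
    and w: "norm w = sqrt (u \<bullet> (Vq *v u))"
  shows "(\<lambda>m. \<integral>z. iexp (u \<bullet> err m z) \<partial>measure_pmf (ReFM iota eff (n m) (nq m) (x m) a))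
     \<longlonglongrightarrow> of_real (exp (- (u \<bullet> (Vp *v u)) / 2)) * (ball_char a (w :: real^('f \<times> 'l)) / ball_char a (0 :: real^('f \<times> 'l)))"
proof -
  let ?N = "\<lambda>m. measure_pmf (CRFE (n m) (nq m))"
  let ?A = "\<lambda>m. {z. mahal iota eff (n m) (nq m) (x m) z \<le> a}"
  have b0: "ball_char a (0 :: real^('f \<times> 'l)) \<noteq> 0"
    unfolding ball_char_0 using std_gauss_ball_pos[OF a, where 'd="'f \<times> 'l"] by simp
  have L1: "(\<lambda>m. \<integral>z. iexp (u \<bullet> err m z) * indicator (?A m) z \<partial>?N m) \<longlonglongrightarrow> of_real (exp (- (u \<bullet> (Vp *v u)) / 2)) * ball_char a w"
    by (rule crfe_ball_limit[OF Vp Vq pp w])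
  have "(\<lambda>m. \<integral>z. iexp (0 \<bullet> err m z) * indicator (?A m) z \<partial>?N m) \<longlonglongrightarrow> of_real (exp (- (0 \<bullet> (Vp *v 0)) / 2)) * ball_char a (0 :: real^('f \<times> 'l))"
    by (rule crfe_ball_limit[OF Vp Vq pp]) simp
  moreover have "(\<integral>z. iexp (0 \<bullet> err m z) * indicator (?A m) z \<partial>?N m) = of_real (measure (?N m) (?A m))" for m
  proof -
    have "(\<integral>z. iexp (0 \<bullet> err m z) * indicator (?A m) z \<partial>?N m) = (\<integral>z. complex_of_real (indicator (?A m) z) \<partial>?N m)"
      by (intro Bochner_Integration.integral_cong refl) (simp add: indicator_def)
    then show ?thesis by simp
  qed
  ultimately have L0: "(\<lambda>m. complex_of_real (measure (?N m) (?A m))) \<longlonglongrightarrow> ball_char a (0 :: real^('f \<times> 'l))" by simp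
  have "\<forall>\<^sub>F m in sequentially. complex_of_real (measure (?N m) (?A m)) \<noteq> 0"
    by (rule tendsto_imp_eventually_ne[OF L0 b0])
  then have ev: "\<forall>\<^sub>F m in sequentially. (\<integral>z. iexp (u \<bullet> err m z) * indicator (?A m) z \<partial>?N m) / of_real (measure (?N m) (?A m)) =
     (\<integral>z. iexp (u \<bullet> err m z) \<partial>measure_pmf (ReFM iota eff (n m) (nq m) (x m) a))"
  proof eventually_elim
    case (elim m)
    then have "measure (?N m) (?A m) > 0" by (simp add: zero_less_measure_iff)
    then show ?case unfolding ReFM_def by (rule integral_cond_pmf[symmetric])
  qed
  have "(\<lambda>m. (\<integral>z. iexp (u \<bullet> err m z) * indicator (?A m) z \<partial>?N m) / of_real (measure (?N m) (?A m))) \<longlonglongrightarrow>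
     of_real (exp (- (u \<bullet> (Vp *v u)) / 2)) * ball_char a w / ball_char a (0 :: real^('f \<times> 'l))"
    by (rule tendsto_divide[OF L1 L0 b0])
  then have "(\<lambda>m. \<integral>z. iexp (u \<bullet> err m z) \<partial>measure_pmf (ReFM iota eff (n m) (nq m) (x m) a)) \<longlonglongrightarrow>
     of_real (exp (- (u \<bullet> (Vp *v u)) / 2)) * ball_char a w / ball_char a (0 :: real^('f \<times> 'l))"
    using ev by (rule Lim_transform_eventually)
  then show ?thesis by simp
qed

end

lemma norm_row_mat_sqrt_sq:
  fixes V :: "real^'n^'n"
  assumes V: "psd_mat V"
  shows "(norm (v v* mat_sqrt V))\<^sup>2 = v \<bullet> (V *v v)"
proof -
  have "transpose (mat_sqrt V) = mat_sqrt V" using mat_sqrt(1)[OF V] by (simp add: psd_mat_def)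
  then have "v v* mat_sqrt V = mat_sqrt V *v v" by (metis transpose_matrix_vector)
  then show ?thesis using norm_mat_sqrt_sq[OF V] by simp
qed

lemma psd_factor_pair:
  fixes V :: "real^'f^'f"
  assumes "psd_mat V"
  obtains C :: "real^('f \<times> 'l::finite)^'f" where "\<And>v. (norm (v v* C))\<^sup>2 = v \<bullet> (V *v v)"
proof -
  define l0 :: 'l where "l0 = undefined"
  let ?R = "mat_sqrt V"
  define C :: "real^('f \<times> 'l)^'f" where "C = (\<chi> f p. if snd p = l0 then ?R $ f $ fst p else 0)"
  have "(norm (v v* C))\<^sup>2 = v \<bullet> (V *v v)" for v :: "real^'f"
  proof -
  have "(norm (v v* C))\<^sup>2 = (\<Sum>p\<in>UNIV. ((v v* C) $ p)\<^sup>2)"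
    unfolding power2_norm_eq_inner by (simp add: inner_vec_def power2_eq_square)
  also have "\<dots> = (\<Sum>f\<in>UNIV. \<Sum>l\<in>UNIV. ((v v* C) $ (f, l))\<^sup>2)"
    by (simp add: UNIV_Times_UNIV[symmetric] sum.cartesian_product split_beta del: UNIV_Times_UNIV)
  also have "\<dots> = (\<Sum>f\<in>UNIV. \<Sum>l\<in>UNIV. if l = l0 then ((v v* ?R) $ f)\<^sup>2 else 0)"
    by (intro sum.cong refl) (auto simp: vector_matrix_mult_def C_def)
  also have "\<dots> = (norm (v v* ?R))\<^sup>2"
    unfolding power2_norm_eq_inner by (simp add: inner_vec_def power2_eq_square)
  finally show ?thesis unfolding norm_row_mat_sqrt_sq[OF assms] .
  qed
  then show thesis by (rule that)
qed

theorem theorem2: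
  fixes iota :: "'q::finite \<Rightarrow> 'k::finite \<Rightarrow> real"
    and eff :: "'f::finite \<Rightarrow> 'k set"
    and a :: real
    and n :: "nat \<Rightarrow> nat"
    and nq :: "nat \<Rightarrow> 'q \<Rightarrow> nat"
    and Y :: "nat \<Rightarrow> nat \<Rightarrow> 'q \<Rightarrow> real"
    and x :: "nat \<Rightarrow> nat \<Rightarrow> real^'l::finite"
  assumes design: "valid_design iota eff"
    and a_pos: "a > 0"
    and nq_pos: "\<And>m q. 1 \<le> nq m q"
    and nq_sum: "\<And>m. (\<Sum>q\<in>UNIV. nq m q) = n m"
    and n_lim: "filterlim n at_top sequentially"
    and cond_i: "\<And>q. \<exists>c>0. (\<lambda>m. real (nq m q) / real (n m)) \<longlonglongrightarrow> c"
    and cond_ii_Y: "\<And>q k. convergent (\<lambda>m. pcov (n m) (\<lambda>i. Y m i q) (\<lambda>i. Y m i k))"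
    and cond_ii_xx: "\<And>m. invertible (pcov_mat (n m) (x m))"
    and cond_ii_xx_lim: "\<exists>Sl. (\<lambda>m. pcov_mat (n m) (x m)) \<longlonglongrightarrow> Sl \<and> invertible Sl"
    and cond_ii_qx: "\<And>q. convergent (\<lambda>m. pcov_sv (n m) (\<lambda>i. Y m i q) (x m))"
    and cond_iii_Y: "\<And>q. (\<lambda>m. Max ((\<lambda>i. (Y m i q - pmean (n m) (\<lambda>j. Y m j q))\<^sup>2) ` {..<n m})
                             / real (n m)) \<longlonglongrightarrow> 0"
    and cond_iii_x: "(\<lambda>m. Max ((\<lambda>i. (norm (x m i - pmean (n m) (x m)))\<^sup>2) ` {..<n m})
                             / real (n m)) \<longlonglongrightarrow> 0"
  shows "\<forall>C :: nat \<Rightarrow> real^('f \<times> 'l)^'f.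
           (\<forall>m. C m ** transpose (C m) = Vmat iota eff (n m) (nq m) (Ypar (n m) (Y m) (x m))) \<longrightarrow>
           (\<exists>\<mu> :: (real^'f) measure. prob_space \<mu> \<and> sets \<mu> = sets borel \<and>
              weak_conv_to
                (\<lambda>m. distr (measure_pmf (ReFM iota eff (n m) (nq m) (x m) a)) borel
                   (\<lambda>z. sqrt (real (n m)) *\<^sub>R
                          (tau_hat iota eff (n m) (nq m) (Y m) z - tau_pop iota eff (n m) (Y m)))) \<mu> \<and>
              weak_conv_to
                (\<lambda>m. distr ((std_gauss :: (real^'f) measure) \<Otimes>\<^sub>M (trunc_gauss a :: (real^('f \<times> 'l)) measure))
                   borel
                   (\<lambda>(e, d). sqrt (real (n m)) *\<^sub>R
                      (mat_sqrt (Vmat iota eff (n m) (nq m) (Yperp (n m) (Y m) (x m))) *v e + C m *v d))) \<mu>)"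
proof (intro allI impI)
  fix C :: "nat \<Rightarrow> real^('f \<times> 'l)^'f"
  assume C: "\<forall>m. C m ** transpose (C m) = Vmat iota eff (n m) (nq m) (Ypar (n m) (Y m) (x m))"
  interpret factorial_sequence iota eff n nq Y x
    by unfold_locales (fact design nq_pos nq_sum n_lim cond_i cond_ii_Y cond_ii_xx cond_ii_xx_lim cond_ii_qx cond_iii_Y cond_iii_x)+
  let ?Vp = "\<lambda>m. Vmat iota eff (n m) (nq m) (Yperp (n m) (Y m) (x m))"
  let ?Vq = "\<lambda>m. Vmat iota eff (n m) (nq m) (Ypar (n m) (Y m) (x m))"
  let ?G = "(std_gauss :: (real^'f) measure) \<Otimes>\<^sub>M (trunc_gauss a :: (real^('f \<times> 'l)) measure)"
  have Vp_nonneg: "0 \<le> u \<bullet> (?Vp m *v u)" for m u using P.Vperp_psd[of m] by (simp add: psd_mat_def)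
  obtain Vp where Vp: "psd_mat Vp" "\<And>u. (\<lambda>m. real (n m) * (u \<bullet> (?Vp m *v u))) \<longlonglongrightarrow> u \<bullet> (Vp *v u)"
    using Vmat_limit[where Z="\<lambda>m. Yperp (n m) (Y m) (x m)", OF Yperp_cov_convergent Vp_nonneg] by blast
  obtain Vq where Vq: "psd_mat Vq" "\<And>u. (\<lambda>m. real (n m) * (u \<bullet> (?Vq m *v u))) \<longlonglongrightarrow> u \<bullet> (Vq *v u)"
    using Vmat_limit[where Z="\<lambda>m. Ypar (n m) (Y m) (x m)", OF Ypar_cov_convergent Vpar_nonneg] by blast
  obtain D :: "real^('f \<times> 'l)^'f" where D: "\<And>v. (norm (v v* D))\<^sup>2 = v \<bullet> (Vq *v v)" by (rule psd_factor_pair[OF Vq(1)]) blast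
  have C_row: "(norm (v v* C m))\<^sup>2 = v \<bullet> (?Vq m *v v)" for v m
  proof -
    have "(norm (v v* C m))\<^sup>2 = v \<bullet> (C m *v (v v* C m))" unfolding power2_norm_eq_inner dot_lmul_matrix ..
    also have "C m *v (v v* C m) = (C m ** transpose (C m)) *v v"
      by (simp add: matrix_vector_mul_assoc[symmetric] del: transpose_matrix_vector) (simp add: transpose_matrix_vector)
    finally show ?thesis using C by simp
  qed
  interpret T: prob_space "trunc_gauss a :: (real^('f \<times> 'l)) measure" by (rule prob_space_trunc_gauss[OF a_pos])
  interpret G: pair_prob_space "std_gauss :: (real^'f) measure" "trunc_gauss a :: (real^('f \<times> 'l)) measure" ..
  have meas: "(\<lambda>(e, d). s *\<^sub>R (R *v e + E *v d)) \<in> borel_measurable ?G" for s :: real and R :: "real^'f^'f" and E :: "real^('f \<times> 'l)^'f"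
    by measurable
  define \<mu> where "\<mu> = distr ?G borel (\<lambda>(e, d). 1 *\<^sub>R (mat_sqrt Vp *v e + D *v d))"
  have char_mu: "(\<integral>y. iexp (v \<bullet> y) \<partial>\<mu>) = of_real (exp (- (v \<bullet> (Vp *v v)) / 2)) * (ball_char a (v v* D) / ball_char a (0::real^('f \<times> 'l)))" for v
    unfolding \<mu>_def char_gauss_plus_trunc[OF a_pos] norm_row_mat_sqrt_sq[OF Vp(1)] by simp
  have prob_mu: "prob_space \<mu>" unfolding \<mu>_def by (rule G.prob_space_distr[OF meas])
  have sets_mu: "sets \<mu> = sets borel" by (simp add: \<mu>_def)
  have "weak_conv_to (\<lambda>m. distr (measure_pmf (ReFM iota eff (n m) (nq m) (x m) a)) borel (err m)) \<mu>"
  proof (rule levy_continuity_vec[OF _ _ prob_mu sets_mu])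
    show "prob_space (distr (measure_pmf (ReFM iota eff (n m) (nq m) (x m) a)) borel (err m))" for m
      by (rule measure_pmf.prob_space_distr) simp
    fix v
    have w: "norm (v v* D) = sqrt (v \<bullet> (Vq *v v))" using D[of v] by (metis norm_ge_zero real_sqrt_unique)
    have "0 \<le> u \<bullet> (Vp *v u)" for u using Vp(1) by (simp add: psd_mat_def)
    from refm_char_limit[OF a_pos Vp(2) Vq(2) this w]
    show "(\<lambda>m. \<integral>y. iexp (v \<bullet> y) \<partial>distr (measure_pmf (ReFM iota eff (n m) (nq m) (x m) a)) borel (err m)) \<longlonglongrightarrow> (\<integral>y. iexp (v \<bullet> y) \<partial>\<mu>)"
      unfolding char_mu by (subst integral_distr) simp_all
  qed simp
  moreover have "weak_conv_to (\<lambda>m. distr ?G borel (\<lambda>(e, d). sqrt (real (n m)) *\<^sub>R (mat_sqrt (?Vp m) *v e + C m *v d))) \<mu>"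
  proof (rule levy_continuity_vec[OF _ _ prob_mu sets_mu])
    show "prob_space (distr ?G borel (\<lambda>(e, d). sqrt (real (n m)) *\<^sub>R (mat_sqrt (?Vp m) *v e + C m *v d)))" for m
      by (rule G.prob_space_distr[OF meas])
    fix v
    have "(\<lambda>m. norm (sqrt (real (n m)) *\<^sub>R (v v* C m))) \<longlonglongrightarrow> norm (v v* D)"
    proof -
      have "norm (sqrt (real (n m)) *\<^sub>R (v v* C m)) = sqrt (real (n m) * (v \<bullet> (?Vq m *v v)))" for m
        unfolding C_row[symmetric] by (simp add: real_sqrt_mult)
      moreover have "norm (v v* D) = sqrt (v \<bullet> (Vq *v v))" unfolding D[symmetric] by simp
      ultimately show ?thesis using tendsto_real_sqrt[OF Vq(2)[of v]] by simp
    qed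
    from ball_char_tendsto[OF this, of a]
    show "(\<lambda>m. \<integral>y. iexp (v \<bullet> y) \<partial>distr ?G borel (\<lambda>(e, d). sqrt (real (n m)) *\<^sub>R (mat_sqrt (?Vp m) *v e + C m *v d))) \<longlonglongrightarrow> (\<integral>y. iexp (v \<bullet> y) \<partial>\<mu>)"
      unfolding char_gauss_plus_trunc[OF a_pos] char_mu norm_row_mat_sqrt_sq[OF P.Vperp_psd] real_sqrt_pow2[OF of_nat_0_le_iff]
      using std_gauss_ball_pos[OF a_pos, where 'd="'f \<times> 'l"]
      by (intro tendsto_mult tendsto_divide tendsto_of_real tendsto_exp tendsto_minus tendsto_const Vp(2)) (simp_all add: ball_char_0)
  qed simp
  ultimately show "\<exists>\<mu> :: (real^'f) measure. prob_space \<mu> \<and> sets \<mu> = sets borel \<and>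
      weak_conv_to (\<lambda>m. distr (measure_pmf (ReFM iota eff (n m) (nq m) (x m) a)) borel
         (\<lambda>z. sqrt (real (n m)) *\<^sub>R (tau_hat iota eff (n m) (nq m) (Y m) z - tau_pop iota eff (n m) (Y m)))) \<mu> \<and>
      weak_conv_to (\<lambda>m. distr ?G borel (\<lambda>(e, d). sqrt (real (n m)) *\<^sub>R (mat_sqrt (?Vp m) *v e + C m *v d))) \<mu>"
    using prob_mu sets_mu unfolding err_def[abs_def] by blast
qed

end
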